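(* Let $\vartheta_0,\tilde\vartheta_1,\vartheta_\infty\in\mathbb C$ and $$H(q,p,x,\epsilon)=-\tfrac{(\vartheta_0+\tilde\vartheta_1)^2-\vartheta_\infty^2}{4}\big((x-\epsilon)q-x\big)+x\vartheta_0p+\big(1-\epsilon-(x-\epsilon)\vartheta_0-x(\vartheta_0+\tilde\vartheta_1)\big)qp+(2x-\epsilon)(qp)^2+(x-\epsilon)(\vartheta_0+\tilde\vartheta_1)q^2p-xqp^2-(x-\epsilon)q^3p^2.$$ Then the formal invariant of the system $x(x-\epsilon)\frac{dq}{dx}=\frac{\partial H}{\partial p}$, $x(x-\epsilon)\frac{dp}{dx}=-\frac{\partial H}{\partial q}$ (with $y=(q,p)$) is $$\chi(h,x,\epsilon)=1-\epsilon-(x-\epsilon)\vartheta_0-x(\vartheta_0+\tilde\vartheta_1)+2(2x-\epsilon)h.$$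
   Context: For a system $x(x-\epsilon)\frac{dy_1}{dx}=\partial_{y_2}H$, $x(x-\epsilon)\frac{dy_2}{dx}=-\partial_{y_1}H$ with $H$ an analytic germ at $0\in\mathbb C^2\times\mathbb C^2$ such that $H(\cdot,0,0)$ has a non-degenerate critical point at $0$: for small $(x,\epsilon)$ let $G_H(h,x,\epsilon)$ be the Birkhoff–Siegel normal form of $(H(\cdot,x,\epsilon),dy_1\wedge dy_2)$ at its critical point near $0$, i.e. there are analytic coordinates $u$ with $du_1\wedge du_2=dy_1\wedge dy_2$ and $H=G_H(u_1u_2,x,\epsilon)$ ($G_H$ is unique up to $G_H(h)\mapsto G_H(-h)$). The formal invariant is the function $\chi(h,x,\epsilon)=\chi^{(0)}(h,\epsilon)+x\chi^{(1)}(h,\epsilon)$, affine in $x$, with $\chi\equiv\partial_hG_H\bmod x(x-\epsilon)$; it is defined up to the involution $\chi(h,x,\epsilon)\mapsto-\chi(-h,x,\epsilon)$. This system is obtained from the sixth Painlevé Hamiltonian system by the confluence $t=1+\epsilon\tilde t$, $x=1/\tilde t+\epsilon$. *)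

theory Defs
  imports "HOL-Analysis.Analysis"
begin

text \<open>Points of C^2 are pairs (y1,y2); points of C^3 are triples (h,x,eps).
Holomorphy of a function of several complex variables on an open set is
rendered as continuity plus holomorphy in each variable separately
(equivalent by Osgood's lemma).\<close>

definition hol2 :: "(complex \<times> complex) set \<Rightarrow> (complex \<times> complex \<Rightarrow> complex) \<Rightarrow> bool" where
  "hol2 U f \<longleftrightarrow> open U \<and> continuous_on U f \<and>
     (\<forall>a b. (a, b) \<in> U \<longrightarrow>
        (\<lambda>z. f (z, b)) field_differentiable at a \<and> (\<lambda>z. f (a, z)) field_differentiable at b)"

definition hol3 :: "(complex \<times> complex \<times> complex) set \<Rightarrow> (complex \<times> complex \<times> complex \<Rightarrow> complex) \<Rightarrow> bool" where
  "hol3 U f \<longleftrightarrow> open U \<and> continuous_on U f \<and>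
     (\<forall>a b c. (a, b, c) \<in> U \<longrightarrow>
        (\<lambda>z. f (z, b, c)) field_differentiable at a \<and>
        (\<lambda>z. f (a, z, c)) field_differentiable at b \<and>
        (\<lambda>z. f (a, b, z)) field_differentiable at c)"

definition symplectic_chart ::
  "(complex \<times> complex) set \<Rightarrow> (complex \<times> complex \<Rightarrow> complex) \<Rightarrow> (complex \<times> complex \<Rightarrow> complex) \<Rightarrow> bool" where
  "symplectic_chart U \<Phi>1 \<Phi>2 \<longleftrightarrow> hol2 U \<Phi>1 \<and> hol2 U \<Phi>2 \<and>
     inj_on (\<lambda>y. (\<Phi>1 y, \<Phi>2 y)) U \<and>
     (\<forall>a b. (a, b) \<in> U \<longrightarrow>
        deriv (\<lambda>z. \<Phi>1 (z, b)) a * deriv (\<lambda>z. \<Phi>2 (a, z)) b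
        - deriv (\<lambda>z. \<Phi>1 (a, z)) b * deriv (\<lambda>z. \<Phi>2 (z, b)) a = 1)"

text \<open>G is (an analytic germ of) the Birkhoff--Siegel normal form G_H(h,x,eps) of
(H(.,x,eps), dy1 /\ dy2) at its critical point c(x,eps) near 0: G analytic near 0 in C^3,
c a continuous branch with c(0,0) = 0, and for every small (x,eps) there are
symplectic analytic coordinates u centred at c(x,eps) with H = G(u1 u2, x, eps).\<close>

definition birkhoff_normal_form ::
  "(complex \<times> complex \<Rightarrow> complex \<Rightarrow> complex \<Rightarrow> complex) \<Rightarrow> (complex \<times> complex \<times> complex \<Rightarrow> complex) \<Rightarrow> bool" where
  "birkhoff_normal_form H G \<longleftrightarrow>
     (\<exists>W. hol3 W G \<and> (0, 0, 0) \<in> W \<and>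
       (\<exists>r>0. \<exists>c :: complex \<times> complex \<Rightarrow> complex \<times> complex.
          continuous_on {(x, e). cmod x < r \<and> cmod e < r} c \<and> c (0, 0) = (0, 0) \<and>
          (\<forall>x e. cmod x < r \<and> cmod e < r \<longrightarrow>
             (\<exists>U \<Phi>1 \<Phi>2. c (x, e) \<in> U \<and> symplectic_chart U \<Phi>1 \<Phi>2 \<and>
                 \<Phi>1 (c (x, e)) = 0 \<and> \<Phi>2 (c (x, e)) = 0 \<and>
                 (\<forall>y\<in>U. (\<Phi>1 y * \<Phi>2 y, x, e) \<in> W \<and>
                         H y x e = G (\<Phi>1 y * \<Phi>2 y, x, e))))))"

text \<open>chi is (a representative of) the formal invariant: affine in x and
chi = d/dh G_H  mod x(x - eps) in the ring of analytic germs at 0 in (h,x,eps).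
Since G_H is unique up to G(h) -> G(-h), this fixes chi up to the involution
chi(h,x,eps) -> -chi(-h,x,eps).\<close>

definition formal_invariant ::
  "(complex \<times> complex \<Rightarrow> complex \<Rightarrow> complex \<Rightarrow> complex) \<Rightarrow> (complex \<Rightarrow> complex \<Rightarrow> complex \<Rightarrow> complex) \<Rightarrow> bool" where
  "formal_invariant H chi \<longleftrightarrow>
     (\<exists>chi0 chi1. \<forall>h x e. chi h x e = chi0 h e + x * chi1 h e) \<and>
     (\<exists>G. birkhoff_normal_form H G \<and>
        (\<exists>V k. hol3 V k \<and> (0, 0, 0) \<in> V \<and>
           (\<forall>h x e. (h, x, e) \<in> V \<longrightarrow>
              deriv (\<lambda>t. G (t, x, e)) h - chi h x e = x * (x - e) * k (h, x, e))))"

text \<open>The Hamiltonian obtained from Painleve VI by confluence; y = (q,p).\<close>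

definition H_conf :: "complex \<Rightarrow> complex \<Rightarrow> complex \<Rightarrow> complex \<times> complex \<Rightarrow> complex \<Rightarrow> complex \<Rightarrow> complex" where
  "H_conf \<theta>0 \<theta>1 \<theta>inf y x e = (case y of (q, p) \<Rightarrow>
      - (((\<theta>0 + \<theta>1)^2 - \<theta>inf^2) / 4) * ((x - e) * q - x)
      + x * \<theta>0 * p
      + (1 - e - (x - e) * \<theta>0 - x * (\<theta>0 + \<theta>1)) * q * p
      + (2 * x - e) * (q * p)^2
      + (x - e) * (\<theta>0 + \<theta>1) * q^2 * p
      - x * q * p^2
      - (x - e) * q^3 * p^2)"

end

(*
  For |q| = 1 and small (x, e) the level H = E has a single small root p(q, E); the action is
  F(E) = (1 / 2 pi i) times the integral of p dq over this fixed circle, and G is its inverse in E.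
  Both are explicit circle integrals, so they are jointly analytic in all variables without any
  implicit function theorem.

  For fixed (x, e) a symplectic shift p = f(q) + P along one branch of the critical level makes the
  Hamiltonian E0 + v1 v2 with v1 = D(q) + a(q) P, v2 = P.  With J = dq dP / dv1 dv2, the symplectic
  coordinates are u1 = v1 exp(W / j0), u2 = v2 m exp(-W / j0), where j0 is the average of J over the
  circle action (v1, v2) -> (t v1, v2 / t) and W solves the linear equation v1 W_1 - v2 W_2 = J - j0.
  Then u1 u2 = F(H), the residue being independent of the circle.

  On x = 0 and on x = e the integrand of F extends holomorphically to q = 0, respectively to
  q = infinity, so F satisfies a quadratic equation there, which gives dG/dh = chi on x (x - e) = 0.
*)

theory Submission
  imports Defs "HOL-Complex_Analysis.Complex_Analysis"
begin

section \<open>Means over the unit circle\<close>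

text \<open>At \<open>x = e = 0\<close> the Hamiltonian is \<open>q * p\<close>, and every
  construction perturbs that case: \<open>D\<close> and \<open>Hp\<close> stay near
  \<open>q\<close>, \<open>Hq\<close> near \<open>p\<close>, \<open>F\<close> near the identity.
  Joint analyticity is required of \<open>G\<close> alone; the centre need only be continuous and
  the charts may be unrelated for different \<open>(x, e)\<close>. So \<open>G\<close> comes from a
  circle that does not move with the critical point, while charts are built at frozen parameters.
  The obstacle there is that \<open>(v1, v2)\<close> is not symplectic: \<open>J\<close> is not a
  function of \<open>v1 * v2\<close> in general. Its mean \<open>j0\<close> is one, and it is
  matched by the derivative of \<open>z * m z\<close>; only the remainder \<open>J - j0\<close> has
  to be removed by \<open>W\<close>. The formula for \<open>chi\<close> is an interpolation. The two
  quadratic relations read \<open>E = b0 * h - e * h^2\<close> on \<open>x = 0\<close> and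
  \<open>E = A * e + b0 * h + e * h^2\<close> on \<open>x = e\<close>; their
  \<open>h\<close>-derivatives are the values of \<open>chi\<close> there. Vanishing of
  \<open>dG/dh - chi\<close> on both lines gives divisibility by \<open>x * (x - e)\<close> through
  a Cauchy integral, which keeps the quotient analytic near \<open>e = 0\<close>, where the two
  zeros in \<open>x\<close> merge.\<close>

definition cmean :: "(complex \<Rightarrow> complex) \<Rightarrow> complex" where
  "cmean f = integral {0..1} (\<lambda>t::real. f (cis (2 * pi * t)))"

lemma cmean_cong:
  assumes "\<And>z. norm z = 1 \<Longrightarrow> f z = g z"
  shows "cmean f = cmean g"
  unfolding cmean_def by (intro integral_cong) (simp add: assms)

lemma continuous_on_cis_compose:
  fixes f :: "complex \<Rightarrow> complex"
  assumes "continuous_on (sphere 0 1) f"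
  shows "continuous_on A (\<lambda>t::real. f (cis (2 * pi * t)))"
  by (intro continuous_on_compose2[OF assms] continuous_intros) auto

lemma cmean_integrable:
  fixes f :: "complex \<Rightarrow> complex"
  assumes "continuous_on (sphere 0 1) f"
  shows "(\<lambda>t::real. f (cis (2 * pi * t))) integrable_on {0..1}"
  by (rule integrable_continuous_interval[OF continuous_on_cis_compose[OF assms]])

lemma cmean_diff:
  assumes "continuous_on (sphere 0 1) f" "continuous_on (sphere 0 1) g"
  shows "cmean (\<lambda>z. f z - g z) = cmean f - cmean g"
  unfolding cmean_def by (rule Henstock_Kurzweil_Integration.integral_diff[OF cmean_integrable[OF assms(1)] cmean_integrable[OF assms(2)]])

lemma cmean_add:
  assumes "continuous_on (sphere 0 1) f" "continuous_on (sphere 0 1) g"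
  shows "cmean (\<lambda>z. f z + g z) = cmean f + cmean g"
  unfolding cmean_def by (rule Henstock_Kurzweil_Integration.integral_add[OF cmean_integrable[OF assms(1)] cmean_integrable[OF assms(2)]])

lemma cmean_mult_left: "cmean (\<lambda>z. c * f z) = c * cmean f"
  unfolding cmean_def by simp

lemma cmean_const: "cmean (\<lambda>z. c) = c"
  unfolding cmean_def by simp

lemma cmean_bound:
  assumes "continuous_on (sphere 0 1) f" "\<And>z. norm z = 1 \<Longrightarrow> norm (f z - c) \<le> B"
  shows "norm (cmean f - c) \<le> B"
proof -
  have g: "continuous_on (sphere 0 1) (\<lambda>z. f z - c)"
    by (intro continuous_intros assms)
  have "norm (cmean f - c) = norm (cmean (\<lambda>z. f z - c))"
    by (subst cmean_diff) (simp_all add: assms cmean_const)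
  also have "\<dots> \<le> B * (1 - 0)"
    unfolding cmean_def
    by (rule integral_bound[OF _ continuous_on_cis_compose[OF g]]) (auto intro!: assms)
  finally show ?thesis by simp
qed

text \<open>On the unit circle inversion is \<open>t\<close> to \<open>- t\<close>; a shift by one
  period returns to the original interval. This is what later exchanges \<open>q = 0\<close> and
  \<open>q = \<infinity>\<close>.\<close>

lemma cmean_inverse: "cmean (\<lambda>z. f (inverse z)) = cmean f"
proof -
  have "cmean (\<lambda>z. f (inverse z)) = integral {0..1} (\<lambda>t. f (cis (2 * pi * (- t))))"
    unfolding cmean_def by (simp add: cis_inverse)
  also have "\<dots> = integral {- 1..- 0} (\<lambda>t. f (cis (2 * pi * t)))"
    using Henstock_Kurzweil_Integration.integral_reflect_real[of 0 "- 1" "\<lambda>t. f (cis (2 * pi * t))"]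
    by (simp del: Henstock_Kurzweil_Integration.integral_reflect_real)
  also have "\<dots> = integral {0 - 1..1 - 1} (\<lambda>t. f (cis (2 * pi * (t + 1))))"
  proof -
    have "cis (2 * pi * (t + 1)) = cis (2 * pi * t)" for t
      by (simp add: complex_eq_iff distrib_left)
    then show ?thesis by simp
  qed
  also have "\<dots> = cmean f"
    unfolding cmean_def by (rule integral_shift_real_ivl)
  finally show ?thesis .
qed

lemma continuous_on_cmean:
  fixes f :: "'a::topological_space \<Rightarrow> complex \<Rightarrow> complex"
  assumes "continuous_on (U \<times> sphere 0 1) (\<lambda>(s, z). f s z)"
  shows "continuous_on U (\<lambda>s. cmean (f s))"
proof -
  have "continuous_on (U \<times> cbox 0 1) (\<lambda>(s, t::real). f s (cis (2 * pi * t)))"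
    unfolding split_beta
    by (rule continuous_on_compose2[OF assms, of _ "\<lambda>y. (fst y, cis (2 * pi * snd y))", simplified])
       (auto intro!: continuous_intros)
  from integral_continuous_on_param[OF this] show ?thesis
    by (simp add: cmean_def cbox_interval)
qed

text \<open>On the unit circle \<open>dz = 2 * pi * \<i> * z dt\<close>; hence the extra factor
  \<open>z\<close> in all residue formulas written as means.\<close>

lemma cmean_eq_contour_integral:
  "contour_integral (circlepath 0 1) f = 2 * pi * \<i> * cmean (\<lambda>z. z * f z)"
proof -
  have "contour_integral (circlepath 0 1) f =
      integral {0..1} (\<lambda>t. 2 * pi * \<i> * (cis (2 * pi * t) * f (cis (2 * pi * t))))"
    unfolding contour_integral_integral
  proof (rule integral_cong)
    fix t :: real assume "t \<in> {0..1}"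
    have "exp (2 * complex_of_real pi * \<i> * complex_of_real t) = cis (2 * pi * t)"
      by (simp add: cis_conv_exp mult_ac)
    then show "f (circlepath 0 1 t) * vector_derivative (circlepath 0 1) (at t) =
        2 * pi * \<i> * (cis (2 * pi * t) * f (cis (2 * pi * t)))"
      by (simp add: vector_derivative_circlepath) (simp add: circlepath mult_ac)
  qed
  then show ?thesis by (simp add: cmean_def)
qed

lemma cmean_Cauchy:
  assumes "f holomorphic_on ball 0 R" "1 < R" "norm w < 1"
  shows "cmean (\<lambda>z. z * f z / (z - w)) = f w"
proof -
  have "((\<lambda>u. f u / (u - w)) has_contour_integral (2 * of_real pi * \<i> * f w)) (circlepath 0 1)"
  proof (rule Cauchy_integral_circlepath)
    show "continuous_on (cball 0 1) f"
      by (intro holomorphic_on_imp_continuous_on holomorphic_on_subset[OF assms(1)])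
        (use assms(2) in \<open>force simp: subset_iff\<close>)
    show "f holomorphic_on ball 0 1"
      by (rule holomorphic_on_subset[OF assms(1)]) (use assms(2) in auto)
  qed (use assms in auto)
  from contour_integral_unique[OF this] show ?thesis
    by (simp add: cmean_eq_contour_integral)
qed

lemma cmean_mean_value:
  assumes "f holomorphic_on ball 0 R" "1 < R"
  shows "cmean f = f 0"
proof -
  have "cmean f = cmean (\<lambda>z. z * f z / (z - 0))"
    by (rule cmean_cong) auto
  then show ?thesis using cmean_Cauchy[OF assms, of 0] by simp
qed

text \<open>Cauchy's formula for the derivative, rescaled to the unit circle. It transfers
  continuity and bounds from a function to its derivative.\<close>

lemma deriv_eq_cmean:
  fixes r :: real
  assumes g: "g holomorphic_on ball s R" and r: "0 < r" "r < R"
  shows "deriv g s = cmean (\<lambda>z. g (s + r * z) / z) / r"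
proof -
  let ?h = "\<lambda>z::complex. g (s + r * z)"
  have hol: "?h holomorphic_on ball 0 (R / r)"
  proof (rule holomorphic_on_compose_gen[unfolded o_def, OF _ g])
    show "(\<lambda>z::complex. s + r * z) ` ball 0 (R / r) \<subseteq> ball s R"
      using r by (auto simp: dist_norm norm_mult pos_less_divide_eq mult.commute)
  qed (intro holomorphic_intros)
  have "1 < R / r" using r by simp
  then have "contour_integral (circlepath 0 1) (\<lambda>u. ?h u / (u - 0)^2) = 2 * pi * \<i> * deriv ?h 0"
    by (intro Cauchy_contour_integral_circlepath_2 holomorphic_on_imp_continuous_on
        holomorphic_on_subset[OF hol]) auto
  moreover have "(?h has_field_derivative (deriv g s * r)) (at 0)"
  proof (rule DERIV_chain2[where f = g])
    show "(g has_field_derivative deriv g s) (at (s + of_real r * 0))"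
      using r by (intro holomorphic_derivI[OF g, THEN DERIV_cong]) auto
    show "((\<lambda>z::complex. s + r * z) has_field_derivative r) (at 0)"
      by (auto intro!: derivative_eq_intros)
  qed
  then have "deriv ?h 0 = r * deriv g s"
    by (simp add: DERIV_imp_deriv mult.commute)
  ultimately have "cmean (\<lambda>z. z * (?h z / (z - 0)^2)) = r * deriv g s"
    by (simp add: cmean_eq_contour_integral)
  moreover have "cmean (\<lambda>z. z * (?h z / (z - 0)^2)) = cmean (\<lambda>z. g (s + r * z) / z)"
    by (rule cmean_cong) (auto simp: power2_eq_square)
  ultimately show ?thesis using r by (simp add: field_simps)
qed

text \<open>The derivative is a mean over circles of the fixed radius \<open>R / 4\<close>. Centres
  in the half ball keep these circles inside \<open>ball s R\<close>, and a mean of a jointly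
  continuous function is continuous.\<close>

lemma continuous_on_deriv_param:
  fixes f :: "complex \<Rightarrow> 'a::topological_space \<Rightarrow> complex"
  assumes cont: "continuous_on (ball s R \<times> A) (\<lambda>(s, z). f s z)"
    and hol: "\<And>z. z \<in> A \<Longrightarrow> (\<lambda>s. f s z) holomorphic_on ball s R"
  shows "continuous_on (ball s (R / 2) \<times> A) (\<lambda>(s, z). deriv (\<lambda>s. f s z) s)"
proof (cases "R > 0")
  case True
  have *: "norm (s - (s' + of_real (R / 4) * z)) < R" "norm (s' + of_real (R / 4) * z - s) < R"
    if "norm (s - s') < R / 2" "norm z = 1" for s' z :: complex
  proof -
    have "norm (s - (s' + of_real (R / 4) * z)) \<le> norm (s - s') + norm (of_real (R / 4) * z)"
      by (metis diff_diff_eq norm_triangle_ineq4)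
    then show "norm (s - (s' + of_real (R / 4) * z)) < R"
      using that True by (simp add: norm_mult)
    then show "norm (s' + of_real (R / 4) * z - s) < R"
      by (simp add: norm_minus_commute)
  qed
  have "continuous_on ((ball s (R / 2) \<times> A) \<times> sphere 0 1)
      (\<lambda>y. f (fst (fst y) + of_real (R / 4) * snd y) (snd (fst y)))"
  proof -
    have c: "continuous_on ((ball s (R / 2) \<times> A) \<times> sphere 0 1)
        (\<lambda>y. (fst (fst y) + of_real (R / 4) * snd y, snd (fst y)))"
      by (intro continuous_intros)
    have "(\<lambda>y. (fst (fst y) + of_real (R / 4) * snd y, snd (fst y))) `
        ((ball s (R / 2) \<times> A) \<times> sphere 0 1) \<subseteq> ball s R \<times> A"
      using *(1) by (auto simp: dist_norm simp del: of_real_divide)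
    from continuous_on_compose2[OF cont c this] show ?thesis
      by (simp add: split_beta)
  qed
  then have "continuous_on ((ball s (R / 2) \<times> A) \<times> sphere 0 1)
      (\<lambda>((s', z), w::complex). f (s' + of_real (R / 4) * w) z / w)"
    unfolding split_beta by (intro continuous_intros) auto
  then have "continuous_on (ball s (R / 2) \<times> A)
      (\<lambda>y. cmean (\<lambda>w. f (fst y + of_real (R / 4) * w) (snd y) / w) / of_real (R / 4))"
    using True by (intro continuous_intros continuous_on_cmean) (auto simp: split_beta)
  moreover have "deriv (\<lambda>s. f s (snd y)) (fst y) =
      cmean (\<lambda>w. f (fst y + of_real (R / 4) * w) (snd y) / w) / of_real (R / 4)"
    if "y \<in> ball s (R / 2) \<times> A" for y
  proof -
    have "ball (fst y) (R / 2) \<subseteq> ball s R"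
    proof
      fix w assume "w \<in> ball (fst y) (R / 2)"
      moreover have "dist s (fst y) < R / 2" using that by auto
      ultimately show "w \<in> ball s R"
        using dist_triangle[of s w "fst y"] by simp
    qed
    then have "(\<lambda>s. f s (snd y)) holomorphic_on ball (fst y) (R / 2)"
      using that by (intro holomorphic_on_subset[OF hol]) auto
    from deriv_eq_cmean[OF this, of "R / 4"] show ?thesis
      using True by simp
  qed
  ultimately show ?thesis
    by (auto simp: split_beta cong: continuous_on_cong)
qed (simp add: ball_empty)

text \<open>The Leibniz rule asks for joint continuity of the derivative; holomorphy supplies it on
  a small ball, so joint continuity of \<open>f\<close> itself is enough.\<close>

lemma cmean_has_field_derivative:
  assumes "open V" and cont: "continuous_on (V \<times> sphere 0 1) (\<lambda>(s, z). f s z)"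
    and hol: "\<And>z. norm z = 1 \<Longrightarrow> (\<lambda>s. f s z) holomorphic_on V" and "s \<in> V"
  shows "((\<lambda>s. cmean (f s)) has_field_derivative cmean (\<lambda>z. deriv (\<lambda>s. f s z) s)) (at s)"
proof -
  obtain R where R: "R > 0" "ball s R \<subseteq> V"
    using assms(1,4) by (meson open_contains_ball)
  let ?B = "ball s (R / 2)"
  have BV: "?B \<subseteq> V" using R by (auto simp: subset_iff)
  have d: "continuous_on (?B \<times> sphere 0 1) (\<lambda>(s, z). deriv (\<lambda>s. f s z) s)"
  proof (rule continuous_on_deriv_param)
    show "continuous_on (ball s R \<times> sphere 0 1) (\<lambda>(s, z). f s z)"
      by (rule continuous_on_subset[OF cont]) (use R in auto)
    show "(\<lambda>s. f s z) holomorphic_on ball s R" if "z \<in> sphere 0 1" for z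
      using that by (intro holomorphic_on_subset[OF hol R(2)]) simp
  qed
  have c: "continuous_on (?B \<times> cbox 0 1) (\<lambda>y. (fst y, cis (2 * pi * snd y)))"
    by (intro continuous_intros)
  have "(\<lambda>y. (fst y, cis (2 * pi * snd y))) ` (?B \<times> cbox 0 1) \<subseteq> ?B \<times> sphere 0 1"
    by auto
  from continuous_on_compose2[OF d c this]
  have 1: "continuous_on (?B \<times> cbox 0 1) (\<lambda>(s', t::real). deriv (\<lambda>s. f s (cis (2 * pi * t))) s')"
    by (simp add: split_beta)
  have "((\<lambda>s. integral (cbox 0 1) (\<lambda>t. f s (cis (2 * pi * t)))) has_field_derivative
      integral (cbox 0 1) (\<lambda>t. deriv (\<lambda>s. f s (cis (2 * pi * t))) s)) (at s within ?B)"
  proof (rule leibniz_rule_field_derivative[OF _ _ 1])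
    fix s' t :: "complex" and u :: real assume "s' \<in> ?B"
    then have s': "s' \<in> V" using BV by auto
    show "((\<lambda>s. f s (cis (2 * pi * u))) has_field_derivative deriv (\<lambda>s. f s (cis (2 * pi * u))) s') (at s' within ?B)"
      by (rule has_field_derivative_at_within, rule holomorphic_derivI[OF hol \<open>open V\<close> s']) simp
    have "continuous_on (sphere 0 1) (\<lambda>z. case (s', z) of (s, z) \<Rightarrow> f s z)"
      by (rule continuous_on_compose2[OF cont]) (use s' in \<open>auto intro!: continuous_intros\<close>)
    then have "continuous_on (sphere 0 1) (f s')" by simp
    from cmean_integrable[OF this]
    show "(\<lambda>t::real. f s' (cis (2 * pi * t))) integrable_on cbox 0 1"
      by (simp add: cbox_interval)
  next
    show "s \<in> ?B" using R by simp
  qed (rule convex_ball)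
  moreover have "at s within ?B = at s"
    using R by (intro at_within_open) auto
  ultimately show ?thesis
    by (simp only: cmean_def cbox_interval)
qed

section \<open>Inversion of maps close to the identity\<close>

text \<open>The radius 2 leaves room around the unit circle for Cauchy estimates; the bound 1/8
  makes \<open>F z - z\<close> a contraction on \<open>ball 0 (3/2)\<close>.\<close>

definition near_id :: "(complex \<Rightarrow> complex) \<Rightarrow> bool" where
  "near_id F \<longleftrightarrow> F holomorphic_on ball 0 2 \<and> (\<forall>z\<in>ball 0 2. norm (F z - z) \<le> 1/8)"

text \<open>Cauchy estimate for \<open>F z - z\<close> on a circle of radius 3/8, which stays in
  \<open>ball 0 2\<close> because 3/2 + 3/8 < 2; the bound is (1/8) / (3/8).\<close>

lemma near_id_deriv:
  assumes "near_id F" "norm w < 3/2"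
  shows "norm (deriv F w - 1) \<le> 1/3"
proof -
  have sub: "ball w (1/2) \<subseteq> ball 0 2"
  proof
    fix z assume "z \<in> ball w (1/2)"
    then show "z \<in> ball 0 2"
      using assms(2) norm_triangle_sub[of z w] by (auto simp: dist_norm norm_minus_commute)
  qed
  have F: "F holomorphic_on ball 0 2" and small: "\<And>z. norm z < 2 \<Longrightarrow> norm (F z - z) \<le> 1/8"
    using assms by (auto simp: near_id_def)
  let ?g = "\<lambda>z. F z - z"
  have g: "?g holomorphic_on ball w (1/2)"
    by (intro holomorphic_intros holomorphic_on_subset[OF F] sub)
  have in2: "norm (w + of_real (3/8) * z) < 2" if "norm z = 1" for z
    using norm_triangle_ineq[of w "of_real (3/8) * z"] assms(2) that
    by (simp add: norm_mult del: of_real_divide)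
  have "norm (cmean (\<lambda>z. ?g (w + of_real (3/8) * z) / z) - 0) \<le> 1/8"
  proof (rule cmean_bound)
    show "continuous_on (sphere 0 1) (\<lambda>z. ?g (w + of_real (3/8) * z) / z)"
      by (intro continuous_intros continuous_on_compose2[OF holomorphic_on_imp_continuous_on[OF F]])
         (use in2 in auto)
    show "norm (?g (w + of_real (3/8) * z) / z - 0) \<le> 1/8" if "norm z = 1" for z
      using small[OF in2[OF that]] that by (simp add: norm_divide del: of_real_divide)
  qed
  moreover have "norm (deriv ?g w) = norm (cmean (\<lambda>z. ?g (w + of_real (3/8) * z) / z)) / (3/8)"
  proof -
    have "deriv ?g w = cmean (\<lambda>z. ?g (w + of_real (3/8) * z) / z) / of_real (3/8)"
      by (rule deriv_eq_cmean[OF g]) simp_all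
    then show ?thesis by (simp only: norm_divide norm_of_real)
  qed
  ultimately have "norm (deriv ?g w) \<le> 1/3" by simp
  moreover have "deriv ?g w = deriv F w - 1"
    using assms by (subst deriv_diff) (auto intro!: holomorphic_on_imp_differentiable_at[OF F])
  ultimately show ?thesis by simp
qed

lemma near_id_deriv_nonzero:
  assumes "near_id F" "norm w < 3/2"
  shows "deriv F w \<noteq> 0"
  using near_id_deriv[OF assms] by auto

lemma near_id_inj:
  assumes "near_id F" "norm w < 3/2" "norm w' < 3/2" "F w = F w'"
  shows "w = w'"
proof -
  have F: "F holomorphic_on ball 0 2"
    using assms by (auto simp: near_id_def)
  have "norm ((F w - w) - (F w' - w')) \<le> 1/3 * norm (w - w')"
  proof (rule field_differentiable_bound[where S = "ball 0 (3/2)" and f' = "\<lambda>z. deriv F z - 1"])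
    show "((\<lambda>z. F z - z) has_field_derivative deriv F z - 1) (at z within ball 0 (3 / 2))"
      if "z \<in> ball 0 (3/2)" for z
    proof (rule has_field_derivative_at_within)
      have "(F has_field_derivative deriv F z) (at z)"
        using that by (intro holomorphic_derivI[OF F]) auto
      then show "((\<lambda>z. F z - z) has_field_derivative deriv F z - 1) (at z)"
        by (auto intro!: derivative_eq_intros)
    qed
  qed (use assms near_id_deriv in auto)
  then show ?thesis using assms(4) by (simp add: norm_minus_commute)
qed

text \<open>By injectivity and \<open>deriv F w \<noteq> 0\<close> the integrand has a single,
  simple pole, at \<open>w\<close>. The difference quotient \<open>?g\<close> takes it out, leaving
  Cauchy's formula for \<open>f z / ?g z\<close>.\<close>

lemma cmean_near_id:
  assumes F: "near_id F" and w: "norm w < 1" and f: "f holomorphic_on ball 0 2"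
  shows "cmean (\<lambda>z. z * f z / (F z - F w)) = f w / deriv F w"
proof -
  have hF: "F holomorphic_on ball 0 2"
    using assms by (auto simp: near_id_def)
  let ?g = "\<lambda>z. if z = w then deriv F w else (F z - F w) / (z - w)"
  have g: "?g holomorphic_on ball 0 (3/2)"
    using w by (intro pole_lemma holomorphic_on_subset[OF hF]) auto
  have gnz: "?g z \<noteq> 0" if "z \<in> ball 0 (3/2)" for z
    using near_id_deriv_nonzero[OF F, of z] near_id_inj[OF F, of z w] that w by auto
  have "cmean (\<lambda>z. z * f z / (F z - F w)) = cmean (\<lambda>z. z * (f z / ?g z) / (z - w))"
    by (rule cmean_cong) (use w in auto)
  also have "\<dots> = f w / ?g w"
    by (rule cmean_Cauchy[of _ "3/2"])
       (use w gnz in \<open>auto intro!: holomorphic_on_divide g holomorphic_on_subset[OF f]\<close>)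
  finally show ?thesis by simp
qed

text \<open>A preimage of \<open>h\<close> is a fixed point of \<open>z - F z + h\<close>, which
  maps the disc of radius 3/4 into itself since 1/8 + 1/2 < 3/4.\<close>

lemma near_id_surj:
  assumes F: "near_id F" and h: "norm h < 1/2"
  obtains w where "norm w < 1" "F w = h"
proof -
  have hF: "F holomorphic_on ball 0 2" and small: "\<And>z. norm z < 2 \<Longrightarrow> norm (F z - z) \<le> 1/8"
    using assms by (auto simp: near_id_def)
  obtain w where "w \<in> cball 0 (3/4)" "w - F w + h = w"
  proof (rule brouwer_ball[of "3/4" 0 "\<lambda>z. z - F z + h"])
    show "continuous_on (cball 0 (3/4)) (\<lambda>z. z - F z + h)"
      by (intro continuous_intros holomorphic_on_imp_continuous_on holomorphic_on_subset[OF hF]) auto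
    show "(\<lambda>z. z - F z + h) \<in> cball 0 (3/4) \<rightarrow> cball 0 (3/4)"
    proof
      fix z :: complex assume "z \<in> cball 0 (3/4)"
      then have "norm (z - F z) \<le> 1/8" using small[of z] by (simp add: norm_minus_commute)
      then show "z - F z + h \<in> cball 0 (3/4)"
        using norm_triangle_ineq[of "z - F z" h] h by simp
    qed
  qed auto
  then show ?thesis by (intro that[of w]) auto
qed

lemma near_id_circle:
  assumes "near_id F" "norm h < 1/2" "norm z = 1"
  shows "F z \<noteq> h"
proof -
  have "norm (z - h) \<le> norm (F z - z)" if "F z = h"
    using that by (simp add: norm_minus_commute)
  moreover have "norm (F z - z) \<le> 1/8" using assms by (auto simp: near_id_def)
  ultimately show ?thesis using norm_triangle_sub[of z h] assms by auto
qed

text \<open>The inverse function and its derivative as residue integrals: analyticity in parameters is inherited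
  from the integrand.\<close>

definition lagrange_deriv :: "(complex \<Rightarrow> complex) \<Rightarrow> complex \<Rightarrow> complex" where
  "lagrange_deriv F h = cmean (\<lambda>z. z / (F z - h))"

definition lagrange_inverse :: "(complex \<Rightarrow> complex) \<Rightarrow> complex \<Rightarrow> complex" where
  "lagrange_inverse F h = cmean (\<lambda>z. z * z / (F z - h)) / lagrange_deriv F h"

lemma lagrange_deriv_eq:
  assumes "near_id F" "norm w < 1"
  shows "lagrange_deriv F (F w) = 1 / deriv F w"
  using cmean_near_id[OF assms, of "\<lambda>_. 1"] by (simp add: lagrange_deriv_def)

text \<open>The numerator is the residue \<open>w / deriv F w\<close>; dividing by
  \<open>lagrange_deriv\<close> removes the weight. Thus the integrands involve only values of
  \<open>F\<close> on the circle, not its derivative.\<close>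

lemma lagrange_inverse_eq:
  assumes "near_id F" "norm w < 1"
  shows "lagrange_inverse F (F w) = w"
  using cmean_near_id[OF assms, of "\<lambda>z. z"] near_id_deriv_nonzero[OF assms(1), of w] assms(2)
  by (simp add: lagrange_inverse_def lagrange_deriv_eq assms)

lemma lagrange_inverse:
  assumes "near_id F" "norm h < 1/2"
  shows "norm (lagrange_inverse F h) < 1" "F (lagrange_inverse F h) = h" "lagrange_deriv F h = 1 / deriv F (lagrange_inverse F h)" "lagrange_deriv F h \<noteq> 0"
proof -
  obtain w where w: "norm w < 1" "F w = h" using near_id_surj[OF assms] by auto
  then have "lagrange_inverse F h = w" using lagrange_inverse_eq assms by auto
  then show "norm (lagrange_inverse F h) < 1" "F (lagrange_inverse F h) = h" "lagrange_deriv F h = 1 / deriv F (lagrange_inverse F h)" "lagrange_deriv F h \<noteq> 0"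
    using w lagrange_deriv_eq[OF assms(1), of w] near_id_deriv_nonzero[OF assms(1), of w] by auto
qed

section \<open>Holomorphic functions of two variables\<close>

text \<open>Bridge from separate holomorphy to total differentiability, which the chain rule for
  coordinate changes needs: Cauchy's formula makes the partial derivatives jointly
  continuous.\<close>

lemma hol2_imp_has_derivative:
  assumes f: "hol2 U f" and ab: "(a, b) \<in> U"
  shows "(f has_derivative (\<lambda>(s, t). deriv (\<lambda>z. f (z, b)) a * s + deriv (\<lambda>z. f (a, z)) b * t)) (at (a, b))"
    and "isCont (\<lambda>y. deriv (\<lambda>z. f (z, snd y)) (fst y)) (a, b)"
    and "isCont (\<lambda>y. deriv (\<lambda>z. f (fst y, z)) (snd y)) (a, b)"
proof -
  have U: "open U" and cont: "continuous_on U f"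
    and d1: "\<And>a b. (a, b) \<in> U \<Longrightarrow> (\<lambda>z. f (z, b)) field_differentiable at a"
    and d2: "\<And>a b. (a, b) \<in> U \<Longrightarrow> (\<lambda>z. f (a, z)) field_differentiable at b"
    using f by (auto simp: hol2_def)
  obtain A B where AB: "open A" "open B" "(a, b) \<in> A \<times> B" "A \<times> B \<subseteq> U"
    using open_prod_elim[OF U ab] by blast
  obtain R1 R2 where R12: "R1 > 0" "ball a R1 \<subseteq> A" "R2 > 0" "ball b R2 \<subseteq> B"
    using AB by (meson mem_Sigma_iff open_contains_ball)
  define R where "R = min R1 R2"
  have R: "R > 0" "ball a R \<times> ball b R \<subseteq> U"
  proof -
    show "R > 0" using R12 by (simp add: R_def)
    have "ball a R \<subseteq> A" "ball b R \<subseteq> B"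
      using R12(2,4) subset_ball[of R R1 a] subset_ball[of R R2 b] unfolding R_def by (meson min.cobounded1 min.cobounded2 order_trans)+
    then show "ball a R \<times> ball b R \<subseteq> U" using AB(4) by blast
  qed
  have sub: "ball a (R / 2) \<times> ball b (R / 2) \<subseteq> ball a R \<times> ball b R"
    by (intro Sigma_mono subset_ball) (use R(1) in auto)
  have c1: "continuous_on (ball a (R / 2) \<times> ball b R) (\<lambda>(x, y). deriv (\<lambda>z. f (z, y)) x)"
  proof (rule continuous_on_deriv_param)
    show "continuous_on (ball a R \<times> ball b R) (\<lambda>(x, y). f (x, y))"
      using continuous_on_subset[OF cont R(2)] by (simp add: split_beta)
    show "(\<lambda>x. f (x, y)) holomorphic_on ball a R" if "y \<in> ball b R" for y
      unfolding holomorphic_on_def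
    proof
      fix x assume "x \<in> ball a R"
      then have "(x, y) \<in> U" using that R(2) by blast
      then show "(\<lambda>x. f (x, y)) field_differentiable at x within ball a R"
        by (rule field_differentiable_at_within[OF d1])
    qed
  qed
  have swap: "continuous_on (X \<times> Y) (\<lambda>(x, y). g y x)"
    if "continuous_on (Y \<times> X) (\<lambda>(y, x). g y x)" for X Y :: "complex set" and g :: "complex \<Rightarrow> complex \<Rightarrow> complex"
  proof -
    have "continuous_on (X \<times> Y) (\<lambda>p. case (snd p, fst p) of (y, x) \<Rightarrow> g y x)"
      by (rule continuous_on_compose2[OF that], intro continuous_intros) auto
    then show ?thesis by (simp add: case_prod_unfold)
  qed
  have "continuous_on (ball b (R / 2) \<times> ball a R) (\<lambda>(y, x). deriv (\<lambda>z. f (x, z)) y)"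
  proof (rule continuous_on_deriv_param)
    show "continuous_on (ball b R \<times> ball a R) (\<lambda>(y, x). f (x, y))"
      by (rule swap) (use continuous_on_subset[OF cont R(2)] in \<open>simp add: case_prod_unfold\<close>)
    show "(\<lambda>y. f (x, y)) holomorphic_on ball b R" if "x \<in> ball a R" for x
      unfolding holomorphic_on_def
    proof
      fix y assume "y \<in> ball b R"
      then have "(x, y) \<in> U" using that R(2) by blast
      then show "(\<lambda>y. f (x, y)) field_differentiable at y within ball b R"
        by (rule field_differentiable_at_within[OF d2])
    qed
  qed
  from swap[OF this]
  have c2: "continuous_on (ball a R \<times> ball b (R / 2)) (\<lambda>(x, y). deriv (\<lambda>z. f (x, z)) y)"
    by (simp add: split_beta)
  let ?N = "ball a (R / 2) \<times> ball b (R / 2)"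
  have N: "open ?N" "(a, b) \<in> ?N" using R by (auto intro: open_Times)
  show cont1: "isCont (\<lambda>y. deriv (\<lambda>z. f (z, snd y)) (fst y)) (a, b)"
  proof (rule continuous_on_interior[of ?N])
    show "continuous_on ?N (\<lambda>y. deriv (\<lambda>z. f (z, snd y)) (fst y))"
      using sub by (intro continuous_on_subset[OF c1[unfolded split_beta]]) auto
  qed (use N in \<open>simp add: interior_open\<close>)
  show cont2: "isCont (\<lambda>y. deriv (\<lambda>z. f (fst y, z)) (snd y)) (a, b)"
  proof (rule continuous_on_interior[of ?N])
    show "continuous_on ?N (\<lambda>y. deriv (\<lambda>z. f (fst y, z)) (snd y))"
      using sub by (intro continuous_on_subset[OF c2[unfolded split_beta]]) auto
  qed (use N in \<open>simp add: interior_open\<close>)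
  have "((\<lambda>(x, y). f (x, y)) has_derivative
      (\<lambda>(tx, ty). blinfun_mult_right (deriv (\<lambda>z. f (z, b)) a) tx + blinfun_mult_right (deriv (\<lambda>z. f (a, z)) b) ty))
      (at (a, b) within ball a (R / 2) \<times> ball b (R / 2))"
  proof (rule has_derivative_partialsI[where fy = "\<lambda>x y. blinfun_mult_right (deriv (\<lambda>z. f (x, z)) y)"])
    show "((\<lambda>x. f (x, b)) has_derivative blinfun_mult_right (deriv (\<lambda>z. f (z, b)) a)) (at a within ball a (R / 2))"
      using d1[OF ab, THEN field_differentiable_derivI]
      by - (rule has_derivative_at_withinI, simp add: has_field_derivative_def)
    show "((\<lambda>y. f (x, y)) has_derivative blinfun_mult_right (deriv (\<lambda>z. f (x, z)) y)) (at y within ball b (R / 2))"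
      if "x \<in> ball a (R / 2)" "y \<in> ball b (R / 2)" for x y
    proof (rule has_derivative_at_withinI)
      have "(x, y) \<in> U" using that R(2) sub by blast
      from d2[OF this, THEN field_differentiable_derivI]
      show "((\<lambda>y. f (x, y)) has_derivative blinfun_mult_right (deriv (\<lambda>z. f (x, z)) y)) (at y)"
        by (simp add: has_field_derivative_def)
    qed
    show "continuous (at (a, b) within ball a (R / 2) \<times> ball b (R / 2))
        (\<lambda>(x, y). blinfun_mult_right (deriv (\<lambda>z. f (x, z)) y))"
    proof -
      have "((\<lambda>y. deriv (\<lambda>z. f (fst y, z)) (snd y)) \<longlongrightarrow> deriv (\<lambda>z. f (a, z)) b) (at (a, b) within ?N)"
        using cont2 unfolding isCont_def fst_conv snd_conv by (rule tendsto_within_subset) simp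
      then show ?thesis
        unfolding case_prod_unfold continuous_within fst_conv snd_conv by (rule bounded_linear.tendsto[OF bounded_linear_blinfun_mult_right])
    qed
  qed (use R in auto)
  then show "(f has_derivative (\<lambda>(s, t). deriv (\<lambda>z. f (z, b)) a * s + deriv (\<lambda>z. f (a, z)) b * t)) (at (a, b))"
    using at_within_open[OF N(2,1)] by (simp add: case_prod_unfold)
qed

text \<open>The complex-linear total derivative, recorded by its two coefficients, so that Jacobian
  determinants of compositions become polynomial identities.\<close>

definition cderiv :: "(complex \<times> complex \<Rightarrow> complex) \<Rightarrow> complex \<Rightarrow> complex \<Rightarrow> complex \<times> complex \<Rightarrow> bool" where
  "cderiv f A B y \<longleftrightarrow> (f has_derivative (\<lambda>v. A * fst v + B * snd v)) (at y)"

lemma cderiv_partials: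
  assumes "cderiv f A B (a, b)"
  shows "((\<lambda>z. f (z, b)) has_field_derivative A) (at a)"
    and "((\<lambda>z. f (a, z)) has_field_derivative B) (at b)"
proof -
  have f: "(f has_derivative (\<lambda>v. A * fst v + B * snd v)) (at ((\<lambda>z. (z, b)) a))"
     "(f has_derivative (\<lambda>v. A * fst v + B * snd v)) (at ((\<lambda>z. (a, z)) b))"
    using assms by (simp_all add: cderiv_def)
  have "((\<lambda>z. (z, b)) has_derivative (\<lambda>z. (z, 0))) (at a)"
    by (auto intro!: derivative_eq_intros)
  from has_derivative_compose[OF this f(1)]
  show "((\<lambda>z. f (z, b)) has_field_derivative A) (at a)"
    by (simp add: has_field_derivative_def)
  have "((\<lambda>z. (a, z)) has_derivative (\<lambda>z. (0, z))) (at b)"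
    by (auto intro!: derivative_eq_intros)
  from has_derivative_compose[OF this f(2)]
  show "((\<lambda>z. f (a, z)) has_field_derivative B) (at b)"
    by (simp add: has_field_derivative_def)
qed

lemma hol2_imp_cderiv:
  assumes "hol2 U f" "(a, b) \<in> U"
  shows "cderiv f (deriv (\<lambda>z. f (z, b)) a) (deriv (\<lambda>z. f (a, z)) b) (a, b)"
  using hol2_imp_has_derivative(1)[OF assms] by (simp add: cderiv_def case_prod_unfold)

lemma hol2I:
  assumes "open U" "\<And>y. y \<in> U \<Longrightarrow> \<exists>A B. cderiv f A B y"
  shows "hol2 U f"
  unfolding hol2_def
proof (intro conjI allI impI)
  show "continuous_on U f"
    using assms(2) unfolding cderiv_def
    by (meson has_derivative_continuous continuous_at_imp_continuous_on)
  show "(\<lambda>z. f (z, b)) field_differentiable at a" "(\<lambda>z. f (a, z)) field_differentiable at b"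
    if "(a, b) \<in> U" for a b
    using assms(2)[OF that] cderiv_partials unfolding field_differentiable_def by blast+
qed fact

lemma cderiv_unique_deriv:
  assumes "cderiv f A B (a, b)"
  shows "deriv (\<lambda>z. f (z, b)) a = A" "deriv (\<lambda>z. f (a, z)) b = B"
  using cderiv_partials[OF assms] DERIV_imp_deriv by blast+

lemma cderiv_compose:
  assumes g1: "cderiv g1 A1 B1 y" and g2: "cderiv g2 A2 B2 y" and f: "cderiv f A B (g1 y, g2 y)"
  shows "cderiv (\<lambda>y. f (g1 y, g2 y)) (A * A1 + B * A2) (A * B1 + B * B2) y"
proof -
  have "((\<lambda>y. (g1 y, g2 y)) has_derivative (\<lambda>v. (A1 * fst v + B1 * snd v, A2 * fst v + B2 * snd v))) (at y)"
    using g1 g2 unfolding cderiv_def by (intro has_derivative_Pair)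
  from has_derivative_compose[OF this f[unfolded cderiv_def]] show ?thesis
    by (simp add: cderiv_def algebra_simps)
qed

lemma cderiv_compose1:
  assumes g: "cderiv g A B y" and f: "(f has_field_derivative f') (at (g y))"
  shows "cderiv (\<lambda>y. f (g y)) (f' * A) (f' * B) y"
  using has_derivative_compose[OF g[unfolded cderiv_def] f[unfolded has_field_derivative_def]]
  by (simp add: cderiv_def algebra_simps)

lemma cderiv_mult:
  assumes "cderiv f A B y" "cderiv g A' B' y"
  shows "cderiv (\<lambda>y. f y * g y) (A * g y + f y * A') (B * g y + f y * B') y"
  using has_derivative_mult[OF assms[unfolded cderiv_def]]
  by (simp add: cderiv_def algebra_simps)

lemma cderiv_add:
  assumes "cderiv f A B y" "cderiv g A' B' y"
  shows "cderiv (\<lambda>y. f y + g y) (A + A') (B + B') y"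
  using has_derivative_add[OF assms[unfolded cderiv_def]]
  by (simp add: cderiv_def algebra_simps)

lemma cderiv_diff:
  assumes "cderiv f A B y" "cderiv g A' B' y"
  shows "cderiv (\<lambda>y. f y - g y) (A - A') (B - B') y"
  using has_derivative_diff[OF assms[unfolded cderiv_def]]
  by (simp add: cderiv_def algebra_simps)

lemma cderiv_fst: "cderiv fst 1 0 y" and cderiv_snd: "cderiv snd 0 1 y"
  by (auto simp: cderiv_def intro!: derivative_eq_intros)

lemma hol2_cmean:
  assumes V: "open V" and cont: "continuous_on (V \<times> sphere 0 1) (\<lambda>(v, q). f v q)"
    and hol: "\<And>q. norm q = 1 \<Longrightarrow> hol2 V (\<lambda>v. f v q)"
  shows "hol2 V (\<lambda>v. cmean (f v))"
  unfolding hol2_def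
proof (intro conjI allI impI)
  show "continuous_on V (\<lambda>v. cmean (f v))"
    by (rule continuous_on_cmean[OF cont])
  fix a b assume ab: "(a, b) \<in> V"
  let ?V1 = "(\<lambda>z. (z, b)) -` V" and ?V2 = "(\<lambda>z. (a, z)) -` V"
  have open12: "open ?V1" "open ?V2"
    by (intro continuous_open_vimage V continuous_intros)+
  have "((\<lambda>z. cmean (f (z, b))) has_field_derivative cmean (\<lambda>q. deriv (\<lambda>z. f (z, b) q) a)) (at a)"
  proof (rule cmean_has_field_derivative[OF open12(1)])
    have "continuous_on (?V1 \<times> sphere 0 1) (\<lambda>y. case ((fst y, b), snd y) of (v, q) \<Rightarrow> f v q)"
      by (rule continuous_on_compose2[OF cont]) (auto intro!: continuous_intros)
    then show "continuous_on (?V1 \<times> sphere 0 1) (\<lambda>(z, q). f (z, b) q)"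
      by (simp add: case_prod_unfold)
    show "(\<lambda>z. f (z, b) q) holomorphic_on ?V1" if "norm q = 1" for q
      using hol[OF that] open12 by (auto simp: hol2_def holomorphic_on_def field_differentiable_at_within)
  qed (use ab in auto)
  then show "(\<lambda>z. cmean (f (z, b))) field_differentiable at a"
    unfolding field_differentiable_def by blast
  have "((\<lambda>z. cmean (f (a, z))) has_field_derivative cmean (\<lambda>q. deriv (\<lambda>z. f (a, z) q) b)) (at b)"
  proof (rule cmean_has_field_derivative[OF open12(2)])
    have "continuous_on (?V2 \<times> sphere 0 1) (\<lambda>y. case ((a, fst y), snd y) of (v, q) \<Rightarrow> f v q)"
      by (rule continuous_on_compose2[OF cont]) (auto intro!: continuous_intros)
    then show "continuous_on (?V2 \<times> sphere 0 1) (\<lambda>(z, q). f (a, z) q)"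
      by (simp add: case_prod_unfold)
    show "(\<lambda>z. f (a, z) q) holomorphic_on ?V2" if "norm q = 1" for q
      using hol[OF that] open12 by (auto simp: hol2_def holomorphic_on_def field_differentiable_at_within)
  qed (use ab in auto)
  then show "(\<lambda>z. cmean (f (a, z))) field_differentiable at b"
    unfolding field_differentiable_def by blast
qed (rule V)

lemma hol3_cmean:
  assumes V: "open V" and cont: "continuous_on (V \<times> sphere 0 1) (\<lambda>(v, q). f v q)"
    and hol: "\<And>q. norm q = 1 \<Longrightarrow> hol3 V (\<lambda>v. f v q)"
  shows "hol3 V (\<lambda>v. cmean (f v))"
proof -
  \<comment> \<open>One argument serves all three variables: \<open>g\<close> will be a complex line
    parallel to a coordinate axis.\<close>
  have *: "(\<lambda>z. cmean (f (g z))) field_differentiable at s"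
    if g: "continuous_on UNIV g" and s: "g s \<in> V"
      and d: "\<And>q s. norm q = 1 \<Longrightarrow> g s \<in> V \<Longrightarrow> (\<lambda>z. f (g z) q) field_differentiable at s" for g s
  proof -
    have op: "open (g -` V)"
      by (rule open_vimage[OF V g])
    have "((\<lambda>z. cmean (f (g z))) has_field_derivative cmean (\<lambda>q. deriv (\<lambda>z. f (g z) q) s)) (at s)"
    proof (rule cmean_has_field_derivative[OF op])
      have "continuous_on (g -` V \<times> sphere 0 1) (\<lambda>y. case (g (fst y), snd y) of (v, q) \<Rightarrow> f v q)"
        by (rule continuous_on_compose2[OF cont])
          (auto intro!: continuous_intros continuous_on_compose2[OF g])
      then show "continuous_on (g -` V \<times> sphere 0 1) (\<lambda>(z, q). f (g z) q)"
        by (simp add: case_prod_unfold)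
      show "(\<lambda>z. f (g z) q) holomorphic_on g -` V" if "norm q = 1" for q
        using d[OF that] by (auto simp: holomorphic_on_def field_differentiable_at_within)
    qed (use s in auto)
    then show ?thesis unfolding field_differentiable_def by blast
  qed
  show ?thesis
    unfolding hol3_def
  proof (intro conjI allI impI)
    fix a b c assume abc: "(a, b, c) \<in> V"
    show "(\<lambda>z. cmean (f (z, b, c))) field_differentiable at a"
      using abc hol by (intro *) (auto simp: hol3_def intro!: continuous_intros)
    show "(\<lambda>z. cmean (f (a, z, c))) field_differentiable at b"
      using abc hol by (intro *) (auto simp: hol3_def intro!: continuous_intros)
    show "(\<lambda>z. cmean (f (a, b, z))) field_differentiable at c"
      using abc hol by (intro *) (auto simp: hol3_def intro!: continuous_intros)
  qed (use V continuous_on_cmean[OF cont] in auto)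
qed

text \<open>Determinant one makes the derivative at \<open>c\<close> invertible, and continuity of
  the partial derivatives then gives injectivity on a ball. The other chart conditions survive
  restriction.\<close>

lemma symplectic_chart_locally:
  assumes f: "hol2 U f" and g: "hol2 U g" and c: "c \<in> U"
    and jac: "\<And>a b. (a, b) \<in> U \<Longrightarrow>
        deriv (\<lambda>z. f (z, b)) a * deriv (\<lambda>z. g (a, z)) b - deriv (\<lambda>z. f (a, z)) b * deriv (\<lambda>z. g (z, b)) a = 1"
  obtains V where "V \<subseteq> U" "c \<in> V" "symplectic_chart V f g"
proof -
  have U: "open U" using f by (simp add: hol2_def)
  define f1 where "f1 = (\<lambda>y. deriv (\<lambda>z. f (z, snd y)) (fst y))"
  define f2 where "f2 = (\<lambda>y. deriv (\<lambda>z. f (fst y, z)) (snd y))"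
  define g1 where "g1 = (\<lambda>y. deriv (\<lambda>z. g (z, snd y)) (fst y))"
  define g2 where "g2 = (\<lambda>y. deriv (\<lambda>z. g (fst y, z)) (snd y))"
  have cont: "isCont f1 c" "isCont f2 c" "isCont g1 c" "isCont g2 c"
    using hol2_imp_has_derivative(2,3)[OF f, of "fst c" "snd c"] hol2_imp_has_derivative(2,3)[OF g, of "fst c" "snd c"] c
    by (simp_all add: f1_def f2_def g1_def g2_def)
  let ?F = "\<lambda>y. (f y, g y)"
  let ?F' = "\<lambda>y v. (f1 y * fst v + f2 y * snd v, g1 y * fst v + g2 y * snd v)"
  \<comment> \<open>The adjugate matrix; it inverts the derivative at \<open>c\<close> because the
    determinant is 1.\<close>
  let ?G' = "\<lambda>v. (g2 c * fst v - f2 c * snd v, f1 c * snd v - g1 c * fst v)"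
  have det: "f1 c * g2 c - f2 c * g1 c = 1"
    using jac[of "fst c" "snd c"] c by (simp add: f1_def f2_def g1_def g2_def)
  have bl: "bounded_linear (\<lambda>v. (A * fst v + B * snd v, C * fst v + E * snd v))" for A B C E :: complex
    by (intro bounded_linear_intros)
  obtain r where r: "r > 0" "ball c r \<subseteq> U" "inj_on ?F (ball c r)"
  proof (rule has_derivative_locally_injective[of c U ?G' ?F' ?F])
    show "bounded_linear ?G'" by (intro bounded_linear_intros)
    show "?G' \<circ> ?F' c = id"
    proof
      fix v
      have "g2 c * (f1 c * fst v + f2 c * snd v) - f2 c * (g1 c * fst v + g2 c * snd v) = (f1 c * g2 c - f2 c * g1 c) * fst v"
        "f1 c * (g1 c * fst v + g2 c * snd v) - g1 c * (f1 c * fst v + f2 c * snd v) = (f1 c * g2 c - f2 c * g1 c) * snd v"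
        by (simp_all add: algebra_simps)
      then show "(?G' \<circ> ?F' c) v = id v" by (simp add: det)
    qed
    show "(?F has_derivative ?F' y) (at y)" if "y \<in> U" for y
      using hol2_imp_cderiv[OF f, of "fst y" "snd y"] hol2_imp_cderiv[OF g, of "fst y" "snd y"] that
      by (intro has_derivative_Pair) (auto simp: cderiv_def f1_def f2_def g1_def g2_def)
    fix e :: real assume e: "e > 0"
    have "(\<lambda>y. norm (f1 y - f1 c) + norm (f2 y - f2 c) + norm (g1 y - g1 c) + norm (g2 y - g2 c)) \<midarrow>c\<rightarrow> 
       norm (f1 c - f1 c) + norm (f2 c - f2 c) + norm (g1 c - g1 c) + norm (g2 c - g2 c)"
      using cont unfolding isCont_def by (intro tendsto_intros)
    then have "\<forall>\<^sub>F y in at c. norm (f1 y - f1 c) + norm (f2 y - f2 c) + norm (g1 y - g1 c) + norm (g2 y - g2 c) < e"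
      using e by (intro order_tendstoD) auto
    then obtain d where d: "d > 0" "\<And>y. y \<noteq> c \<Longrightarrow> dist y c < d \<Longrightarrow>
        norm (f1 y - f1 c) + norm (f2 y - f2 c) + norm (g1 y - g1 c) + norm (g2 y - g2 c) < e"
      unfolding eventually_at by auto
    have "onorm (\<lambda>v. ?F' y v - ?F' c v) < e" if "dist c y < d" for y
    proof -
      let ?s = "norm (f1 y - f1 c) + norm (f2 y - f2 c) + norm (g1 y - g1 c) + norm (g2 y - g2 c)"
      have "?s < e" using d e that by (cases "y = c") (auto simp: dist_commute)
      moreover have "onorm (\<lambda>v. ?F' y v - ?F' c v) \<le> ?s"
      proof (rule onorm_le)
        fix v :: "complex \<times> complex"
        have v: "norm (fst v) \<le> norm v" "norm (snd v) \<le> norm v"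
          by (metis norm_fst_le prod.collapse, metis norm_snd_le prod.collapse)
        have *: "norm ((A - A') * fst v + (B - B') * snd v) \<le> (norm (A - A') + norm (B - B')) * norm v"
          for A A' B B' :: complex
        proof -
          have "norm ((A - A') * fst v + (B - B') * snd v) \<le> norm ((A - A') * fst v) + norm ((B - B') * snd v)"
            by (rule norm_triangle_ineq)
          also have "\<dots> \<le> norm (A - A') * norm v + norm (B - B') * norm v"
            unfolding norm_mult by (intro add_mono mult_left_mono v) auto
          finally show ?thesis by (simp add: distrib_right)
        qed
        have "?F' y v - ?F' c v =
            ((f1 y - f1 c) * fst v + (f2 y - f2 c) * snd v, (g1 y - g1 c) * fst v + (g2 y - g2 c) * snd v)"
          by (simp add: algebra_simps)
        also have "norm \<dots> \<le> norm ((f1 y - f1 c) * fst v + (f2 y - f2 c) * snd v)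
            + norm ((g1 y - g1 c) * fst v + (g2 y - g2 c) * snd v)"
          by (rule norm_Pair_le)
        also have "\<dots> \<le> ?s * norm v"
          using *[of "f1 y" "f1 c" "f2 y" "f2 c"] *[of "g1 y" "g1 c" "g2 y" "g2 c"]
          by (simp add: distrib_right)
        finally show "norm (?F' y v - ?F' c v) \<le> ?s * norm v" .
      qed
      ultimately show ?thesis by simp
    qed
    then show "\<exists>d>0. \<forall>y. dist c y < d \<longrightarrow> onorm (\<lambda>v. ?F' y v - ?F' c v) < e"
      using d(1) by blast
  qed (use U c in auto)
  show ?thesis
  proof (rule that[of "ball c r"])
    show "symplectic_chart (ball c r) f g"
      unfolding symplectic_chart_def
    proof (intro conjI allI impI)
      show "hol2 (ball c r) f" "hol2 (ball c r) g"
        using f g r(2) by (auto simp: hol2_def intro: continuous_on_subset)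
    qed (use r jac in auto)
  qed (use r in auto)
qed

section \<open>Normal form of a Hamiltonian quadratic in the momentum\<close>

lemma Re_pos_not_nonpos: "Re z > 0 \<Longrightarrow> z \<notin> \<real>\<^sub>\<le>\<^sub>0"
  by (auto simp: complex_nonpos_Reals_iff)

lemma Re_one_plus_pos: "norm z < 1 \<Longrightarrow> Re (1 + z) > 0"
  using abs_Re_le_cmod[of z] by simp

text \<open>\<open>norm X < 1\<close> keeps \<open>1 + X\<close> in the right half-plane, so the
  root has positive real part; the bound near 1 follows from \<open>(s - 1) * (1 + s) = X\<close>
  and \<open>norm (1 + s) \<ge> 1\<close>.\<close>

lemma csqrt_one_plus:
  assumes "norm X < 1"
  shows "Re (csqrt (1 + X)) > 0" "(csqrt (1 + X))\<^sup>2 = 1 + X" "norm (csqrt (1 + X) - 1) \<le> norm X"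
    "norm (1 + csqrt (1 + X)) \<ge> 1"
proof -
  let ?s = "csqrt (1 + X)"
  show 2: "?s\<^sup>2 = 1 + X" by simp
  have "Re ?s \<noteq> 0"
  proof
    assume "Re ?s = 0"
    then have "Re (?s\<^sup>2) \<le> 0" by (simp only: Re_power2) simp
    then show False using Re_one_plus_pos[OF assms] 2 by simp
  qed
  then show 1: "Re ?s > 0" using csqrt_principal[of "1 + X"] by auto
  have "1 \<le> Re (1 + ?s)" using 1 by simp
  then show 3: "norm (1 + ?s) \<ge> 1" using complex_Re_le_cmod[of "1 + ?s"] by linarith
  have "(?s - 1) * (1 + ?s) = X" using 2 by (simp add: algebra_simps power2_eq_square)
  then have "norm (?s - 1) * norm (1 + ?s) = norm X" by (metis norm_mult)
  moreover have "norm (?s - 1) * 1 \<le> norm (?s - 1) * norm (1 + ?s)" using 3 by (intro mult_left_mono) auto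
  ultimately show "norm (?s - 1) \<le> norm X" by simp
qed

lemma continuous_on_csqrt_one_plus:
  assumes "continuous_on A f" "\<And>x. x \<in> A \<Longrightarrow> norm (f x) < 1"
  shows "continuous_on A (\<lambda>x. csqrt (1 + f x))"
proof (rule continuous_on_compose2[where g = csqrt and t = "- \<real>\<^sub>\<le>\<^sub>0"])
  show "continuous_on (- \<real>\<^sub>\<le>\<^sub>0) csqrt"
    by (intro holomorphic_on_imp_continuous_on holomorphic_on_csqrt)
  show "(\<lambda>x. 1 + f x) ` A \<subseteq> - \<real>\<^sub>\<le>\<^sub>0"
    using Re_one_plus_pos[OF assms(2)] Re_pos_not_nonpos by blast
qed (intro continuous_intros assms)

lemma field_differentiable_csqrt_one_plus:
  assumes "f field_differentiable at z" "norm (f z) < 1"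
  shows "(\<lambda>x. csqrt (1 + f x)) field_differentiable at z"
proof -
  have "csqrt field_differentiable at (1 + f z)"
    using Re_pos_not_nonpos[OF Re_one_plus_pos[OF assms(2)]] by (rule field_differentiable_at_csqrt)
  moreover have "(\<lambda>x. 1 + f x) field_differentiable at z"
    by (intro derivative_intros assms)
  ultimately show ?thesis
    using field_differentiable_compose[of "\<lambda>x. 1 + f x" z csqrt] by (simp add: o_def)
qed

text \<open>The quadratic \<^term>\<open>D q * P + a q * P\<^sup>2\<close> is, in the symplectic coordinates \<^term>\<open>(q, P)\<close>, the
  general Hamiltonian of degree two in \<^term>\<open>P\<close> whose critical level contains \<^term>\<open>P = 0\<close>.\<close>

locale quadratic_hamiltonian =
  fixes D a :: "complex \<Rightarrow> complex"
  assumes D_hol: "D holomorphic_on ball 0 2" and a_hol: "a holomorphic_on ball 0 2"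
    and D_near: "\<And>q. norm q < 2 \<Longrightarrow> norm (D q - q) \<le> 1/16"
    and a_small: "\<And>q. norm q < 2 \<Longrightarrow> norm (a q) \<le> 1/4"
begin

definition S :: "complex \<Rightarrow> complex \<Rightarrow> complex" where
  "S q z = csqrt (1 + 4 * a q * z / (D q)\<^sup>2)"

text \<open>The small solution of \<open>D q * P + a q * P^2 = z\<close> is
  \<open>P = z / T q z\<close>, a form that stays regular where \<open>a q = 0\<close>. Moreover
  \<open>T q z = D q + a q * P\<close>, and \<open>D q * S q z = D q + 2 * a q * P\<close> is the
  \<open>P\<close>-derivative of the quadratic on the level.\<close>

definition T :: "complex \<Rightarrow> complex \<Rightarrow> complex" where
  "T q z = D q * (1 + S q z) / 2"

text \<open>\<open>z * m z\<close> is the mean of \<open>q * P\<close> over the level, that is, its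
  action; \<open>j0\<close> below is the corresponding period.\<close>

definition m :: "complex \<Rightarrow> complex" where
  "m z = cmean (\<lambda>q. q / T q z)"

definition j0 :: "complex \<Rightarrow> complex" where
  "j0 z = cmean (\<lambda>q. q / (D q * S q z))"

text \<open>A residue at the solution \<open>q\<close> of \<open>D q + a q * snd v = fst v\<close>:
  the Jacobian is thus a function of \<open>(v1, v2)\<close> without solving for
  \<open>q\<close>.\<close>

definition J :: "complex \<times> complex \<Rightarrow> complex" where
  "J v = cmean (\<lambda>q. q / (D q + a q * snd v - fst v))"

text \<open>The side 1/8 gives \<open>norm (v1 * v2) < 1/64\<close>, the range in which the square
  root \<open>S\<close> is controlled.\<close>

definition B :: "(complex \<times> complex) set" where
  "B = ball 0 (1/8) \<times> ball 0 (1/8)"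

lemma D_lower: "norm q = 1 \<Longrightarrow> norm (D q) \<ge> 15/16"
  using D_near[of q] norm_triangle_sub[of q "D q"] by (simp add: norm_minus_commute)

lemma D_nz: "norm q = 1 \<Longrightarrow> D q \<noteq> 0"
  using D_lower[of q] by auto

lemma D_cont: "continuous_on (sphere 0 1) D" and a_cont: "continuous_on (sphere 0 1) a"
  using holomorphic_on_imp_continuous_on[OF D_hol] holomorphic_on_imp_continuous_on[OF a_hol]
  by (auto elim: continuous_on_subset)

lemma X_bound:
  assumes "norm q = 1" "norm z < 1/64"
  shows "norm (4 * a q * z / (D q)\<^sup>2) \<le> 1/50"
proof -
  have "norm (4 * a q * z / (D q)\<^sup>2) = 4 * norm (a q) * norm z / (norm (D q))\<^sup>2"
    by (simp add: norm_mult norm_divide norm_power)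
  also have "\<dots> \<le> 4 * (1/4) * (1/64) / (15/16)\<^sup>2"
    using a_small[of q] D_lower[of q] assms
    by (intro frac_le mult_mono power_mono) auto
  also have "\<dots> \<le> 1/50" by (simp add: power2_eq_square)
  finally show ?thesis .
qed

lemma S_facts:
  assumes "norm q = 1" "norm z < 1/64"
  shows "Re (S q z) > 0" "(S q z)\<^sup>2 = 1 + 4 * a q * z / (D q)\<^sup>2" "norm (S q z - 1) \<le> 1/50"
    "norm (1 + S q z) \<ge> 1" "S q z \<noteq> 0"
  using csqrt_one_plus[of "4 * a q * z / (D q)\<^sup>2"] X_bound[OF assms] unfolding S_def by force+

lemma T_facts:
  assumes q: "norm q = 1" and z: "norm z < 1/64"
  shows "norm (T q z) \<ge> 15/32" "T q z \<noteq> 0" "T q z * T q z = D q * T q z + a q * z"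
    "D q * S q z = 2 * T q z - D q"
proof -
  have "norm (T q z) = norm (D q) * norm (1 + S q z) / 2"
    by (simp add: T_def norm_mult norm_divide)
  moreover have "(15/16) * 1 \<le> norm (D q) * norm (1 + S q z)"
    using D_lower[OF q] S_facts(4)[OF q z] by (intro mult_mono) auto
  ultimately show 1: "norm (T q z) \<ge> 15/32" by simp
  then show "T q z \<noteq> 0" by auto
  show 2: "D q * S q z = 2 * T q z - D q" by (simp add: T_def field_simps)
  have "(D q)\<^sup>2 * (S q z)\<^sup>2 = (D q)\<^sup>2 + 4 * a q * z"
    using S_facts(2)[OF q z] D_nz[OF q] by (simp add: field_simps)
  then have "(2 * T q z - D q)\<^sup>2 = (D q)\<^sup>2 + 4 * a q * z"
    unfolding 2[symmetric] by (simp add: power_mult_distrib)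
  then have "4 * (T q z * T q z) = 4 * (D q * T q z + a q * z)"
    by (simp add: power2_eq_square algebra_simps)
  then show "T q z * T q z = D q * T q z + a q * z"
    by (subst (asm) mult_left_cancel) simp_all
qed

lemma S_cont: "continuous_on (ball 0 (1/64) \<times> sphere 0 1) (\<lambda>y. S (snd y) (fst y))"
  unfolding S_def
proof (rule continuous_on_csqrt_one_plus)
  show "continuous_on (ball 0 (1/64) \<times> sphere 0 1) (\<lambda>y. 4 * a (snd y) * fst y / (D (snd y))\<^sup>2)"
    using D_nz by (intro continuous_intros continuous_on_compose2[OF D_cont] continuous_on_compose2[OF a_cont]) auto
  show "norm (4 * a (snd y) * fst y / (D (snd y))\<^sup>2) < 1" if "y \<in> ball 0 (1/64) \<times> sphere 0 1" for y
    using X_bound[of "snd y" "fst y"] that by auto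
qed

lemma T_cont: "continuous_on (ball 0 (1/64) \<times> sphere 0 1) (\<lambda>y. T (snd y) (fst y))"
  unfolding T_def
  by (intro continuous_intros S_cont continuous_on_compose2[OF D_cont]) auto

lemma S_has_derivative:
  assumes q: "norm q = 1" and z: "norm z < 1/64"
  shows "(S q has_field_derivative (2 * a q / ((D q)\<^sup>2 * S q z))) (at z)"
proof -
  have "(S q) field_differentiable at z"
    unfolding S_def using X_bound[OF q z] D_nz[OF q]
    by (intro field_differentiable_csqrt_one_plus derivative_intros) auto
  then obtain s' where s': "(S q has_field_derivative s') (at z)"
    unfolding field_differentiable_def by blast
  have "((\<lambda>z. (S q z)\<^sup>2) has_field_derivative (2 * S q z * s')) (at z)"
    by (auto intro!: derivative_eq_intros s')
  moreover have "((\<lambda>z. (S q z)\<^sup>2) has_field_derivative (4 * a q / (D q)\<^sup>2)) (at z)"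
  proof (rule has_field_derivative_transform_within_open[where S = "ball 0 (1/64)"])
    show "((\<lambda>z. 1 + 4 * a q / (D q)\<^sup>2 * z) has_field_derivative (4 * a q / (D q)\<^sup>2)) (at z)"
      by (rule DERIV_cong[OF DERIV_add[OF DERIV_const DERIV_cmult_Id]]) simp
  qed (use z S_facts(2)[OF q] in auto)
  ultimately have "2 * S q z * s' = 4 * a q / (D q)\<^sup>2"
    by (rule DERIV_unique)
  moreover have "s' = (2 * S q z * s') / (2 * S q z)"
    using S_facts(5)[OF q z] by simp
  ultimately have "s' = (4 * a q / (D q)\<^sup>2) / (2 * S q z)" by simp
  then have "s' = 2 * a q / ((D q)\<^sup>2 * S q z)" by simp
  with s' show ?thesis by simp
qed

lemma T_has_derivative:
  assumes q: "norm q = 1" and z: "norm z < 1/64"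
  shows "(T q has_field_derivative (a q / (D q * S q z))) (at z)"
proof -
  have "((\<lambda>z. D q * (1 + S q z) / 2) has_field_derivative (D q * (2 * a q / ((D q)\<^sup>2 * S q z)) / 2)) (at z)"
    by (auto intro!: derivative_eq_intros S_has_derivative[OF q z])
  moreover have "D q * (2 * a q / ((D q)\<^sup>2 * S q z)) / 2 = a q / (D q * S q z)"
    using D_nz[OF q] by (simp add: power2_eq_square)
  ultimately show ?thesis unfolding T_def by simp
qed

text \<open>Implicit differentiation on the level: \<open>dP/dz\<close> is the reciprocal of the
  \<open>P\<close>-derivative \<open>D q * S q z\<close>.\<close>

lemma T_div_has_derivative:
  assumes q: "norm q = 1" and z: "norm z < 1/64"
  shows "((\<lambda>z. z / T q z) has_field_derivative (1 / (D q * S q z))) (at z)"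
proof -
  have ds: "D q * S q z \<noteq> 0" using D_nz[OF q] S_facts(5)[OF q z] by simp
  have "((\<lambda>z. z / T q z) has_field_derivative ((T q z - z * (a q / (D q * S q z))) / (T q z * T q z))) (at z)"
    using T_facts(2)[OF q z] by (auto intro!: derivative_eq_intros T_has_derivative[OF q z])
  moreover have "T q z * (D q * S q z) - z * a q = T q z * T q z"
    using T_facts(3,4)[OF q z] by algebra
  then have "(T q z - z * (a q / (D q * S q z))) * (D q * S q z) = T q z * T q z"
    using ds by (simp add: field_simps)
  then have "(T q z - z * (a q / (D q * S q z))) / (T q z * T q z) = 1 / (D q * S q z)"
    using ds T_facts(2)[OF q z] by (metis divide_divide_eq_right divide_self_if mult_eq_0_iff nonzero_mult_div_cancel_right mult.commute nonzero_divide_mult_cancel_left)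
  ultimately show ?thesis by simp
qed

lemma m_hol: "m holomorphic_on ball 0 (1/64)"
  and j0_hol: "j0 holomorphic_on ball 0 (1/64)"
proof -
  have c: "continuous_on (ball 0 (1/64) \<times> sphere 0 1) (\<lambda>(z, q). q / T q z)"
     "continuous_on (ball 0 (1/64) \<times> sphere 0 1) (\<lambda>(z, q). q / (D q * S q z))"
    unfolding case_prod_unfold using T_facts(2) S_facts(5) D_nz
    by (intro continuous_intros S_cont T_cont continuous_on_compose2[OF D_cont]; force)+
  have h: "(\<lambda>z. q / T q z) holomorphic_on ball 0 (1/64)"
    "(\<lambda>z. q / (D q * S q z)) holomorphic_on ball 0 (1/64)" if q: "norm q = 1" for q
  proof -
    have "T q holomorphic_on ball 0 (1/64)" "S q holomorphic_on ball 0 (1/64)"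
      unfolding holomorphic_on_open[OF open_ball]
      using T_has_derivative[OF q] S_has_derivative[OF q] by (metis mem_ball_0)+
    then show "(\<lambda>z. q / T q z) holomorphic_on ball 0 (1/64)"
      "(\<lambda>z. q / (D q * S q z)) holomorphic_on ball 0 (1/64)"
      using T_facts(2) S_facts(5) D_nz q by (auto intro!: holomorphic_intros)
  qed
  show "m holomorphic_on ball 0 (1/64)" "j0 holomorphic_on ball 0 (1/64)"
    using cmean_has_field_derivative[OF open_ball c(1) h(1)] cmean_has_field_derivative[OF open_ball c(2) h(2)]
    unfolding m_def j0_def holomorphic_on_open[OF open_ball] by blast+
qed

text \<open>The derivative of the action is the period. This identity makes the Jacobian of
  \<open>(u1, u2)\<close> come out as \<open>J\<close>.\<close>

lemma zm_has_derivative: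
  assumes z: "norm z < 1/64"
  shows "((\<lambda>z. z * m z) has_field_derivative j0 z) (at z)"
proof -
  have c: "continuous_on (ball 0 (1/64) \<times> sphere 0 1) (\<lambda>(z, q). q * (z / T q z))"
    unfolding case_prod_unfold using T_facts(2)
    by (intro continuous_intros T_cont) force
  have d: "((\<lambda>z. q * (z / T q z)) has_field_derivative (q / (D q * S q z))) (at z)"
    if q: "norm q = 1" and z: "norm z < 1/64" for q z
    using DERIV_cmult[OF T_div_has_derivative[OF that], of q] by simp
  have "((\<lambda>z. cmean (\<lambda>q. q * (z / T q z))) has_field_derivative
      cmean (\<lambda>q. deriv (\<lambda>z. q * (z / T q z)) z)) (at z)"
  proof (rule cmean_has_field_derivative[OF open_ball c])
    show "(\<lambda>z. q * (z / T q z)) holomorphic_on ball 0 (1/64)" if "norm q = 1" for q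
      unfolding holomorphic_on_open[OF open_ball] using d[OF that] by (metis mem_ball_0)
  qed (use z in auto)
  moreover have "cmean (\<lambda>q. deriv (\<lambda>z. q * (z / T q z)) z) = j0 z"
    unfolding j0_def by (rule cmean_cong) (use d z in \<open>auto intro: DERIV_imp_deriv\<close>)
  moreover have "(\<lambda>z. cmean (\<lambda>q. q * (z / T q z))) = (\<lambda>z. z * m z)"
    unfolding m_def cmean_mult_left[symmetric] by (intro ext cmean_cong) simp
  ultimately show ?thesis by simp
qed

lemma j0_nz:
  assumes z: "norm z < 1/64"
  shows "j0 z \<noteq> 0"
proof -
  have "norm (j0 z - 1) \<le> 1/2"
    unfolding j0_def
  proof (rule cmean_bound)
    have "continuous_on (sphere 0 1) (\<lambda>q. S (snd (z, q)) (fst (z, q)))"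
      by (rule continuous_on_compose2[OF S_cont]) (use z in \<open>auto intro!: continuous_intros\<close>)
    then have "continuous_on (sphere 0 1) (\<lambda>q. S q z)" by simp
    then show "continuous_on (sphere 0 1) (\<lambda>q. q / (D q * S q z))"
      using z S_facts(5) D_nz by (intro continuous_intros D_cont) auto
    fix q :: complex assume q: "norm q = 1"
    have ds: "D q * S q z \<noteq> 0" using D_nz[OF q] S_facts(5)[OF q z] by simp
    have "norm (D q * (S q z - 1)) \<le> (17/16) * (1/50)"
      unfolding norm_mult using S_facts(3)[OF q z] D_near[of q] norm_triangle_sub[of "D q" q] q
      by (intro mult_mono) auto
    moreover have "q - D q * S q z = (q - D q) - D q * (S q z - 1)"
      by (simp add: algebra_simps)
    then have "norm (q - D q * S q z) \<le> norm (q - D q) + norm (D q * (S q z - 1))"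
      by (metis norm_triangle_ineq4)
    ultimately have n: "norm (q - D q * S q z) \<le> 1/10"
      using D_near[of q] q by (simp add: norm_minus_commute)
    then have "norm (D q * S q z) \<ge> 1/2"
      using norm_triangle_sub[of q "D q * S q z"] q by simp
    then have "norm ((q - D q * S q z) / (D q * S q z)) \<le> (1/10) / (1/2)"
      unfolding norm_divide using n by (intro frac_le) auto
    moreover have "q / (D q * S q z) - 1 = (q - D q * S q z) / (D q * S q z)"
      using ds by (simp add: field_simps)
    ultimately show "norm (q / (D q * S q z) - 1) \<le> 1/2" by simp
  qed
  then show ?thesis by auto
qed

end

section \<open>Solving the homological equation along the circle action\<close>

context quadratic_hamiltonian
begin

lemma open_B: "open B"
  unfolding B_def by (intro open_Times open_ball)

lemma B_prod: "(v1, v2) \<in> B \<Longrightarrow> norm (v1 * v2) < 1/64"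
  using mult_strict_mono'[of "norm v1" "1/8" "norm v2" "1/8"] by (simp add: B_def norm_mult)

text \<open>Keeps the arguments of both logarithms in \<open>K\<close> in the right half-plane, away
  from the branch cut of \<open>Ln\<close>.\<close>

lemma c_bounds:
  assumes v: "(v1, v2) \<in> B" and q: "norm q = 1"
  shows "norm (v1 / T q (v1 * v2)) < 1" "norm (a q * v2 / T q (v1 * v2)) < 1"
proof -
  have T: "norm (T q (v1 * v2)) \<ge> 15/32" using T_facts(1)[OF q B_prod[OF v]] .
  have "norm (v1 / T q (v1 * v2)) \<le> (1/8) / (15/32)"
    unfolding norm_divide using v T by (intro frac_le) (auto simp: B_def)
  then show "norm (v1 / T q (v1 * v2)) < 1" by simp
  have "norm (a q * v2 / T q (v1 * v2)) \<le> ((1/4) * (1/8)) / (15/32)"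
    unfolding norm_divide norm_mult using v T a_small[of q] q by (intro frac_le mult_mono) (auto simp: B_def)
  then show "norm (a q * v2 / T q (v1 * v2)) < 1" by simp
qed

lemma one_plus_slit: "norm z < 1 \<Longrightarrow> 1 + z \<notin> \<real>\<^sub>\<le>\<^sub>0" "norm z < 1 \<Longrightarrow> 1 - z \<notin> \<real>\<^sub>\<le>\<^sub>0"
  for z :: complex
  using Re_pos_not_nonpos[OF Re_one_plus_pos, of z] Re_pos_not_nonpos[OF Re_one_plus_pos, of "- z"] by auto

text \<open>For fixed \<^term>\<open>q\<close>, partial fractions in \<^term>\<open>t\<close> turn \<^term>\<open>1 / (D q + a q * v2 / t - t * v1)\<close> into
  geometric series in \<^term>\<open>t * v1 / T q z\<close> and \<^term>\<open>a q * v2 / (t * T q z)\<close>; dividing the coefficient of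
  \<open>t\<^sup>n\<close> by \<open>n\<close> for \<open>n \<noteq> 0\<close> gives the logarithms.\<close>

definition K :: "complex \<times> complex \<Rightarrow> complex \<Rightarrow> complex" where
  "K v q = q * (Ln (1 + a q * snd v / T q (fst v * snd v)) - Ln (1 - fst v / T q (fst v * snd v)))
             / (D q * S q (fst v * snd v))"

definition W :: "complex \<times> complex \<Rightarrow> complex" where
  "W v = cmean (K v)"

lemma K_cont: "continuous_on (B \<times> sphere 0 1) (\<lambda>(v, q). K v q)"
proof -
  let ?g = "\<lambda>y::(complex \<times> complex) \<times> complex. (fst (fst y) * snd (fst y), snd y)"
  have im: "?g ` (B \<times> sphere 0 1) \<subseteq> ball 0 (1/64) \<times> sphere 0 1"
    using B_prod by fastforce
  have g: "continuous_on (B \<times> sphere 0 1) ?g" by (intro continuous_intros)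
  have TS: "continuous_on (B \<times> sphere 0 1) (\<lambda>y. T (snd y) (fst (fst y) * snd (fst y)))"
    "continuous_on (B \<times> sphere 0 1) (\<lambda>y. S (snd y) (fst (fst y) * snd (fst y)))"
    using continuous_on_compose2[OF T_cont g im] continuous_on_compose2[OF S_cont g im] by simp_all
  have nz: "T (snd y) (fst (fst y) * snd (fst y)) \<noteq> 0" "S (snd y) (fst (fst y) * snd (fst y)) \<noteq> 0"
      "D (snd y) \<noteq> 0"
      "1 + a (snd y) * snd (fst y) / T (snd y) (fst (fst y) * snd (fst y)) \<notin> \<real>\<^sub>\<le>\<^sub>0"
      "1 - fst (fst y) / T (snd y) (fst (fst y) * snd (fst y)) \<notin> \<real>\<^sub>\<le>\<^sub>0"
    if "y \<in> B \<times> sphere 0 1" for y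
  proof -
    obtain v1 v2 q where y: "y = ((v1, v2), q)" by (metis prod.exhaust)
    have q: "norm q = 1" and v: "(v1, v2) \<in> B" using that y by auto
    show "T (snd y) (fst (fst y) * snd (fst y)) \<noteq> 0" "S (snd y) (fst (fst y) * snd (fst y)) \<noteq> 0"
      "D (snd y) \<noteq> 0"
      "1 + a (snd y) * snd (fst y) / T (snd y) (fst (fst y) * snd (fst y)) \<notin> \<real>\<^sub>\<le>\<^sub>0"
      "1 - fst (fst y) / T (snd y) (fst (fst y) * snd (fst y)) \<notin> \<real>\<^sub>\<le>\<^sub>0"
      using T_facts(2)[OF q B_prod[OF v]] S_facts(5)[OF q B_prod[OF v]] D_nz[OF q]
        one_plus_slit c_bounds[OF v q] unfolding y by auto
  qed
  show ?thesis
    unfolding K_def case_prod_unfold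
    by (intro continuous_intros TS continuous_on_compose2[OF D_cont] continuous_on_compose2[OF a_cont])
       (use nz in auto)
qed

lemma K_field_differentiable:
  assumes q: "norm q = 1" and v: "(f s, g s) \<in> B"
    and f: "f field_differentiable at s" and g: "g field_differentiable at s"
  shows "(\<lambda>s. K (f s, g s) q) field_differentiable at s"
proof -
  have z: "norm (f s * g s) < 1/64" by (rule B_prod[OF v])
  have fg: "(\<lambda>s. f s * g s) field_differentiable at s"
    by (intro derivative_intros f g)
  have T: "(\<lambda>s. T q (f s * g s)) field_differentiable at s"
    using field_differentiable_compose[OF fg, of "T q"] T_has_derivative[OF q z]
    by (auto simp: o_def field_differentiable_def)
  have S: "(\<lambda>s. S q (f s * g s)) field_differentiable at s"
    using field_differentiable_compose[OF fg, of "S q"] S_has_derivative[OF q z]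
    by (auto simp: o_def field_differentiable_def)
  have L1: "(\<lambda>s. Ln (1 + a q * g s / T q (f s * g s))) field_differentiable at s"
  proof -
    have "(\<lambda>s. 1 + a q * g s / T q (f s * g s)) field_differentiable at s"
      using T_facts(2)[OF q z] by (intro derivative_intros f g T) auto
    from field_differentiable_compose[OF this, of Ln] show ?thesis
      using one_plus_slit(1)[OF c_bounds(2)[OF v q]] by (simp add: o_def field_differentiable_at_Ln)
  qed
  have L2: "(\<lambda>s. Ln (1 - f s / T q (f s * g s))) field_differentiable at s"
  proof -
    have "(\<lambda>s. 1 - f s / T q (f s * g s)) field_differentiable at s"
      using T_facts(2)[OF q z] by (intro derivative_intros f g T) auto
    from field_differentiable_compose[OF this, of Ln] show ?thesis
      using one_plus_slit(2)[OF c_bounds(1)[OF v q]] by (simp add: o_def field_differentiable_at_Ln)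
  qed
  show ?thesis
    unfolding K_def fst_conv snd_conv
    using S_facts(5)[OF q z] D_nz[OF q] by (intro derivative_intros L1 L2 S) auto
qed

lemma W_hol2: "hol2 B W"
  unfolding W_def
proof (rule hol2_cmean[OF open_B K_cont])
  fix q :: complex assume q: "norm q = 1"
  show "hol2 B (\<lambda>v. K v q)"
    unfolding hol2_def
  proof (intro conjI allI impI)
    have "continuous_on B (\<lambda>v. case (v, q) of (v, q) \<Rightarrow> K v q)"
      by (rule continuous_on_compose2[OF K_cont]) (use q in \<open>auto intro!: continuous_intros\<close>)
    then show "continuous_on B (\<lambda>v. K v q)" by simp
    show "(\<lambda>z. K (z, b) q) field_differentiable at a'" "(\<lambda>z. K (a', z) q) field_differentiable at b"
      if "(a', b) \<in> B" for a' b
      using that by (intro K_field_differentiable[OF q] derivative_intros; simp)+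
  qed (rule open_B)
qed

text \<open>The left side is the derivative at \<open>s = 0\<close> along
  \<open>(exp s * v1, exp (- s) * v2)\<close>. This flow preserves \<open>v1 * v2\<close>, hence
  \<open>T\<close> and \<open>S\<close>, so only the arguments of the logarithms vary. Computing the
  derivative under the integral and by the chain rule gives the two sides.\<close>

lemma W_euler:
  assumes v: "(v1, v2) \<in> B" and W: "cderiv W A A' (v1, v2)"
  shows "v1 * A - v2 * A' = J (v1, v2) - j0 (v1 * v2)"
proof -
  define E where "E = {s. (exp s * v1, exp (- s) * v2) \<in> B}"
  have E: "open E" "0 \<in> E"
  proof -
    have "E = (\<lambda>s. (exp s * v1, exp (- s) * v2)) -` B" by (auto simp: E_def)
    then show "open E" by (simp only:) (intro open_vimage open_B continuous_intros)
    show "0 \<in> E" using v by (simp add: E_def)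
  qed
  have prod: "(exp s * v1) * (exp (- s) * v2) = v1 * v2" for s :: complex
    by (simp add: exp_minus field_simps)
  let ?f = "\<lambda>s q. K (exp s * v1, exp (- s) * v2) q"
  have cont: "continuous_on (E \<times> sphere 0 1) (\<lambda>(s, q). ?f s q)"
  proof -
    have "continuous_on (E \<times> sphere 0 1)
        (\<lambda>y. case ((exp (fst y) * v1, exp (- fst y) * v2), snd y) of (v, q) \<Rightarrow> K v q)"
      by (rule continuous_on_compose2[OF K_cont]) (auto simp: E_def intro!: continuous_intros)
    then show ?thesis by (simp add: case_prod_unfold)
  qed
  have hol: "(\<lambda>s. ?f s q) holomorphic_on E" if "norm q = 1" for q
    unfolding holomorphic_on_def
  proof
    fix s assume "s \<in> E"
    then have "(\<lambda>s. ?f s q) field_differentiable at s"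
      by (intro K_field_differentiable[OF that] derivative_intros)
        (auto simp: E_def intro!: field_differentiable_compose[of uminus _ exp, unfolded o_def] derivative_intros
          field_differentiable_within_exp)
    then show "(\<lambda>s. ?f s q) field_differentiable at s within E"
      by (rule field_differentiable_at_within)
  qed
  have d: "((\<lambda>s. cmean (?f s)) has_field_derivative cmean (\<lambda>q. deriv (\<lambda>s. ?f s q) 0)) (at 0)"
    by (rule cmean_has_field_derivative[OF E(1) cont hol E(2)])
  have z: "norm (v1 * v2) < 1/64" by (rule B_prod[OF v])
  have den: "D q + a q * v2 - v1 \<noteq> 0"
    and dq: "deriv (\<lambda>s. ?f s q) 0 = q / (D q + a q * v2 - v1) - q / (D q * S q (v1 * v2))" if q: "norm q = 1" for q
  proof -
    define t where "t = T q (v1 * v2)"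
    have t: "t \<noteq> 0" "t * t = D q * t + a q * (v1 * v2)" "D q * S q (v1 * v2) = 2 * t - D q"
      using T_facts[OF q z] by (auto simp: t_def)
    have ds: "2 * t - D q \<noteq> 0"
      using S_facts(5)[OF q z] D_nz[OF q] unfolding t(3)[symmetric] by simp
    have sl: "1 + a q * v2 / t \<notin> \<real>\<^sub>\<le>\<^sub>0" "1 - v1 / t \<notin> \<real>\<^sub>\<le>\<^sub>0"
      using one_plus_slit c_bounds[OF v q] by (auto simp: t_def)
    then have ne: "1 + a q * v2 / t \<noteq> 0" "1 - v1 / t \<noteq> 0" by auto
    then have ne': "t + a q * v2 \<noteq> 0" "t - v1 \<noteq> 0" using t(1) by (auto simp: field_simps)
    \<comment> \<open>The partial fractions: the quadratic equation for \<open>t\<close> splits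
      \<open>t\<close> times the denominator of \<open>J\<close> into the denominators of the two
      logarithmic derivatives.\<close>
    have fac: "(t + a q * v2) * (t - v1) = t * (D q + a q * v2 - v1)"
      using t(2) by algebra
    then show den: "D q + a q * v2 - v1 \<noteq> 0" using ne' by auto
    have d1: "((\<lambda>s. Ln (1 + a q * (exp (- s) * v2) / t)) has_field_derivative
        (- (a q * v2) / t) / (1 + a q * v2 / t)) (at 0)"
      using sl(1) t(1) by (auto intro!: derivative_eq_intros simp: divide_inverse mult_ac)
    have d2: "((\<lambda>s. Ln (1 - exp s * v1 / t)) has_field_derivative (- v1 / t) / (1 - v1 / t)) (at 0)"
      using sl(2) t(1) by (auto intro!: derivative_eq_intros simp: divide_inverse mult_ac)
    have "((\<lambda>s. q * (Ln (1 + a q * (exp (- s) * v2) / t) - Ln (1 - exp s * v1 / t)) / (2 * t - D q)) has_field_derivative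
        q * ((- (a q * v2) / t) / (1 + a q * v2 / t) - (- v1 / t) / (1 - v1 / t)) / (2 * t - D q)) (at 0)"
      by (intro DERIV_cdivide DERIV_cmult DERIV_diff d1 d2)
    moreover have "(\<lambda>s. ?f s q) = (\<lambda>s. q * (Ln (1 + a q * (exp (- s) * v2) / t) - Ln (1 - exp s * v1 / t)) / (2 * t - D q))"
      unfolding K_def fst_conv snd_conv prod t_def[symmetric] t(3) ..
    ultimately have "deriv (\<lambda>s. ?f s q) 0 =
        q * ((- (a q * v2) / t) / (1 + a q * v2 / t) - (- v1 / t) / (1 - v1 / t)) / (2 * t - D q)"
      by (simp only: DERIV_imp_deriv)
    also have "(- (a q * v2) / t) / (1 + a q * v2 / t) = - (a q * v2) / (t + a q * v2)"
      using t(1) ne ne' by (simp add: divide_simps)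
    also have "(- v1 / t) / (1 - v1 / t) = - v1 / (t - v1)"
      using t(1) ne ne' by (simp add: divide_simps)
    also have "- (a q * v2) / (t + a q * v2) - - v1 / (t - v1) =
        (v1 * (t + a q * v2) - a q * v2 * (t - v1)) / ((t + a q * v2) * (t - v1))"
      using ne' by (simp add: divide_simps)
    also have "\<dots> = (t * (2 * t - D q - (D q + a q * v2 - v1))) / (t * (D q + a q * v2 - v1))"
      unfolding fac using t(2) by (intro arg_cong2[where f = divide]) (algebra, simp)
    also have "\<dots> = (2 * t - D q) / (D q + a q * v2 - v1) - 1"
      using t(1) den by (simp add: divide_simps)
    also have "q * ((2 * t - D q) / (D q + a q * v2 - v1) - 1) / (2 * t - D q) =
        q / (D q + a q * v2 - v1) - q / (2 * t - D q)"
      using ds den by (simp add: divide_simps) (simp add: algebra_simps)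
    finally show "deriv (\<lambda>s. ?f s q) 0 = q / (D q + a q * v2 - v1) - q / (D q * S q (v1 * v2))"
      by (simp add: t(3))
  qed
  have "cmean (\<lambda>q. deriv (\<lambda>s. ?f s q) 0) = cmean (\<lambda>q. q / (D q + a q * v2 - v1) - q / (D q * S q (v1 * v2)))"
    by (rule cmean_cong) (rule dq)
  also have "\<dots> = J (v1, v2) - j0 (v1 * v2)"
    unfolding J_def j0_def fst_conv snd_conv
  proof (rule cmean_diff)
    show "continuous_on (sphere 0 1) (\<lambda>q. q / (D q + a q * v2 - v1))"
      using den by (intro continuous_intros D_cont a_cont) auto
    have "continuous_on (sphere 0 1) (\<lambda>q. S (snd (v1 * v2, q)) (fst (v1 * v2, q)))"
      by (rule continuous_on_compose2[OF S_cont]) (use z in \<open>auto intro!: continuous_intros\<close>)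
    then have "continuous_on (sphere 0 1) (\<lambda>q. S q (v1 * v2))" by simp
    then show "continuous_on (sphere 0 1) (\<lambda>q. q / (D q * S q (v1 * v2)))"
      using D_nz S_facts(5) z by (intro continuous_intros D_cont) auto
  qed
  finally have "((\<lambda>s. W (exp s * v1, exp (- s) * v2)) has_field_derivative J (v1, v2) - j0 (v1 * v2)) (at 0)"
    using d unfolding W_def by simp
  moreover have "((\<lambda>s. W (exp s * v1, exp (- s) * v2)) has_field_derivative v1 * A - v2 * A') (at 0)"
  proof -
    have "((\<lambda>s. exp s * v1) has_field_derivative v1) (at 0)"
      "((\<lambda>s. exp (- s) * v2) has_field_derivative - v2) (at 0)"
      by (auto intro!: derivative_eq_intros)
    then have "((\<lambda>s. (exp s * v1, exp (- s) * v2)) has_derivative (\<lambda>h. (v1 * h, - v2 * h))) (at 0)"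
      unfolding has_field_derivative_def by (rule has_derivative_Pair)
    moreover have "(W has_derivative (\<lambda>v. A * fst v + A' * snd v)) (at ((\<lambda>s. (exp s * v1, exp (- s) * v2)) 0))"
      using W by (simp add: cderiv_def)
    ultimately have "((\<lambda>s. W (exp s * v1, exp (- s) * v2)) has_derivative
        (\<lambda>h. A * fst (v1 * h, - v2 * h) + A' * snd (v1 * h, - v2 * h))) (at 0)"
      by (rule has_derivative_compose)
    moreover have "(\<lambda>h. A * fst (v1 * h, - v2 * h) + A' * snd (v1 * h, - v2 * h)) = (*) (v1 * A - v2 * A')"
      by (auto simp: algebra_simps)
    ultimately show ?thesis by (simp add: has_field_derivative_def)
  qed
  ultimately show ?thesis using DERIV_unique by metis
qed

end

section \<open>Symplectic coordinates for the normal form\<close>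

context quadratic_hamiltonian
begin

definition w :: "complex \<times> complex \<Rightarrow> complex" where
  "w v = W v / j0 (fst v * snd v)"

definition u1 :: "complex \<times> complex \<Rightarrow> complex" where
  "u1 v = fst v * exp (w v)"

definition u2 :: "complex \<times> complex \<Rightarrow> complex" where
  "u2 v = snd v * (m (fst v * snd v) * exp (- w v))"

lemma u1_mult_u2: "u1 v * u2 v = fst v * snd v * m (fst v * snd v)"
  by (simp add: u1_def u2_def exp_minus field_simps)

text \<open>With \<open>z = v1 * v2\<close> the determinant is
  \<open>(m z + z * m') * (1 + v1 * w1 - v2 * w2)\<close>. The first factor is \<open>j0 z\<close>,
  and the equation for \<open>W\<close> makes the second \<open>J / j0\<close>.\<close>

lemma u_jacobian:
  assumes v: "(v1, v2) \<in> B"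
  obtains A1 A2 C1 C2 where "cderiv u1 A1 A2 (v1, v2)" "cderiv u2 C1 C2 (v1, v2)"
    "A1 * C2 - A2 * C1 = J (v1, v2)"
proof -
  let ?v = "(v1, v2)" and ?z = "v1 * v2"
  have z: "norm ?z < 1/64" by (rule B_prod[OF v])
  obtain W1 W2 where W: "cderiv W W1 W2 ?v"
    using hol2_imp_cderiv[OF W_hol2 v] by blast
  have euler: "v1 * W1 - v2 * W2 = J ?v - j0 ?z" by (rule W_euler[OF v W])
  obtain j' where j': "(j0 has_field_derivative j') (at ?z)"
    using z holomorphic_derivI[OF j0_hol open_ball, of ?z UNIV] by auto
  obtain m' where m': "(m has_field_derivative m') (at ?z)"
    using z holomorphic_derivI[OF m_hol open_ball, of ?z UNIV] by auto
  have jz: "j0 ?z \<noteq> 0" by (rule j0_nz[OF z])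
  have "((\<lambda>z. z * m z) has_field_derivative (m ?z + ?z * m')) (at ?z)"
    by (auto intro!: derivative_eq_intros m')
  then have mj: "m ?z + ?z * m' = j0 ?z"
    using DERIV_unique[OF zm_has_derivative[OF z]] by simp
  have prod: "cderiv (\<lambda>v. fst v * snd v) v2 v1 ?v"
    using cderiv_mult[OF cderiv_fst cderiv_snd, of ?v] by simp
  have ij: "((\<lambda>z. inverse (j0 z)) has_field_derivative (- j' / (j0 ?z)\<^sup>2)) (at (fst ?v * snd ?v))"
    using jz by (auto intro!: derivative_eq_intros j' simp: power2_eq_square divide_inverse)
  define w1 where "w1 = W1 * inverse (j0 ?z) + W ?v * (- j' / (j0 ?z)\<^sup>2 * v2)"
  define w2 where "w2 = W2 * inverse (j0 ?z) + W ?v * (- j' / (j0 ?z)\<^sup>2 * v1)"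
  have w: "cderiv w w1 w2 ?v"
    using cderiv_mult[OF W cderiv_compose1[OF prod ij]]
    by (simp add: w_def[abs_def] w1_def w2_def divide_inverse)
  \<comment> \<open>The operator annihilates functions of \<open>v1 * v2\<close>, so
    \<open>j0\<close> behaves like a constant and its derivative drops out.\<close>
  have "v1 * w1 - v2 * w2 = (v1 * W1 - v2 * W2) * inverse (j0 ?z)"
    by (simp add: w1_def w2_def algebra_simps)
  then have ew: "j0 ?z * (1 + v1 * w1 - v2 * w2) = J ?v"
    using jz unfolding euler by (simp add: field_simps)
  define e where "e = exp (w ?v)"
  define e' where "e' = exp (- w ?v)"
  have ee: "e * e' = 1" by (simp add: e_def e'_def exp_minus)
  have "(exp has_field_derivative e) (at (w ?v))" by (simp add: e_def DERIV_exp)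
  from cderiv_mult[OF cderiv_fst cderiv_compose1[OF w this]]
  have u1: "cderiv u1 (e + v1 * (e * w1)) (v1 * (e * w2)) ?v"
    by (simp add: u1_def[abs_def] e_def)
  have "((\<lambda>x. exp (- x)) has_field_derivative - e') (at (w ?v))"
    by (auto intro!: derivative_eq_intros simp: e'_def)
  note we = cderiv_compose1[OF w this]
  have mz: "(m has_field_derivative m') (at (fst ?v * snd ?v))" using m' by simp
  from cderiv_mult[OF cderiv_snd cderiv_mult[OF cderiv_compose1[OF prod mz] we]]
  have u2: "cderiv u2 (v2 * (m' * v2 * e' + m ?z * (- e' * w1)))
      (m ?z * e' + v2 * (m' * v1 * e' + m ?z * (- e' * w2))) ?v"
    by (simp add: u2_def[abs_def] e'_def)
  have "(e + v1 * (e * w1)) * (m ?z * e' + v2 * (m' * v1 * e' + m ?z * (- e' * w2)))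
      - (v1 * (e * w2)) * (v2 * (m' * v2 * e' + m ?z * (- e' * w1)))
      = (e * e') * ((m ?z + ?z * m') * (1 + v1 * w1 - v2 * w2))"
    by (simp add: algebra_simps)
  also have "\<dots> = J ?v" by (simp add: ee mj ew)
  finally show ?thesis using u1 u2 that by blast
qed

text \<open>\<open>q\<close> to \<open>D q + a q * P\<close> is near the identity (1/16 + 1/32 <
  1/8), and \<open>J\<close> is its \<open>lagrange_deriv\<close>: the reciprocal of the Jacobian of
  \<open>(q, P)\<close> to \<open>(v1, v2)\<close>.\<close>

lemma J_eq:
  assumes q: "norm q < 1" and v: "(D q + a q * P, P) \<in> B"
  shows "J (D q + a q * P, P) * (deriv D q + deriv a q * P) = 1"
proof -
  let ?F = "\<lambda>q. D q + a q * P"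
  have P: "norm P \<le> 1/8" using v by (simp add: B_def)
  have "norm (?F z - z) \<le> 1/8" if "norm z < 2" for z
  proof -
    have "norm (a z * P) \<le> (1/4) * (1/8)"
      unfolding norm_mult using a_small[OF that] P by (intro mult_mono) auto
    then show ?thesis
      using norm_triangle_ineq[of "D z - z" "a z * P"] D_near[OF that] by (simp add: algebra_simps)
  qed
  then have F: "near_id ?F"
    by (auto simp: near_id_def intro!: holomorphic_intros D_hol a_hol)
  have "J (?F q, P) = lagrange_deriv ?F (?F q)" by (simp add: J_def lagrange_deriv_def)
  also have "\<dots> = 1 / deriv ?F q" by (rule lagrange_deriv_eq[OF F q])
  also have "deriv ?F q = deriv D q + deriv a q * P"
    using q by (intro DERIV_imp_deriv) (auto intro!: derivative_eq_intros holomorphic_derivI[OF D_hol] holomorphic_derivI[OF a_hol])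
  finally show ?thesis
    using near_id_deriv_nonzero[OF F, of q] q \<open>deriv ?F q = deriv D q + deriv a q * P\<close> by simp
qed

text \<open>The shear \<open>(q, p)\<close> to \<open>(q, p - f q)\<close> has determinant one, so
  the total Jacobian is \<open>J * (deriv D q + deriv a q * P) = 1\<close>. The zero
  \<open>qc\<close> of \<open>D\<close> on the branch \<open>P = 0\<close> is the point with
  \<open>v1 = v2 = 0\<close>.\<close>

lemma local_chart:
  assumes f: "f holomorphic_on ball 0 2" and c: "norm qc < 1" "D qc = 0"
  obtains U \<Phi>1 \<Phi>2 where "(qc, f qc) \<in> U" "symplectic_chart U \<Phi>1 \<Phi>2"
    "\<Phi>1 (qc, f qc) = 0" "\<Phi>2 (qc, f qc) = 0"
    "\<And>q p z. (q, p) \<in> U \<Longrightarrow> z = D q * (p - f q) + a q * (p - f q)\<^sup>2 \<Longrightarrow>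
        norm q < 1 \<and> norm z < 1/64 \<and> \<Phi>1 (q, p) * \<Phi>2 (q, p) = z * m z"
proof -
  let ?P = "\<lambda>y. snd y - f (fst y)"
  let ?v1 = "\<lambda>y. D (fst y) + a (fst y) * ?P y"
  let ?v = "\<lambda>y. (?v1 y, ?P y)"
  define U where "U = {y \<in> ball 0 1 \<times> UNIV. ?v y \<in> B}"
  have one_ball: "continuous_on (ball 0 1) g" if "g holomorphic_on ball 0 2" for g :: "complex \<Rightarrow> complex"
    by (intro holomorphic_on_imp_continuous_on holomorphic_on_subset[OF that]) auto
  have contP: "continuous_on (ball 0 1 \<times> UNIV) ?P"
    by (intro continuous_intros continuous_on_compose2[OF one_ball[OF f]]) auto
  have contv: "continuous_on (ball 0 1 \<times> UNIV) ?v1"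
    by (intro continuous_intros contP continuous_on_compose2[OF one_ball[OF D_hol]]
        continuous_on_compose2[OF one_ball[OF a_hol]]) auto
  have "U = (ball 0 1 \<times> UNIV) \<inter> ?v -` B"
    by (auto simp: U_def)
  also have "open \<dots>"
    by (intro continuous_open_preimage open_Times open_B continuous_intros contP contv) auto
  finally have openU: "open U" .
  have cU: "(qc, f qc) \<in> U"
    using c by (simp add: U_def B_def)
  have dv: "cderiv ?v1 (deriv D q + deriv a q * (p - f q) - a q * deriv f q) (a q) (q, p)"
    and dP: "cderiv ?P (- deriv f q) 1 (q, p)" if q: "norm q < 1" for q p
  proof -
    have "(g has_field_derivative deriv g q) (at (fst (q, p)))" if "g holomorphic_on ball 0 2" for g
      using q by (auto intro!: holomorphic_derivI[OF that])
    note d = cderiv_compose1[OF cderiv_fst this]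
    show P: "cderiv ?P (- deriv f q) 1 (q, p)"
      using cderiv_diff[OF cderiv_snd d[OF f]] by simp
    show "cderiv ?v1 (deriv D q + deriv a q * (p - f q) - a q * deriv f q) (a q) (q, p)"
      using cderiv_add[OF d[OF D_hol] cderiv_mult[OF d[OF a_hol] P]] by (simp add: add_diff_eq)
  qed
  define \<Phi>1 where "\<Phi>1 = (\<lambda>y. u1 (?v y))"
  define \<Phi>2 where "\<Phi>2 = (\<lambda>y. u2 (?v y))"
  have jac: "\<exists>A1 A2 C1 C2. cderiv \<Phi>1 A1 A2 (q, p) \<and> cderiv \<Phi>2 C1 C2 (q, p) \<and> A1 * C2 - A2 * C1 = 1"
    if "(q, p) \<in> U" for q p
  proof -
    have q: "norm q < 1" and v: "(?v1 (q, p), ?P (q, p)) \<in> B" using that by (auto simp: U_def)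
    obtain A1 A2 C1 C2 where u: "cderiv u1 A1 A2 (?v (q, p))" "cderiv u2 C1 C2 (?v (q, p))"
      "A1 * C2 - A2 * C1 = J (?v (q, p))"
      using u_jacobian[OF v] by metis
    let ?x = "deriv D q + deriv a q * (p - f q)"
    have "(A1 * (?x - a q * deriv f q) + A2 * (- deriv f q)) * (C1 * a q + C2 * 1)
       - (A1 * a q + A2 * 1) * (C1 * (?x - a q * deriv f q) + C2 * (- deriv f q))
      = (A1 * C2 - A2 * C1) * ?x"
      by (simp add: algebra_simps)
    also have "\<dots> = 1"
      unfolding u(3) using J_eq[OF q, of "p - f q"] v by simp
    finally show ?thesis
      using cderiv_compose[OF dv[OF q] dP[OF q] u(1)] cderiv_compose[OF dv[OF q] dP[OF q] u(2)]
      unfolding \<Phi>1_def \<Phi>2_def by blast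
  qed
  have hol: "hol2 U \<Phi>1" "hol2 U \<Phi>2"
    using jac by (intro hol2I openU; fastforce)+
  obtain V where V: "V \<subseteq> U" "(qc, f qc) \<in> V" "symplectic_chart V \<Phi>1 \<Phi>2"
  proof (rule symplectic_chart_locally[OF hol cU])
    fix q p assume "(q, p) \<in> U"
    from jac[OF this] obtain A1 A2 C1 C2 where
      "cderiv \<Phi>1 A1 A2 (q, p)" "cderiv \<Phi>2 C1 C2 (q, p)" "A1 * C2 - A2 * C1 = 1" by blast
    then show "deriv (\<lambda>z. \<Phi>1 (z, p)) q * deriv (\<lambda>z. \<Phi>2 (q, z)) p
        - deriv (\<lambda>z. \<Phi>1 (q, z)) p * deriv (\<lambda>z. \<Phi>2 (z, p)) q = 1"
      by (simp add: cderiv_unique_deriv)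
  qed
  show ?thesis
  proof (rule that[OF V(2,3)])
    show "\<Phi>1 (qc, f qc) = 0" "\<Phi>2 (qc, f qc) = 0"
      by (simp_all add: \<Phi>1_def \<Phi>2_def u1_def u2_def c)
    fix q p z assume y: "(q, p) \<in> V" and z: "z = D q * (p - f q) + a q * (p - f q)\<^sup>2"
    have yU: "(q, p) \<in> U" using y V(1) by auto
    have zv: "z = ?v1 (q, p) * ?P (q, p)" by (simp add: z power2_eq_square algebra_simps)
    have "?v (q, p) \<in> B" using yU by (simp add: U_def)
    then have "norm z < 1/64" unfolding zv by (rule B_prod)
    moreover have "\<Phi>1 (q, p) * \<Phi>2 (q, p) = z * m z"
      unfolding \<Phi>1_def \<Phi>2_def u1_mult_u2 zv by simp
    ultimately show "norm q < 1 \<and> norm z < 1/64 \<and> \<Phi>1 (q, p) * \<Phi>2 (q, p) = z * m z"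
      using yU zv by (simp add: U_def)
  qed
qed

end

section \<open>Parameter dependence of Lagrange inversion and of small roots\<close>

lemma lagrange_continuous:
  fixes F :: "'a::topological_space \<Rightarrow> complex \<Rightarrow> complex"
  assumes F: "continuous_on (U \<times> sphere 0 1) (\<lambda>(s, z). F s z)"
    and ni: "\<And>s. s \<in> U \<Longrightarrow> near_id (F s)"
    and h: "continuous_on U h" "\<And>s. s \<in> U \<Longrightarrow> norm (h s) < 1/2"
  shows "continuous_on U (\<lambda>s. lagrange_deriv (F s) (h s))" "continuous_on U (\<lambda>s. lagrange_inverse (F s) (h s))"
proof -
  have nz: "F (fst y) (snd y) - h (fst y) \<noteq> 0" if "y \<in> U \<times> sphere 0 1" for y
    using near_id_circle[OF ni h(2), of "fst y" "fst y" "snd y"] that by auto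
  have hf: "continuous_on (U \<times> sphere 0 1) (\<lambda>y. h (fst y))"
    by (intro continuous_on_compose2[OF h(1)] continuous_intros) auto
  have "continuous_on (U \<times> sphere 0 1) (\<lambda>(s, z). z / (F s z - h s))"
    "continuous_on (U \<times> sphere 0 1) (\<lambda>(s, z). z * z / (F s z - h s))"
    using nz unfolding case_prod_unfold
    by (intro continuous_intros F[unfolded case_prod_unfold] hf; blast)+
  from this[THEN continuous_on_cmean] show "continuous_on U (\<lambda>s. lagrange_deriv (F s) (h s))"
    "continuous_on U (\<lambda>s. lagrange_inverse (F s) (h s))"
    using lagrange_inverse(4)[OF ni h(2)] unfolding lagrange_inverse_def
    by (auto simp: lagrange_deriv_def intro!: continuous_intros)
qed

lemma lagrange_holomorphic:
  assumes V: "open V"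
    and F: "continuous_on (V \<times> sphere 0 1) (\<lambda>(s, z). F s z)"
      "\<And>z. norm z = 1 \<Longrightarrow> (\<lambda>s. F s z) holomorphic_on V"
    and ni: "\<And>s. s \<in> V \<Longrightarrow> near_id (F s)"
    and h: "h holomorphic_on V" "\<And>s. s \<in> V \<Longrightarrow> norm (h s) < 1/2"
  shows "(\<lambda>s. lagrange_deriv (F s) (h s)) holomorphic_on V" "(\<lambda>s. lagrange_inverse (F s) (h s)) holomorphic_on V"
proof -
  have nz: "F s z - h s \<noteq> 0" if "s \<in> V" "norm z = 1" for s z
    using near_id_circle[OF ni h(2), of s s z] that by auto
  have hf: "continuous_on (V \<times> sphere 0 1) (\<lambda>y. h (fst y))"
    by (intro continuous_on_compose2[OF holomorphic_on_imp_continuous_on[OF h(1)]] continuous_intros) auto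
  have c: "continuous_on (V \<times> sphere 0 1) (\<lambda>(s, z). z / (F s z - h s))"
    "continuous_on (V \<times> sphere 0 1) (\<lambda>(s, z). z * z / (F s z - h s))"
    using nz unfolding case_prod_unfold
    by (intro continuous_intros F(1)[unfolded case_prod_unfold] hf; force)+
  have d: "(\<lambda>s. z / (F s z - h s)) holomorphic_on V" "(\<lambda>s. z * z / (F s z - h s)) holomorphic_on V"
    if "norm z = 1" for z
    using nz that by (auto intro!: holomorphic_intros F h)
  show 1: "(\<lambda>s. lagrange_deriv (F s) (h s)) holomorphic_on V"
    using cmean_has_field_derivative[OF V c(1) d(1)] unfolding lagrange_deriv_def holomorphic_on_open[OF V] by blast
  have "(\<lambda>s. cmean (\<lambda>z. z * z / (F s z - h s))) holomorphic_on V"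
    using cmean_has_field_derivative[OF V c(2) d(2)] unfolding holomorphic_on_open[OF V] by blast
  then show "(\<lambda>s. lagrange_inverse (F s) (h s)) holomorphic_on V"
    unfolding lagrange_inverse_def using lagrange_inverse(4)[OF ni h(2)] by (intro holomorphic_intros 1) auto
qed

text \<open>A tube-lemma argument; it supplies all smallness hypotheses below from the vanishing of
  explicit expressions at \<open>x = e = 0\<close>.\<close>

lemma uniformly_small_near_zero:
  fixes f :: "complex \<times> complex \<Rightarrow> 'a::topological_space \<Rightarrow> complex"
  assumes K: "compact K" and f: "continuous_on (N \<times> K) (\<lambda>(s, k). f s k)"
    and N: "open N" "(0, 0) \<in> N" and f0: "\<And>k. k \<in> K \<Longrightarrow> f (0, 0) k = 0" and "\<eta> > 0"
  obtains r where "r > 0" "\<And>x e. norm x < r \<Longrightarrow> norm e < r \<Longrightarrow> (x, e) \<in> N"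
    "\<And>x e k. norm x < r \<Longrightarrow> norm e < r \<Longrightarrow> k \<in> K \<Longrightarrow> norm (f (x, e) k) \<le> \<eta>"
proof -
  obtain X where X: "(0, 0) \<in> X" "open X" "\<And>s k. s \<in> X \<inter> N \<Longrightarrow> k \<in> K \<Longrightarrow> dist (f s k) (f (0, 0) k) \<le> \<eta>"
    using continuous_on_prod_compactE[OF f K N(2) \<open>\<eta> > 0\<close>] by (metis IntD1 IntD2 case_prod_conv)
  obtain A B where AB: "open A" "open B" "(0, 0) \<in> A \<times> B" "A \<times> B \<subseteq> X \<inter> N"
    using open_prod_elim[of "X \<inter> N" "(0, 0)"] X N by blast
  obtain r1 r2 where r12: "r1 > 0" "ball 0 r1 \<subseteq> A" "r2 > 0" "ball 0 r2 \<subseteq> B"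
    using AB by (meson mem_Sigma_iff open_contains_ball)
  have small: "(x, e) \<in> X \<inter> N" if "norm x < min r1 r2" "norm e < min r1 r2" for x e
    using that r12(2,4) AB(4) by (auto simp: subset_iff)
  show ?thesis
  proof (rule that[of "min r1 r2"])
    show "norm (f (x, e) k) \<le> \<eta>" if "norm x < min r1 r2" "norm e < min r1 r2" "k \<in> K" for x e k
      using X(3)[OF small[OF that(1,2)] that(3)] f0[OF that(3)] by simp
  qed (use r12 small in auto)
qed

text \<open>The solution of \<open>\<alpha> * p^2 + \<beta> * p = N\<close> that tends to
  \<open>N / \<beta>\<close> as \<alpha> tends to 0, rationalised so that
  \<open>\<alpha> = 0\<close> causes no division by zero.\<close>

definition small_root :: "complex \<Rightarrow> complex \<Rightarrow> complex \<Rightarrow> complex" where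
  "small_root \<alpha> \<beta> N = 2 * N / (\<beta> * (1 + csqrt (1 + 4 * \<alpha> * N / \<beta>\<^sup>2)))"

text \<open>\<open>b\<close> is the unperturbed linear coefficient: \<open>q\<close> on the circle,
  or 1 once a factor of \<open>q\<close> or of \<open>q - qcrit x e\<close> is divided out.\<close>

lemma small_root_bound:
  fixes \<alpha> \<beta> N b :: complex
  assumes "norm (\<beta> - b) \<le> 1/16" "norm b = 1" "norm \<alpha> \<le> 1/64" "norm N \<le> 4"
  shows "norm \<beta> \<ge> 15/16" "norm (4 * \<alpha> * N / \<beta>\<^sup>2) < 1"
proof -
  show b: "norm \<beta> \<ge> 15/16" using assms norm_triangle_sub[of b \<beta>] by (simp add: norm_minus_commute)
  have "norm (4 * \<alpha> * N / \<beta>\<^sup>2) = 4 * norm \<alpha> * norm N / (norm \<beta>)\<^sup>2"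
    by (simp add: norm_mult norm_divide norm_power)
  also have "\<dots> \<le> 4 * (1/64) * 4 / (15/16)\<^sup>2"
    using b assms by (intro frac_le mult_mono power_mono) auto
  also have "\<dots> < 1" by (simp add: power2_eq_square)
  finally show "norm (4 * \<alpha> * N / \<beta>\<^sup>2) < 1" .
qed

lemma small_root_eq:
  assumes "\<beta> \<noteq> 0" "norm (4 * \<alpha> * N / \<beta>\<^sup>2) < 1"
  shows "\<alpha> * (small_root \<alpha> \<beta> N)\<^sup>2 + \<beta> * small_root \<alpha> \<beta> N = N"
    "norm (small_root \<alpha> \<beta> N) \<le> 2 * norm N / norm \<beta>"
proof -
  define t where "t = 1 + csqrt (1 + 4 * \<alpha> * N / \<beta>\<^sup>2)"
  have n: "norm t \<ge> 1" using csqrt_one_plus(4)[OF assms(2)] by (simp add: t_def)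
  then have t0: "t \<noteq> 0" by auto
  have "(t - 1)\<^sup>2 = 1 + 4 * \<alpha> * N / \<beta>\<^sup>2" using csqrt_one_plus(2)[OF assms(2)] by (simp add: t_def)
  then have "((t - 1)\<^sup>2 - 1) * \<beta>\<^sup>2 = 4 * \<alpha> * N" using assms(1) by simp
  then have t: "4 * \<alpha> * N = (t * t - 2 * t) * (\<beta> * \<beta>)"
    by (simp add: power2_eq_square algebra_simps)
  have r: "small_root \<alpha> \<beta> N = 2 * N / (\<beta> * t)" by (simp add: small_root_def t_def)
  have "\<alpha> * (2 * N / (\<beta> * t))\<^sup>2 = 4 * \<alpha> * N * N / ((\<beta> * t) * (\<beta> * t))"
    by (simp add: power2_eq_square)
  also have "\<dots> = N * (t - 2) / t"
    unfolding t using assms(1) t0 by (simp add: divide_simps) (simp add: algebra_simps)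
  also have "\<dots> + \<beta> * (2 * N / (\<beta> * t)) = N"
    using assms(1) t0 by (simp add: divide_simps) (simp add: algebra_simps)
  finally show "\<alpha> * (small_root \<alpha> \<beta> N)\<^sup>2 + \<beta> * small_root \<alpha> \<beta> N = N" by (simp add: r)
  have "norm (small_root \<alpha> \<beta> N) = 2 * norm N / (norm \<beta> * norm t)"
    by (simp add: r norm_mult norm_divide)
  also have "\<dots> \<le> 2 * norm N / (norm \<beta> * 1)"
    using assms(1) n by (intro divide_left_mono mult_left_mono mult_pos_pos) auto
  finally show "norm (small_root \<alpha> \<beta> N) \<le> 2 * norm N / norm \<beta>" by simp
qed

text \<open>Two distinct roots would have sum \<open>- \<beta> / \<alpha>\<close>, impossible since
  10/64 < 15/16. The bounds are asymmetric because one root is known only through the crude estimate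
  9.\<close>

lemma small_root_unique:
  fixes p1 p2 :: complex
  assumes "\<alpha> * p1\<^sup>2 + \<beta> * p1 = N" "\<alpha> * p2\<^sup>2 + \<beta> * p2 = N"
    and "norm \<alpha> \<le> 1/64" "norm \<beta> \<ge> 15/16" "norm p1 \<le> 9" "norm p2 \<le> 1"
  shows "p1 = p2"
proof (rule ccontr)
  assume "p1 \<noteq> p2"
  moreover have "(p1 - p2) * (\<alpha> * (p1 + p2) + \<beta>) = 0"
  proof -
    have "(p1 - p2) * (\<alpha> * (p1 + p2) + \<beta>) = (\<alpha> * p1\<^sup>2 + \<beta> * p1) - (\<alpha> * p2\<^sup>2 + \<beta> * p2)"
      by (simp add: power2_eq_square algebra_simps)
    then show ?thesis by (simp only: assms(1,2) diff_self)
  qed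
  ultimately have "\<beta> = - (\<alpha> * (p1 + p2))" by (simp add: eq_neg_iff_add_eq_0 add.commute)
  then have "norm \<beta> = norm \<alpha> * norm (p1 + p2)" by (simp add: norm_mult)
  also have "\<dots> \<le> (1/64) * 10"
    using assms norm_triangle_ineq[of p1 p2] by (intro mult_mono) auto
  finally show False using assms by simp
qed

text \<open>\<open>Y = q * p\<close> solves the equation whose coefficients are divided by
  \<open>q^2\<close> and \<open>q\<close>. This removes the singularity of the integrand on the two
  special slices.\<close>

lemma small_root_scale:
  assumes "q \<noteq> 0"
  shows "q * small_root (q\<^sup>2 * \<alpha>) (q * \<beta>) N = small_root \<alpha> \<beta> N"
  using assms by (simp add: small_root_def power_mult_distrib mult.assoc)

lemma continuous_on_small_root:
  assumes "continuous_on A \<alpha>" "continuous_on A \<beta>" "continuous_on A N"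
    "\<And>x. x \<in> A \<Longrightarrow> \<beta> x \<noteq> 0" "\<And>x. x \<in> A \<Longrightarrow> norm (4 * \<alpha> x * N x / (\<beta> x)\<^sup>2) < 1"
  shows "continuous_on A (\<lambda>x. small_root (\<alpha> x) (\<beta> x) (N x))"
  unfolding small_root_def
proof (intro continuous_intros continuous_on_csqrt_one_plus assms ballI)
  fix x assume "x \<in> A"
  then show "\<beta> x * (1 + csqrt (1 + 4 * \<alpha> x * N x / (\<beta> x)\<^sup>2)) \<noteq> 0"
    using csqrt_one_plus(4)[OF assms(5)[OF \<open>x \<in> A\<close>]] assms(4) by auto
qed (use assms(4) in auto)

lemma field_differentiable_small_root:
  assumes "\<alpha> field_differentiable at z" "\<beta> field_differentiable at z" "N field_differentiable at z"
    "\<beta> z \<noteq> 0" "norm (4 * \<alpha> z * N z / (\<beta> z)\<^sup>2) < 1"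
  shows "(\<lambda>z. small_root (\<alpha> z) (\<beta> z) (N z)) field_differentiable at z"
  unfolding small_root_def
proof (intro derivative_intros field_differentiable_csqrt_one_plus assms)
  show "\<beta> z * (1 + csqrt (1 + 4 * \<alpha> z * N z / (\<beta> z)\<^sup>2)) \<noteq> 0"
    using csqrt_one_plus(4)[OF assms(5)] assms(4) by auto
qed (use assms(4) in auto)

text \<open>The root is holomorphic on the whole disc, so its mean is its value at the centre, which
  solves the equation with the coefficients at 0.\<close>

lemma cmean_small_root:
  assumes hol: "\<alpha> holomorphic_on ball 0 2" "\<beta> holomorphic_on ball 0 2" "N holomorphic_on ball 0 2"
    and bd: "\<And>q. norm q < 2 \<Longrightarrow> norm (\<beta> q - 1) \<le> 1/16" "\<And>q. norm q < 2 \<Longrightarrow> norm (\<alpha> q) \<le> 1/64"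
      "\<And>q. norm q < 2 \<Longrightarrow> norm (N q) \<le> 4"
  defines "Y \<equiv> cmean (\<lambda>q. small_root (\<alpha> q) (\<beta> q) (N q))"
  shows "\<alpha> 0 * Y\<^sup>2 + \<beta> 0 * Y = N 0"
proof -
  have b: "\<beta> q \<noteq> 0" "norm (4 * \<alpha> q * N q / (\<beta> q)\<^sup>2) < 1" if "norm q < 2" for q
    using small_root_bound[of "\<beta> q" 1 "\<alpha> q" "N q"] bd[OF that] by auto
  have "(\<lambda>q. small_root (\<alpha> q) (\<beta> q) (N q)) holomorphic_on ball 0 2"
    unfolding holomorphic_on_def
  proof
    fix q :: complex assume q: "q \<in> ball 0 2"
    have "(\<lambda>q. small_root (\<alpha> q) (\<beta> q) (N q)) field_differentiable at q"
      using b q by (intro field_differentiable_small_root holomorphic_on_imp_differentiable_at[OF hol(1)]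
          holomorphic_on_imp_differentiable_at[OF hol(2)] holomorphic_on_imp_differentiable_at[OF hol(3)]) auto
    then show "(\<lambda>q. small_root (\<alpha> q) (\<beta> q) (N q)) field_differentiable at q within ball 0 2"
      by (rule field_differentiable_at_within)
  qed
  then have "Y = small_root (\<alpha> 0) (\<beta> 0) (N 0)"
    unfolding Y_def by (intro cmean_mean_value) auto
  then show ?thesis using small_root_eq(1)[OF b(1) b(2), of 0] by simp
qed

section \<open>The confluent family\<close>

text \<open>In the application \<open>\<sigma>\<close> is \<open>\<theta>0 + \<theta>1\<close> and
  \<open>A\<close> is \<open>((\<theta>0 + \<theta>1)^2 - \<theta>inf^2) / 4\<close>.\<close>

locale confluent_family =
  fixes \<theta> \<sigma> A :: complex
begin

definition a :: "complex \<Rightarrow> complex \<Rightarrow> complex \<Rightarrow> complex" where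
  "a q x e = (2 * x - e) * q^2 - x * q - (x - e) * q^3"

definition b0 :: "complex \<Rightarrow> complex \<Rightarrow> complex" where
  "b0 x e = 1 - e - (x - e) * \<theta> - x * \<sigma>"

definition b :: "complex \<Rightarrow> complex \<Rightarrow> complex \<Rightarrow> complex" where
  "b q x e = x * \<theta> + b0 x e * q + (x - e) * \<sigma> * q^2"

definition c :: "complex \<Rightarrow> complex \<Rightarrow> complex \<Rightarrow> complex" where
  "c q x e = - A * ((x - e) * q - x)"

definition H :: "complex \<Rightarrow> complex \<Rightarrow> complex \<Rightarrow> complex \<Rightarrow> complex" where
  "H q p x e = a q x e * p^2 + b q x e * p + c q x e"

definition Hp :: "complex \<Rightarrow> complex \<Rightarrow> complex \<Rightarrow> complex \<Rightarrow> complex" where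
  "Hp q p x e = b q x e + 2 * a q x e * p"

definition Hq :: "complex \<Rightarrow> complex \<Rightarrow> complex \<Rightarrow> complex \<Rightarrow> complex" where
  "Hq q p x e = (2 * (2 * x - e) * q - x - 3 * (x - e) * q^2) * p^2 + (b0 x e + 2 * (x - e) * \<sigma> * q) * p - A * (x - e)"

definition F :: "complex \<Rightarrow> complex \<Rightarrow> complex \<Rightarrow> complex" where
  "F E x e = cmean (\<lambda>q. q * small_root (a q x e) (b q x e) (E - c q x e))"

text \<open>The critical point is found by two nested one-variable inversions: \<open>q\<close> is
  eliminated from \<open>Hp = 0\<close> at fixed \<open>p\<close>, and then \<open>Hq = 0\<close> is
  solved for \<open>p\<close>.\<close>

definition qcrit_of :: "complex \<Rightarrow> complex \<Rightarrow> complex \<Rightarrow> complex" where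
  "qcrit_of p x e = lagrange_inverse (\<lambda>q. Hp q p x e) 0"

definition pcrit :: "complex \<Rightarrow> complex \<Rightarrow> complex" where
  "pcrit x e = lagrange_inverse (\<lambda>p. Hq (qcrit_of p x e) p x e) 0"

definition qcrit :: "complex \<Rightarrow> complex \<Rightarrow> complex" where
  "qcrit x e = qcrit_of (pcrit x e) x e"

text \<open>At the critical point \<^term>\<open>(q0, p0)\<close> with \<^term>\<open>Q = q - q0\<close>, the coefficients of the expansion in
  \<^term>\<open>p - p0\<close> are \<^term>\<open>a\<close>, \<^term>\<open>Q * b1\<close> and \<^term>\<open>H q0 p0 x e + Q\<^sup>2 * c2\<close>.\<close>

definition b1 :: "complex \<Rightarrow> complex \<Rightarrow> complex \<Rightarrow> complex" where
  "b1 q x e = b0 x e - 2 * x * pcrit x e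
     + ((x - e) * \<sigma> + 2 * (2 * x - e) * pcrit x e) * (q + qcrit x e)
     - 2 * (x - e) * pcrit x e * (q^2 + q * qcrit x e + (qcrit x e)^2)"

definition c2 :: "complex \<Rightarrow> complex \<Rightarrow> complex \<Rightarrow> complex" where
  "c2 q x e = (x - e) * \<sigma> * pcrit x e + (2 * x - e) * (pcrit x e)^2
     - (x - e) * (pcrit x e)^2 * (q + 2 * qcrit x e)"

definition Ecrit :: "complex \<Rightarrow> complex \<Rightarrow> complex" where
  "Ecrit x e = H (qcrit x e) (pcrit x e) x e"

text \<open>\<open>b1\<close> is the divided difference of \<open>Hp\<close> in \<open>q\<close>
  between \<open>q\<close> and the critical point.\<close>

lemma b1_eq:
  assumes "Hp (qcrit x e) (pcrit x e) x e = 0"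
  shows "Hp q (pcrit x e) x e = (q - qcrit x e) * b1 q x e"
proof -
  have "Hp q (pcrit x e) x e - Hp (qcrit x e) (pcrit x e) x e = (q - qcrit x e) * b1 q x e"
    unfolding Hp_def b1_def a_def b_def by algebra
  then show ?thesis by (simp add: assms)
qed

text \<open>The first-order term in \<open>q - qcrit x e\<close> is \<open>Hq\<close> at the
  critical point, which vanishes; what remains is divisible by the square.\<close>

lemma c2_eq:
  assumes "Hq (qcrit x e) (pcrit x e) x e = 0"
  shows "H q (pcrit x e) x e = Ecrit x e + (q - qcrit x e)^2 * c2 q x e"
proof -
  have "H q (pcrit x e) x e - Ecrit x e - (q - qcrit x e)^2 * c2 q x e =
      (q - qcrit x e) * Hq (qcrit x e) (pcrit x e) x e"
    unfolding H_def Hq_def c2_def a_def b_def c_def Ecrit_def by algebra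
  then show ?thesis by (simp add: assms diff_eq_eq add.commute)
qed

lemmas coeff_defs = a_def b_def c_def b0_def

lemma continuous_on_coeffs:
  assumes "continuous_on S f" "continuous_on S g" "continuous_on S h"
  shows "continuous_on S (\<lambda>y. a (f y) (g y) (h y))" "continuous_on S (\<lambda>y. b (f y) (g y) (h y))"
    "continuous_on S (\<lambda>y. c (f y) (g y) (h y))"
  unfolding coeff_defs by (intro continuous_intros assms)+

lemma field_differentiable_coeffs:
  "(\<lambda>x. a q x e) field_differentiable at x" "(\<lambda>x. b q x e) field_differentiable at x"
  "(\<lambda>x. c q x e) field_differentiable at x"
  "(\<lambda>e. a q x e) field_differentiable at e" "(\<lambda>e. b q x e) field_differentiable at e"
  "(\<lambda>e. c q x e) field_differentiable at e"
  unfolding coeff_defs by (intro derivative_intros)+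

text \<open>At \<open>x = e = 0\<close> one has \<open>a = c = 0\<close>, \<open>b = q\<close>,
  \<open>Hp = q\<close> and \<open>Hq = p\<close>. The last five bounds concern the rescaled
  coefficients on the slices: in \<open>q\<close> for \<open>x = 0\<close>, in \<open>1 / q\<close>
  for \<open>x = e\<close>.\<close>

lemma small_coefficients:
  obtains r where "r > 0"
    "\<And>x e q. norm x < r \<Longrightarrow> norm e < r \<Longrightarrow> norm q \<le> 2 \<Longrightarrow> norm (a q x e) \<le> 1/64"
    "\<And>x e q. norm x < r \<Longrightarrow> norm e < r \<Longrightarrow> norm q \<le> 2 \<Longrightarrow> norm (b q x e - q) \<le> 1/16"
    "\<And>x e q. norm x < r \<Longrightarrow> norm e < r \<Longrightarrow> norm q \<le> 2 \<Longrightarrow> norm (c q x e) \<le> 1/16"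
    "\<And>x e q p. norm x < r \<Longrightarrow> norm e < r \<Longrightarrow> norm q \<le> 2 \<Longrightarrow> norm p \<le> 2 \<Longrightarrow> norm (Hp q p x e - q) \<le> 1/8"
    "\<And>x e q p. norm x < r \<Longrightarrow> norm e < r \<Longrightarrow> norm q \<le> 2 \<Longrightarrow> norm p \<le> 2 \<Longrightarrow> norm (Hq q p x e - p) \<le> 1/8"
    "\<And>e q :: complex. norm e < r \<Longrightarrow> norm q \<le> 2 \<Longrightarrow> norm (e * (1 - q)) \<le> 1/64"
    "\<And>e q. norm e < r \<Longrightarrow> norm q \<le> 2 \<Longrightarrow> norm (1 - e + e * \<theta> - e * \<sigma> * q - 1) \<le> 1/16"
    "\<And>e q. norm e < r \<Longrightarrow> norm q \<le> 2 \<Longrightarrow> norm (1 - e - e * \<sigma> + e * \<theta> * q - 1) \<le> 1/16"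
    "\<And>e q. norm e < r \<Longrightarrow> norm q \<le> 2 \<Longrightarrow> norm (A * e * q) \<le> 1/16"
    "\<And>e. norm e < r \<Longrightarrow> norm (A * e) \<le> 1/16"
proof -
  have one: "\<exists>r>0. \<forall>x e q. norm x < r \<longrightarrow> norm e < r \<longrightarrow> norm q \<le> 2 \<longrightarrow> norm (f (x, e) q) \<le> \<eta>"
    if "continuous_on UNIV (\<lambda>y. f (fst y) (snd y))" "\<And>q. f (0, 0) q = 0" "\<eta> > 0"
    for f :: "complex \<times> complex \<Rightarrow> complex \<Rightarrow> complex" and \<eta>
  proof -
    have "continuous_on (UNIV \<times> cball 0 2) (\<lambda>(s, k). f s k)"
      unfolding case_prod_unfold by (rule continuous_on_subset[OF that(1)]) auto
    from uniformly_small_near_zero[OF compact_cball this open_UNIV UNIV_I that(2) that(3)]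
    show ?thesis by (metis mem_cball_0)
  qed
  have two: "\<exists>r>0. \<forall>x e q p. norm x < r \<longrightarrow> norm e < r \<longrightarrow> norm q \<le> 2 \<longrightarrow> norm p \<le> 2 \<longrightarrow> norm (f (x, e) (q, p)) \<le> \<eta>"
    if "continuous_on UNIV (\<lambda>y. f (fst y) (snd y))" "\<And>q. f (0, 0) q = 0" "\<eta> > 0"
    for f :: "complex \<times> complex \<Rightarrow> complex \<times> complex \<Rightarrow> complex" and \<eta>
  proof -
    have "continuous_on (UNIV \<times> (cball 0 2 \<times> cball 0 2)) (\<lambda>(s, k). f s k)"
      unfolding case_prod_unfold by (rule continuous_on_subset[OF that(1)]) auto
    from uniformly_small_near_zero[OF compact_Times[OF compact_cball compact_cball] this open_UNIV UNIV_I that(2) that(3)]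
    show ?thesis by (metis mem_cball_0 mem_Sigma_iff)
  qed
  have "\<exists>r>0. \<forall>x e q. norm (x::complex) < r \<longrightarrow> norm (e::complex) < r \<longrightarrow> norm q \<le> 2 \<longrightarrow> norm (a q x e) \<le> 1/64"
  proof -
    let ?f = "\<lambda>(s::complex \<times> complex) (q::complex). a q (fst s) (snd s)"
    have "continuous_on UNIV (\<lambda>y. ?f (fst y) (snd y))"
      unfolding coeff_defs by (intro continuous_intros)
    moreover have "?f (0, 0) k = 0" for k by (simp add: coeff_defs)
    ultimately have "\<exists>r>0. \<forall>x e q. norm x < r \<longrightarrow> norm e < r \<longrightarrow> norm q \<le> 2 \<longrightarrow> norm (?f (x, e) q) \<le> 1/64"
      by (rule one) simp
    then show ?thesis by (simp only: fst_conv snd_conv)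
  qed
  then obtain r1 where r1: "r1 > 0" "\<And>x e q. norm (x::complex) < r1 \<Longrightarrow> norm (e::complex) < r1 \<Longrightarrow> norm q \<le> 2 \<Longrightarrow> norm (a q x e) \<le> 1/64"
    by (elim exE conjE) (rule that; blast)
  have "\<exists>r>0. \<forall>x e q. norm (x::complex) < r \<longrightarrow> norm (e::complex) < r \<longrightarrow> norm q \<le> 2 \<longrightarrow> norm (b q x e - q) \<le> 1/16"
  proof -
    let ?f = "\<lambda>(s::complex \<times> complex) (q::complex). b q (fst s) (snd s) - q"
    have "continuous_on UNIV (\<lambda>y. ?f (fst y) (snd y))"
      unfolding coeff_defs by (intro continuous_intros)
    moreover have "?f (0, 0) k = 0" for k by (simp add: coeff_defs)
    ultimately have "\<exists>r>0. \<forall>x e q. norm x < r \<longrightarrow> norm e < r \<longrightarrow> norm q \<le> 2 \<longrightarrow> norm (?f (x, e) q) \<le> 1/16"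
      by (rule one) simp
    then show ?thesis by (simp only: fst_conv snd_conv)
  qed
  then obtain r2 where r2: "r2 > 0" "\<And>x e q. norm (x::complex) < r2 \<Longrightarrow> norm (e::complex) < r2 \<Longrightarrow> norm q \<le> 2 \<Longrightarrow> norm (b q x e - q) \<le> 1/16"
    by (elim exE conjE) (rule that; blast)
  have "\<exists>r>0. \<forall>x e q. norm (x::complex) < r \<longrightarrow> norm (e::complex) < r \<longrightarrow> norm q \<le> 2 \<longrightarrow> norm (c q x e) \<le> 1/16"
  proof -
    let ?f = "\<lambda>(s::complex \<times> complex) (q::complex). c q (fst s) (snd s)"
    have "continuous_on UNIV (\<lambda>y. ?f (fst y) (snd y))"
      unfolding coeff_defs by (intro continuous_intros)
    moreover have "?f (0, 0) k = 0" for k by (simp add: coeff_defs)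
    ultimately have "\<exists>r>0. \<forall>x e q. norm x < r \<longrightarrow> norm e < r \<longrightarrow> norm q \<le> 2 \<longrightarrow> norm (?f (x, e) q) \<le> 1/16"
      by (rule one) simp
    then show ?thesis by (simp only: fst_conv snd_conv)
  qed
  then obtain r3 where r3: "r3 > 0" "\<And>x e q. norm (x::complex) < r3 \<Longrightarrow> norm (e::complex) < r3 \<Longrightarrow> norm q \<le> 2 \<Longrightarrow> norm (c q x e) \<le> 1/16"
    by (elim exE conjE) (rule that; blast)
  have "\<exists>r>0. \<forall>x e q p. norm (x::complex) < r \<longrightarrow> norm (e::complex) < r \<longrightarrow> norm q \<le> 2 \<longrightarrow> norm p \<le> 2 \<longrightarrow> norm (Hp q p x e - q) \<le> 1/8"
  proof -
    let ?f = "\<lambda>(s::complex \<times> complex) (k::complex \<times> complex). Hp (fst k) (snd k) (fst s) (snd s) - fst k"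
    have "continuous_on UNIV (\<lambda>y. ?f (fst y) (snd y))"
      unfolding coeff_defs Hp_def by (intro continuous_intros)
    moreover have "?f (0, 0) k = 0" for k by (simp add: coeff_defs Hp_def)
    ultimately have "\<exists>r>0. \<forall>x e q p. norm x < r \<longrightarrow> norm e < r \<longrightarrow> norm q \<le> 2 \<longrightarrow> norm p \<le> 2 \<longrightarrow> norm (?f (x, e) (q, p)) \<le> 1/8"
      by (rule two) simp
    then show ?thesis by (simp only: fst_conv snd_conv)
  qed
  then obtain r4 where r4: "r4 > 0" "\<And>x e q p. norm (x::complex) < r4 \<Longrightarrow> norm (e::complex) < r4 \<Longrightarrow> norm q \<le> 2 \<Longrightarrow> norm p \<le> 2 \<Longrightarrow> norm (Hp q p x e - q) \<le> 1/8"
    by (elim exE conjE) (rule that; blast)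
  have "\<exists>r>0. \<forall>x e q p. norm (x::complex) < r \<longrightarrow> norm (e::complex) < r \<longrightarrow> norm q \<le> 2 \<longrightarrow> norm p \<le> 2 \<longrightarrow> norm (Hq q p x e - p) \<le> 1/8"
  proof -
    let ?f = "\<lambda>(s::complex \<times> complex) (k::complex \<times> complex). Hq (fst k) (snd k) (fst s) (snd s) - snd k"
    have "continuous_on UNIV (\<lambda>y. ?f (fst y) (snd y))"
      unfolding coeff_defs Hq_def by (intro continuous_intros)
    moreover have "?f (0, 0) k = 0" for k by (simp add: coeff_defs Hq_def)
    ultimately have "\<exists>r>0. \<forall>x e q p. norm x < r \<longrightarrow> norm e < r \<longrightarrow> norm q \<le> 2 \<longrightarrow> norm p \<le> 2 \<longrightarrow> norm (?f (x, e) (q, p)) \<le> 1/8"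
      by (rule two) simp
    then show ?thesis by (simp only: fst_conv snd_conv)
  qed
  then obtain r5 where r5: "r5 > 0" "\<And>x e q p. norm (x::complex) < r5 \<Longrightarrow> norm (e::complex) < r5 \<Longrightarrow> norm q \<le> 2 \<Longrightarrow> norm p \<le> 2 \<Longrightarrow> norm (Hq q p x e - p) \<le> 1/8"
    by (elim exE conjE) (rule that; blast)
  have "\<exists>r>0. \<forall>x e q. norm (x::complex) < r \<longrightarrow> norm (e::complex) < r \<longrightarrow> norm q \<le> 2 \<longrightarrow> norm (e * (1 - q)) \<le> 1/64"
  proof -
    let ?f = "\<lambda>(s::complex \<times> complex) (q::complex). snd s * (1 - q)"
    have "continuous_on UNIV (\<lambda>y. ?f (fst y) (snd y))"
      unfolding coeff_defs by (intro continuous_intros)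
    moreover have "?f (0, 0) k = 0" for k by (simp add: coeff_defs)
    ultimately have "\<exists>r>0. \<forall>x e q. norm x < r \<longrightarrow> norm e < r \<longrightarrow> norm q \<le> 2 \<longrightarrow> norm (?f (x, e) q) \<le> 1/64"
      by (rule one) simp
    then show ?thesis by (simp only: fst_conv snd_conv)
  qed
  then obtain r6 where r6: "r6 > 0" "\<And>x e q. norm (x::complex) < r6 \<Longrightarrow> norm (e::complex) < r6 \<Longrightarrow> norm q \<le> 2 \<Longrightarrow> norm (e * (1 - q)) \<le> 1/64"
    by (elim exE conjE) (rule that; blast)
  have "\<exists>r>0. \<forall>x e q. norm (x::complex) < r \<longrightarrow> norm (e::complex) < r \<longrightarrow> norm q \<le> 2 \<longrightarrow> norm (1 - e + e * \<theta> - e * \<sigma> * q - 1) \<le> 1/16"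
  proof -
    let ?f = "\<lambda>(s::complex \<times> complex) (q::complex). 1 - snd s + snd s * \<theta> - snd s * \<sigma> * q - 1"
    have "continuous_on UNIV (\<lambda>y. ?f (fst y) (snd y))"
      unfolding coeff_defs by (intro continuous_intros)
    moreover have "?f (0, 0) k = 0" for k by (simp add: coeff_defs)
    ultimately have "\<exists>r>0. \<forall>x e q. norm x < r \<longrightarrow> norm e < r \<longrightarrow> norm q \<le> 2 \<longrightarrow> norm (?f (x, e) q) \<le> 1/16"
      by (rule one) simp
    then show ?thesis by (simp only: fst_conv snd_conv)
  qed
  then obtain r7 where r7: "r7 > 0" "\<And>x e q. norm (x::complex) < r7 \<Longrightarrow> norm (e::complex) < r7 \<Longrightarrow> norm q \<le> 2 \<Longrightarrow> norm (1 - e + e * \<theta> - e * \<sigma> * q - 1) \<le> 1/16"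
    by (elim exE conjE) (rule that; blast)
  have "\<exists>r>0. \<forall>x e q. norm (x::complex) < r \<longrightarrow> norm (e::complex) < r \<longrightarrow> norm q \<le> 2 \<longrightarrow> norm (1 - e - e * \<sigma> + e * \<theta> * q - 1) \<le> 1/16"
  proof -
    let ?f = "\<lambda>(s::complex \<times> complex) (q::complex). 1 - snd s - snd s * \<sigma> + snd s * \<theta> * q - 1"
    have "continuous_on UNIV (\<lambda>y. ?f (fst y) (snd y))"
      unfolding coeff_defs by (intro continuous_intros)
    moreover have "?f (0, 0) k = 0" for k by (simp add: coeff_defs)
    ultimately have "\<exists>r>0. \<forall>x e q. norm x < r \<longrightarrow> norm e < r \<longrightarrow> norm q \<le> 2 \<longrightarrow> norm (?f (x, e) q) \<le> 1/16"
      by (rule one) simp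
    then show ?thesis by (simp only: fst_conv snd_conv)
  qed
  then obtain r8 where r8: "r8 > 0" "\<And>x e q. norm (x::complex) < r8 \<Longrightarrow> norm (e::complex) < r8 \<Longrightarrow> norm q \<le> 2 \<Longrightarrow> norm (1 - e - e * \<sigma> + e * \<theta> * q - 1) \<le> 1/16"
    by (elim exE conjE) (rule that; blast)
  have "\<exists>r>0. \<forall>x e q. norm (x::complex) < r \<longrightarrow> norm (e::complex) < r \<longrightarrow> norm q \<le> 2 \<longrightarrow> norm (A * e * q) \<le> 1/16"
  proof -
    let ?f = "\<lambda>(s::complex \<times> complex) (q::complex). A * snd s * q"
    have "continuous_on UNIV (\<lambda>y. ?f (fst y) (snd y))"
      unfolding coeff_defs by (intro continuous_intros)
    moreover have "?f (0, 0) k = 0" for k by (simp add: coeff_defs)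
    ultimately have "\<exists>r>0. \<forall>x e q. norm x < r \<longrightarrow> norm e < r \<longrightarrow> norm q \<le> 2 \<longrightarrow> norm (?f (x, e) q) \<le> 1/16"
      by (rule one) simp
    then show ?thesis by (simp only: fst_conv snd_conv)
  qed
  then obtain r9 where r9: "r9 > 0" "\<And>x e q. norm (x::complex) < r9 \<Longrightarrow> norm (e::complex) < r9 \<Longrightarrow> norm q \<le> 2 \<Longrightarrow> norm (A * e * q) \<le> 1/16"
    by (elim exE conjE) (rule that; blast)
  define r where "r = min r1 (min r2 (min r3 (min r4 (min r5 (min r6 (min r7 (min r8 r9)))))))"
  have less_r: "t < r \<longleftrightarrow> t < r1 \<and> t < r2 \<and> t < r3 \<and> t < r4 \<and> t < r5 \<and> t < r6 \<and> t < r7 \<and> t < r8 \<and> t < r9" for t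
    by (simp only: r_def min_less_iff_conj)
  show ?thesis
  proof (rule that[of r])
    show "norm (A * e) \<le> 1/16" if "norm e < r" for e
      using r9(2)[of 0 e 1] r9(1) that by (simp add: less_r)
    show "norm (e * (1 - q)) \<le> 1/64" if "norm e < r" "norm q \<le> 2" for e q :: complex
      using r6(2)[of 0 e q] r6(1) that by (simp add: less_r)
    show "norm (1 - e + e * \<theta> - e * \<sigma> * q - 1) \<le> 1/16" if "norm e < r" "norm q \<le> 2" for e q
      using r7(2)[of 0 e q] r7(1) that by (simp add: less_r)
    show "norm (1 - e - e * \<sigma> + e * \<theta> * q - 1) \<le> 1/16" if "norm e < r" "norm q \<le> 2" for e q
      using r8(2)[of 0 e q] r8(1) that by (simp add: less_r)
    show "norm (A * e * q) \<le> 1/16" if "norm e < r" "norm q \<le> 2" for e q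
      using r9(2)[of 0 e q] r9(1) that by (simp add: less_r)
    show "r > 0" using r1(1) r2(1) r3(1) r4(1) r5(1) r6(1) r7(1) r8(1) r9(1) by (simp add: less_r)
    show "norm (a q x e) \<le> 1/64" if "norm x < r" "norm e < r" "norm q \<le> 2" for x e q
      using that by (intro r1(2)) (simp_all add: less_r)
    show "norm (b q x e - q) \<le> 1/16" if "norm x < r" "norm e < r" "norm q \<le> 2" for x e q
      using that by (intro r2(2)) (simp_all add: less_r)
    show "norm (c q x e) \<le> 1/16" if "norm x < r" "norm e < r" "norm q \<le> 2" for x e q
      using that by (intro r3(2)) (simp_all add: less_r)
    show "norm (Hp q p x e - q) \<le> 1/8" if "norm x < r" "norm e < r" "norm q \<le> 2" "norm p \<le> 2" for x e q p
      using that by (intro r4(2)) (simp_all add: less_r)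
    show "norm (Hq q p x e - p) \<le> 1/8" if "norm x < r" "norm e < r" "norm q \<le> 2" "norm p \<le> 2" for x e q p
      using that by (intro r5(2)) (simp_all add: less_r)
  qed
qed

end

section \<open>Action integral and critical point for small parameters\<close>

locale confluent_disc = confluent_family +
  fixes r :: real
  assumes r: "r > 0"
    and a_small: "\<And>x e q. norm x < r \<Longrightarrow> norm e < r \<Longrightarrow> norm q \<le> 2 \<Longrightarrow> norm (a q x e) \<le> 1/64"
    and b_near: "\<And>x e q. norm x < r \<Longrightarrow> norm e < r \<Longrightarrow> norm q \<le> 2 \<Longrightarrow> norm (b q x e - q) \<le> 1/16"
    and c_small: "\<And>x e q. norm x < r \<Longrightarrow> norm e < r \<Longrightarrow> norm q \<le> 2 \<Longrightarrow> norm (c q x e) \<le> 1/16"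
    and Hp_near: "\<And>x e q p. norm x < r \<Longrightarrow> norm e < r \<Longrightarrow> norm q \<le> 2 \<Longrightarrow> norm p \<le> 2 \<Longrightarrow> norm (Hp q p x e - q) \<le> 1/8"
    and Hq_near: "\<And>x e q p. norm x < r \<Longrightarrow> norm e < r \<Longrightarrow> norm q \<le> 2 \<Longrightarrow> norm p \<le> 2 \<Longrightarrow> norm (Hq q p x e - p) \<le> 1/8"
begin

lemma small_root_conditions:
  assumes "norm q = 1" "norm E < 3" "norm x < r" "norm e < r"
  shows "norm (b q x e) \<ge> 15/16" "b q x e \<noteq> 0" "norm (4 * a q x e * (E - c q x e) / (b q x e)\<^sup>2) < 1"
    "norm (small_root (a q x e) (b q x e) (E - c q x e)) \<le> 9"
proof -
  have N: "norm (E - c q x e) \<le> 4"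
    using norm_triangle_ineq4[of E "c q x e"] c_small[of x e q] assms by simp
  show b: "norm (b q x e) \<ge> 15/16" and k: "norm (4 * a q x e * (E - c q x e) / (b q x e)\<^sup>2) < 1"
    using small_root_bound[OF b_near[of x e q] _ a_small[of x e q] N] assms by auto
  show b0: "b q x e \<noteq> 0" using b by auto
  have "norm (small_root (a q x e) (b q x e) (E - c q x e)) \<le> 2 * norm (E - c q x e) / norm (b q x e)"
    by (rule small_root_eq(2)[OF b0 k])
  \<comment> \<open>From \<open>norm E < 3\<close> and \<open>norm (c q x e) \<le> 1/16\<close> the
    right-hand side is at most 4, and 8 / (15/16) < 9.\<close>
  also have "\<dots> \<le> 2 * 4 / (15/16)" using N b by (intro frac_le) auto
  finally show "norm (small_root (a q x e) (b q x e) (E - c q x e)) \<le> 9" by simp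
qed

text \<open>Radius 3 in \<open>E\<close> leaves the closed disc of radius 2, the domain of
  \<open>near_id\<close>, in the interior.\<close>

lemma F_hol3: "hol3 (ball 0 3 \<times> ball 0 r \<times> ball 0 r) (\<lambda>(E, x, e). F E x e)"
  unfolding F_def case_prod_unfold
proof (rule hol3_cmean)
  show "open (ball (0::complex) 3 \<times> ball (0::complex) r \<times> ball (0::complex) r)"
    by (intro open_Times open_ball)
  let ?f = "\<lambda>v q. q * small_root (a q (fst (snd v)) (snd (snd v))) (b q (fst (snd v)) (snd (snd v)))
      (fst v - c q (fst (snd v)) (snd (snd v)))"
  show cont: "continuous_on ((ball 0 3 \<times> ball 0 r \<times> ball 0 r) \<times> sphere 0 1) (\<lambda>(v, q). ?f v q)"
    unfolding case_prod_unfold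
  proof (intro continuous_intros continuous_on_small_root)
    fix y :: "(complex \<times> complex \<times> complex) \<times> complex"
    assume "y \<in> (ball 0 3 \<times> ball 0 r \<times> ball 0 r) \<times> sphere 0 1"
    then show "b (snd y) (fst (snd (fst y))) (snd (snd (fst y))) \<noteq> 0"
      "norm (4 * a (snd y) (fst (snd (fst y))) (snd (snd (fst y))) *
              (fst (fst y) - c (snd y) (fst (snd (fst y))) (snd (snd (fst y)))) /
              (b (snd y) (fst (snd (fst y))) (snd (snd (fst y))))\<^sup>2) < 1"
      using small_root_conditions(2,3)[of "snd y" "fst (fst y)" "fst (snd (fst y))" "snd (snd (fst y))"] by auto
  qed (intro continuous_on_coeffs continuous_intros)+
  fix q :: complex assume q: "norm q = 1"
  have "continuous_on (ball 0 3 \<times> ball 0 r \<times> ball 0 r) (\<lambda>v. case (v, q) of (v, q) \<Rightarrow> ?f v q)"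
    by (rule continuous_on_compose2[OF cont]) (use q in \<open>auto intro!: continuous_intros\<close>)
  then have c: "continuous_on (ball 0 3 \<times> ball 0 r \<times> ball 0 r) (\<lambda>v. ?f v q)" by simp
  show "hol3 (ball 0 3 \<times> ball 0 r \<times> ball 0 r) (\<lambda>v. ?f v q)"
    unfolding hol3_def
  proof (intro conjI allI impI open_Times open_ball c)
    fix E x e :: complex assume "(E, x, e) \<in> ball 0 3 \<times> ball 0 r \<times> ball 0 r"
    then have k: "b q x e \<noteq> 0" "norm (4 * a q x e * (E - c q x e) / (b q x e)\<^sup>2) < 1"
      using small_root_conditions(2,3)[OF q, of E x e] by auto
    show "(\<lambda>z. ?f (z, x, e) q) field_differentiable at E"
      unfolding fst_conv snd_conv using k
      by (intro derivative_intros field_differentiable_small_root) auto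
    show "(\<lambda>z. ?f (E, z, e) q) field_differentiable at x"
      unfolding fst_conv snd_conv using k
      by (intro derivative_intros field_differentiable_small_root field_differentiable_coeffs)
    show "(\<lambda>z. ?f (E, x, z) q) field_differentiable at e"
      unfolding fst_conv snd_conv using k
      by (intro derivative_intros field_differentiable_small_root field_differentiable_coeffs)
  qed
qed

lemma F_zero: "F E 0 0 = E"
proof -
  have "F E 0 0 = cmean (\<lambda>q. E)"
    unfolding F_def by (rule cmean_cong) (auto simp: coeff_defs small_root_def)
  then show ?thesis by (simp add: cmean_const)
qed

lemma Hp_near_id: "norm x < r \<Longrightarrow> norm e < r \<Longrightarrow> norm p < 2 \<Longrightarrow> near_id (\<lambda>q. Hp q p x e)"
  unfolding near_id_def using Hp_near[of x e _ p]
  by (auto simp: Hp_def coeff_defs intro!: holomorphic_intros)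

lemma qcrit_of:
  assumes "norm x < r" "norm e < r" "norm p < 2"
  shows "norm (qcrit_of p x e) < 1" "Hp (qcrit_of p x e) p x e = 0"
  unfolding qcrit_of_def using lagrange_inverse(1,2)[OF Hp_near_id[OF assms], of 0] by auto

lemma qcrit_of_continuous:
  "continuous_on (ball 0 2 \<times> ball 0 r \<times> ball 0 r) (\<lambda>(p, x, e). qcrit_of p x e)"
  unfolding qcrit_of_def case_prod_unfold
proof (rule lagrange_continuous(2))
  show "continuous_on ((ball 0 2 \<times> ball 0 r \<times> ball 0 r) \<times> sphere 0 1)
      (\<lambda>(s, q). Hp q (fst s) (fst (snd s)) (snd (snd s)))"
    unfolding Hp_def case_prod_unfold by (intro continuous_intros continuous_on_coeffs)
  show "near_id (\<lambda>q. Hp q (fst s) (fst (snd s)) (snd (snd s)))"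
    if "s \<in> ball 0 2 \<times> ball 0 r \<times> ball 0 r" for s
    using that by (intro Hp_near_id) auto
qed auto

lemma qcrit_of_holomorphic:
  assumes "norm x < r" "norm e < r"
  shows "(\<lambda>p. qcrit_of p x e) holomorphic_on ball 0 2"
  unfolding qcrit_of_def
proof (rule lagrange_holomorphic(2)[OF open_ball])
  show "continuous_on (ball 0 2 \<times> sphere 0 1) (\<lambda>(p, q). Hp q p x e)"
    unfolding Hp_def case_prod_unfold coeff_defs by (intro continuous_intros)
  show "(\<lambda>p. Hp q p x e) holomorphic_on ball 0 2" for q
    unfolding Hp_def coeff_defs by (intro holomorphic_intros)
qed (use Hp_near_id assms in auto)

lemma Hq_near_id:
  assumes "norm x < r" "norm e < r"
  shows "near_id (\<lambda>p. Hq (qcrit_of p x e) p x e)"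
  unfolding near_id_def
proof (intro conjI ballI)
  show "(\<lambda>p. Hq (qcrit_of p x e) p x e) holomorphic_on ball 0 2"
    unfolding Hq_def by (intro holomorphic_intros qcrit_of_holomorphic assms)
  show "norm (Hq (qcrit_of z x e) z x e - z) \<le> 1/8" if "z \<in> ball 0 2" for z
    using that qcrit_of(1)[OF assms, of z] assms by (intro Hq_near) auto
qed

lemma critical_point:
  assumes "norm x < r" "norm e < r"
  shows "norm (pcrit x e) < 1" "norm (qcrit x e) < 1"
    "Hp (qcrit x e) (pcrit x e) x e = 0" "Hq (qcrit x e) (pcrit x e) x e = 0"
proof -
  show p: "norm (pcrit x e) < 1" and "Hq (qcrit x e) (pcrit x e) x e = 0"
    unfolding qcrit_def unfolding pcrit_def using lagrange_inverse(1,2)[OF Hq_near_id[OF assms], of 0] by auto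
  show "norm (qcrit x e) < 1" "Hp (qcrit x e) (pcrit x e) x e = 0"
    unfolding qcrit_def using qcrit_of[OF assms, of "pcrit x e"] p by auto
qed

lemma pcrit_continuous: "continuous_on (ball 0 r \<times> ball 0 r) (\<lambda>y. pcrit (fst y) (snd y))"
  unfolding pcrit_def
proof (rule lagrange_continuous(2))
  have "continuous_on ((ball 0 r \<times> ball 0 r) \<times> sphere 0 1)
      (\<lambda>y. case (snd y, fst y) of (p, x, e) \<Rightarrow> qcrit_of p x e)"
    by (rule continuous_on_compose2[OF qcrit_of_continuous]) (auto intro!: continuous_intros)
  then have "continuous_on ((ball 0 r \<times> ball 0 r) \<times> sphere 0 1)
      (\<lambda>y. qcrit_of (snd y) (fst (fst y)) (snd (fst y)))"
    by (simp add: case_prod_unfold)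
  then show "continuous_on ((ball 0 r \<times> ball 0 r) \<times> sphere 0 1)
     (\<lambda>(s, p). Hq (qcrit_of p (fst s) (snd s)) p (fst s) (snd s))"
    unfolding Hq_def case_prod_unfold b0_def by (intro continuous_intros)
qed (use Hq_near_id in auto)

lemma qcrit_continuous: "continuous_on (ball 0 r \<times> ball 0 r) (\<lambda>y. qcrit (fst y) (snd y))"
proof -
  have "continuous_on (ball 0 r \<times> ball 0 r) (\<lambda>y. case (pcrit (fst y) (snd y), y) of (p, x, e) \<Rightarrow> qcrit_of p x e)"
    using critical_point(1)
    by (intro continuous_on_compose2[OF qcrit_of_continuous] continuous_intros pcrit_continuous) force+
  then show ?thesis by (simp add: case_prod_unfold qcrit_def)
qed

lemma critical_point_zero: "pcrit 0 0 = 0" "qcrit 0 0 = 0"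
proof -
  have id: "lagrange_inverse (\<lambda>z. z) 0 = 0"
    by (rule lagrange_inverse_eq[of "\<lambda>z. z" 0]) (auto simp: near_id_def)
  have "Hp q p 0 0 = q" "Hq q p 0 0 = p" for q p
    by (simp_all add: Hp_def Hq_def coeff_defs)
  then show "pcrit 0 0 = 0" "qcrit 0 0 = 0"
    by (simp_all add: pcrit_def qcrit_def qcrit_of_def id)
qed

text \<open>A second shrinking, for quantities built from \<open>F\<close> and the critical point,
  which exist only on the first disc. At the origin \<open>F\<close> is the identity,
  \<open>b1 = 1\<close>, and \<open>qcrit\<close>, \<open>pcrit\<close>, \<open>Ecrit\<close>,
  \<open>c2\<close> vanish.\<close>

lemma small_radius:
  obtains s where "s > 0" "s \<le> r"
    "\<And>x e. norm x < s \<Longrightarrow> norm e < s \<Longrightarrow> near_id (\<lambda>E. F E x e)"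
    "\<And>x e. norm x < s \<Longrightarrow> norm e < s \<Longrightarrow> norm (qcrit x e) \<le> 1/100"
    "\<And>x e. norm x < s \<Longrightarrow> norm e < s \<Longrightarrow> norm (pcrit x e) \<le> 1/100"
    "\<And>x e. norm x < s \<Longrightarrow> norm e < s \<Longrightarrow> norm (Ecrit x e) \<le> 1/100"
    "\<And>x e q. norm x < s \<Longrightarrow> norm e < s \<Longrightarrow> norm q \<le> 2 \<Longrightarrow> norm (b1 q x e - 1) \<le> 1/100"
    "\<And>x e q. norm x < s \<Longrightarrow> norm e < s \<Longrightarrow> norm q \<le> 2 \<Longrightarrow> norm (c2 q x e) \<le> 1/100"
proof -
  let ?N = "ball (0::complex) r \<times> ball (0::complex) r"
  have N: "open ?N" "(0, 0) \<in> ?N" using r by (auto intro: open_Times)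
  have pc: "continuous_on (?N \<times> cball 0 2) (\<lambda>y. pcrit (fst (fst y)) (snd (fst y)))"
    and qc: "continuous_on (?N \<times> cball 0 2) (\<lambda>y. qcrit (fst (fst y)) (snd (fst y)))"
    by (rule continuous_on_compose2[OF pcrit_continuous] continuous_on_compose2[OF qcrit_continuous];
        auto intro!: continuous_intros)+
  note small = uniformly_small_near_zero[OF compact_cball[of "0::complex" 2] _ N]
  obtain s1 where s1: "s1 > 0" "\<And>x e. norm x < s1 \<Longrightarrow> norm e < s1 \<Longrightarrow> (x, e) \<in> ?N"
    "\<And>x e k. norm x < s1 \<Longrightarrow> norm e < s1 \<Longrightarrow> norm (k::complex) \<le> 2 \<Longrightarrow> norm (F k (fst (x, e)) (snd (x, e)) - k) \<le> 1/8"
  proof (rule small[of "\<lambda>s k. F k (fst s) (snd s) - k" "1/8"])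
    have "continuous_on (?N \<times> cball 0 2) (\<lambda>y. case (snd y, fst y) of (E, x, e) \<Rightarrow> F E x e)"
      by (rule continuous_on_compose2[of "ball 0 3 \<times> ball 0 r \<times> ball 0 r"])
        (use F_hol3 in \<open>auto simp: hol3_def intro!: continuous_intros\<close>)
    then show "continuous_on (?N \<times> cball 0 2) (\<lambda>(s, k). F k (fst s) (snd s) - k)"
      by (auto simp: case_prod_unfold intro!: continuous_intros)
  qed (auto simp: F_zero)
  obtain s2 where s2: "s2 > 0"
    "\<And>x e k. norm x < s2 \<Longrightarrow> norm e < s2 \<Longrightarrow> norm (k::complex) \<le> 2 \<Longrightarrow> norm (qcrit (fst (x, e)) (snd (x, e))) \<le> 1/100"
  proof (rule small[of "\<lambda>s k. qcrit (fst s) (snd s)" "1/100"])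
    show "continuous_on (?N \<times> cball 0 2) (\<lambda>(s, k). qcrit (fst s) (snd s))"
      using qc by (simp add: case_prod_unfold)
  qed (auto simp: critical_point_zero)
  obtain s3 where s3: "s3 > 0"
    "\<And>x e k. norm x < s3 \<Longrightarrow> norm e < s3 \<Longrightarrow> norm (k::complex) \<le> 2 \<Longrightarrow> norm (pcrit (fst (x, e)) (snd (x, e))) \<le> 1/100"
  proof (rule small[of "\<lambda>s k. pcrit (fst s) (snd s)" "1/100"])
    show "continuous_on (?N \<times> cball 0 2) (\<lambda>(s, k). pcrit (fst s) (snd s))"
      using pc by (simp add: case_prod_unfold)
  qed (auto simp: critical_point_zero)
  obtain s4 where s4: "s4 > 0"
    "\<And>x e k. norm x < s4 \<Longrightarrow> norm e < s4 \<Longrightarrow> norm (k::complex) \<le> 2 \<Longrightarrow> norm (Ecrit (fst (x, e)) (snd (x, e))) \<le> 1/100"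
  proof (rule small[of "\<lambda>s k. Ecrit (fst s) (snd s)" "1/100"])
    show "continuous_on (?N \<times> cball 0 2) (\<lambda>(s, k). Ecrit (fst s) (snd s))"
      unfolding Ecrit_def H_def coeff_defs case_prod_unfold by (intro continuous_intros pc qc)
  qed (auto simp: critical_point_zero Ecrit_def H_def coeff_defs)
  obtain s5 where s5: "s5 > 0"
    "\<And>x e k. norm x < s5 \<Longrightarrow> norm e < s5 \<Longrightarrow> norm (k::complex) \<le> 2 \<Longrightarrow> norm (b1 k (fst (x, e)) (snd (x, e)) - 1) \<le> 1/100"
  proof (rule small[of "\<lambda>s k. b1 k (fst s) (snd s) - 1" "1/100"])
    show "continuous_on (?N \<times> cball 0 2) (\<lambda>(s, k). b1 k (fst s) (snd s) - 1)"
      unfolding b1_def b0_def case_prod_unfold by (intro continuous_intros pc qc)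
  qed (auto simp: critical_point_zero b1_def b0_def)
  obtain s6 where s6: "s6 > 0"
    "\<And>x e k. norm x < s6 \<Longrightarrow> norm e < s6 \<Longrightarrow> norm (k::complex) \<le> 2 \<Longrightarrow> norm (c2 k (fst (x, e)) (snd (x, e))) \<le> 1/100"
  proof (rule small[of "\<lambda>s k. c2 k (fst s) (snd s)" "1/100"])
    show "continuous_on (?N \<times> cball 0 2) (\<lambda>(s, k). c2 k (fst s) (snd s))"
      unfolding c2_def case_prod_unfold by (intro continuous_intros pc qc)
  qed (auto simp: critical_point_zero c2_def)
  define s where "s = min r (min s1 (min s2 (min s3 (min s4 (min s5 s6)))))"
  have less_s: "t < s \<longleftrightarrow> t < r \<and> t < s1 \<and> t < s2 \<and> t < s3 \<and> t < s4 \<and> t < s5 \<and> t < s6" for t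
    by (simp only: s_def min_less_iff_conj)
  have "s \<le> r" unfolding s_def by (rule min.cobounded1)
  show ?thesis
  proof (rule that[of s])
    fix x e :: complex assume xe: "norm x < s" "norm e < s"
    show "near_id (\<lambda>E. F E x e)"
      unfolding near_id_def
    proof (intro conjI ballI)
      show "(\<lambda>E. F E x e) holomorphic_on ball 0 2"
        using F_hol3 xe
        by (auto simp: hol3_def holomorphic_on_def less_s case_prod_unfold intro: field_differentiable_at_within)
      show "norm (F z x e - z) \<le> 1/8" if "z \<in> ball 0 2" for z
        using s1(3)[of x e z] xe that by (auto simp: less_s)
    qed
    show "norm (qcrit x e) \<le> 1/100" "norm (pcrit x e) \<le> 1/100" "norm (Ecrit x e) \<le> 1/100"
      using s2(2)[of x e 0] s3(2)[of x e 0] s4(2)[of x e 0] xe by (auto simp: less_s)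
    show "norm (b1 q x e - 1) \<le> 1/100" "norm (c2 q x e) \<le> 1/100" if "norm q \<le> 2" for q
      using s5(2)[of x e q] s6(2)[of x e q] xe that by (auto simp: less_s)
  next
    show "s > 0" using r s1(1) s2(1) s3(1) s4(1) s5(1) s6(1) by (simp add: less_s)
  qed fact
qed

end

section \<open>Critical level, inverse action and normal form\<close>

locale confluent_small = confluent_disc +
  fixes s :: real
  assumes s: "s > 0" "s \<le> r"
    and F_near_id: "\<And>x e. norm x < s \<Longrightarrow> norm e < s \<Longrightarrow> near_id (\<lambda>E. F E x e)"
    and qcrit_small: "\<And>x e. norm x < s \<Longrightarrow> norm e < s \<Longrightarrow> norm (qcrit x e) \<le> 1/100"
    and pcrit_small: "\<And>x e. norm x < s \<Longrightarrow> norm e < s \<Longrightarrow> norm (pcrit x e) \<le> 1/100"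
    and Ecrit_small: "\<And>x e. norm x < s \<Longrightarrow> norm e < s \<Longrightarrow> norm (Ecrit x e) \<le> 1/100"
    and b1_near: "\<And>x e q. norm x < s \<Longrightarrow> norm e < s \<Longrightarrow> norm q \<le> 2 \<Longrightarrow> norm (b1 q x e - 1) \<le> 1/100"
    and c2_small: "\<And>x e q. norm x < s \<Longrightarrow> norm e < s \<Longrightarrow> norm q \<le> 2 \<Longrightarrow> norm (c2 q x e) \<le> 1/100"
begin

text \<open>With \<open>Q = q - qcrit x e\<close> and \<open>p = pcrit x e + Q * s\<close>, the
  critical level equation is \<open>Q^2\<close> times \<open>a * s^2 + b1 * s + c2 = 0\<close>.
  Cancelling \<open>Q^2\<close> resolves the node of the level, and the small root \<open>s\<close>
  gives a holomorphic branch through the critical point.\<close>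

definition slope :: "complex \<Rightarrow> complex \<Rightarrow> complex \<Rightarrow> complex" where
  "slope q x e = small_root (a q x e) (b1 q x e) (- c2 q x e)"

definition f :: "complex \<Rightarrow> complex \<Rightarrow> complex \<Rightarrow> complex" where
  "f q x e = pcrit x e + (q - qcrit x e) * slope q x e"

text \<open>The \<open>p\<close>-derivative of \<open>H\<close> along the branch
  \<open>p = f q x e\<close>, with its zero at \<open>qcrit x e\<close> factored out.\<close>

definition D :: "complex \<Rightarrow> complex \<Rightarrow> complex \<Rightarrow> complex" where
  "D q x e = (q - qcrit x e) * (b1 q x e + 2 * a q x e * slope q x e)"

lemma slope_facts:
  assumes "norm x < s" "norm e < s" "norm q \<le> 2"
  shows "b1 q x e \<noteq> 0" "norm (4 * a q x e * (- c2 q x e) / (b1 q x e)\<^sup>2) < 1"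
    "a q x e * (slope q x e)\<^sup>2 + b1 q x e * slope q x e = - c2 q x e"
    "norm (slope q x e) \<le> 1/40"
proof -
  have xe: "norm x < r" "norm e < r" using assms s by auto
  have k: "norm (b1 q x e) \<ge> 15/16" "norm (4 * a q x e * (- c2 q x e) / (b1 q x e)\<^sup>2) < 1"
    using small_root_bound[of "b1 q x e" 1 "a q x e" "- c2 q x e"]
      b1_near[OF assms] c2_small[OF assms] a_small[OF xe assms(3)] by auto
  then show b1: "b1 q x e \<noteq> 0" and "norm (4 * a q x e * (- c2 q x e) / (b1 q x e)\<^sup>2) < 1" by auto
  show "a q x e * (slope q x e)\<^sup>2 + b1 q x e * slope q x e = - c2 q x e"
    unfolding slope_def by (rule small_root_eq(1)[OF b1 k(2)])
  have "norm (slope q x e) \<le> 2 * norm (- c2 q x e) / norm (b1 q x e)"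
    unfolding slope_def by (rule small_root_eq(2)[OF b1 k(2)])
  also have "\<dots> \<le> 2 * (1/100) / (15/16)"
    using c2_small[OF assms] k(1) by (intro frac_le) auto
  also have "\<dots> \<le> 1/40" by simp
  finally show "norm (slope q x e) \<le> 1/40" .
qed

lemma H_expand:
  assumes "norm x < s" "norm e < s" "norm q \<le> 2"
  shows "H q (f q x e + P) x e = Ecrit x e + (D q x e * P + a q x e * P\<^sup>2)"
proof -
  have xe: "norm x < r" "norm e < r" using assms s by auto
  define Q where "Q = q - qcrit x e"
  let ?u = "Q * slope q x e + P"
  have "H q (f q x e + P) x e = H q (pcrit x e) x e + Hp q (pcrit x e) x e * ?u + a q x e * ?u\<^sup>2"
    unfolding H_def Hp_def f_def Q_def[symmetric] by algebra
  also have "\<dots> = Ecrit x e + Q\<^sup>2 * c2 q x e + Q * b1 q x e * ?u + a q x e * ?u\<^sup>2"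
    using b1_eq[OF critical_point(3)[OF xe], of q] c2_eq[OF critical_point(4)[OF xe], of q]
    by (simp add: Q_def)
  also have "\<dots> = Ecrit x e + (D q x e * P + a q x e * P\<^sup>2)"
    using slope_facts(3)[OF assms] unfolding D_def Q_def[symmetric] by algebra
  finally show ?thesis .
qed

lemma D_f_facts:
  assumes xe: "norm x < s" "norm e < s"
  shows "(\<lambda>q. f q x e) holomorphic_on ball 0 2" "(\<lambda>q. D q x e) holomorphic_on ball 0 2"
    "\<And>q. norm q < 2 \<Longrightarrow> norm (D q x e - q) \<le> 1/16" "\<And>q. norm q < 2 \<Longrightarrow> norm (f q x e) \<le> 1/4"
    "D (qcrit x e) x e = 0" "f (qcrit x e) x e = pcrit x e"
proof -
  have sl: "(\<lambda>q. slope q x e) holomorphic_on ball 0 2"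
    unfolding holomorphic_on_def
  proof
    fix q :: complex assume "q \<in> ball 0 2"
    then have "(\<lambda>q. slope q x e) field_differentiable at q"
      unfolding slope_def using slope_facts(1,2)[OF xe, of q]
      by (intro field_differentiable_small_root) (auto simp: coeff_defs b1_def c2_def intro!: derivative_intros)
    then show "(\<lambda>q. slope q x e) field_differentiable at q within ball 0 2"
      by (rule field_differentiable_at_within)
  qed
  show "(\<lambda>q. f q x e) holomorphic_on ball 0 2" "(\<lambda>q. D q x e) holomorphic_on ball 0 2"
    unfolding f_def D_def by (auto simp: coeff_defs b1_def intro!: holomorphic_intros sl)
  show "D (qcrit x e) x e = 0" "f (qcrit x e) x e = pcrit x e" by (simp_all add: D_def f_def)
  fix q :: complex assume q: "norm q < 2"
  define Q where "Q = q - qcrit x e"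
  have Q: "norm Q \<le> 3"
    using norm_triangle_ineq4[of q "qcrit x e"] q qcrit_small[OF xe] by (simp add: Q_def)
  have sl: "norm (slope q x e) \<le> 1/40" using slope_facts(4)[OF xe] q by simp
  have "norm (Q * slope q x e) \<le> 3 * (1/40)"
    unfolding norm_mult using Q sl by (intro mult_mono) auto
  then show "norm (f q x e) \<le> 1/4"
    using norm_triangle_ineq[of "pcrit x e" "Q * slope q x e"] pcrit_small[OF xe] by (simp add: f_def Q_def)
  have n1: "norm (Q * (b1 q x e - 1)) \<le> 3 * (1/100)"
    unfolding norm_mult using Q b1_near[OF xe, of q] q by (intro mult_mono) auto
  have "norm (Q * (2 * a q x e * slope q x e)) \<le> 3 * ((2 * (1/64)) * (1/40))"
    unfolding norm_mult using Q sl a_small[of x e q] xe s q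
    by (intro mult_mono) auto
  moreover have "D q x e - q = (Q * (b1 q x e - 1) + Q * (2 * a q x e * slope q x e)) - qcrit x e"
    by (simp add: D_def Q_def algebra_simps)
  ultimately show "norm (D q x e - q) \<le> 1/16"
    using norm_triangle_ineq4[of "Q * (b1 q x e - 1) + Q * (2 * a q x e * slope q x e)" "qcrit x e"]
      norm_triangle_ineq[of "Q * (b1 q x e - 1)" "Q * (2 * a q x e * slope q x e)"]
      n1 qcrit_small[OF xe] by simp
qed

lemma quadratic:
  assumes xe: "norm x < s" "norm e < s"
  shows "quadratic_hamiltonian (\<lambda>q. D q x e) (\<lambda>q. a q x e)"
proof
  show "(\<lambda>q. a q x e) holomorphic_on ball 0 2" unfolding a_def by (intro holomorphic_intros)
  show "norm (a q x e) \<le> 1/4" if "norm q < 2" for q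
    using a_small[of x e q] xe s that by simp
qed (use D_f_facts(2,3)[OF xe] in auto)

text \<open>On the circle the small root of the level \<open>Ecrit x e + z\<close> must be
  \<open>f + z / T\<close> by uniqueness. Since \<open>q * f q x e\<close> is holomorphic in the
  disc and zero at \<open>q = 0\<close>, the branch contributes nothing to the mean; the rest is
  \<open>z * m z\<close>.\<close>

lemma F_eq:
  assumes xe: "norm x < s" "norm e < s" and z: "norm z < 1/64"
  shows "F (Ecrit x e + z) x e = z * quadratic_hamiltonian.m (\<lambda>q. D q x e) (\<lambda>q. a q x e) z"
proof -
  interpret qh: quadratic_hamiltonian "\<lambda>q. D q x e" "\<lambda>q. a q x e" by (rule quadratic[OF xe])
  have xe': "norm x < r" "norm e < r" using xe s by auto
  have E: "norm (Ecrit x e + z) < 3"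
    using norm_triangle_ineq[of "Ecrit x e" z] Ecrit_small[OF xe] z by simp
  have root: "small_root (a q x e) (b q x e) (Ecrit x e + z - c q x e) = f q x e + z / qh.T q z"
    if q: "norm q = 1" for q
  proof (rule small_root_unique)
    note k = small_root_conditions[OF q E xe']
    show "a q x e * (small_root (a q x e) (b q x e) (Ecrit x e + z - c q x e))\<^sup>2
        + b q x e * small_root (a q x e) (b q x e) (Ecrit x e + z - c q x e) = Ecrit x e + z - c q x e"
      by (rule small_root_eq(1)[OF k(2,3)])
    let ?P = "z / qh.T q z"
    have t: "qh.T q z \<noteq> 0" "qh.T q z * qh.T q z = D q x e * qh.T q z + a q x e * z"
      "norm (qh.T q z) \<ge> 15/32" using qh.T_facts[OF q z] by auto
    have "D q x e * ?P + a q x e * ?P\<^sup>2 = z * (D q x e * qh.T q z + a q x e * z) / (qh.T q z * qh.T q z)"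
      using t(1) by (simp add: divide_simps power2_eq_square) (simp add: algebra_simps)
    also have "\<dots> = z" using t(1) by (simp flip: t(2))
    finally have "H q (f q x e + ?P) x e = Ecrit x e + z"
      using H_expand[OF xe, of q ?P] q by simp
    then show "a q x e * (f q x e + ?P)\<^sup>2 + b q x e * (f q x e + ?P) = Ecrit x e + z - c q x e"
      by (simp add: H_def eq_diff_eq)
    show "norm (a q x e) \<le> 1/64" using a_small[OF xe'] q by simp
    show "norm (b q x e) \<ge> 15/16" "norm (small_root (a q x e) (b q x e) (Ecrit x e + z - c q x e)) \<le> 9"
      using k by auto
    have "norm ?P \<le> (1/64) / (15/32)" unfolding norm_divide using z t(3) by (intro frac_le) auto
    then show "norm (f q x e + ?P) \<le> 1"
      using norm_triangle_ineq[of "f q x e" ?P] D_f_facts(4)[OF xe, of q] q by simp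
  qed
  have cf: "continuous_on (sphere 0 1) (\<lambda>q. q * f q x e)"
    by (intro continuous_intros holomorphic_on_imp_continuous_on holomorphic_on_subset[OF D_f_facts(1)[OF xe]]) auto
  have "continuous_on (sphere 0 1) (\<lambda>q. qh.T (snd (z, q)) (fst (z, q)))"
    by (rule continuous_on_compose2[OF qh.T_cont]) (use z in \<open>auto intro!: continuous_intros\<close>)
  then have cT: "continuous_on (sphere 0 1) (\<lambda>q. z * (q / qh.T q z))"
    using qh.T_facts(2) z by (intro continuous_intros) auto
  have "F (Ecrit x e + z) x e = cmean (\<lambda>q. q * f q x e + z * (q / qh.T q z))"
    unfolding F_def by (rule cmean_cong) (simp add: root distrib_left)
  also have "\<dots> = cmean (\<lambda>q. q * f q x e) + cmean (\<lambda>q. z * (q / qh.T q z))"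
    by (rule cmean_add[OF cf cT])
  also have "cmean (\<lambda>q. q * f q x e) = 0 * f 0 x e"
    by (rule cmean_mean_value[of _ 2]) (auto intro!: holomorphic_intros D_f_facts(1)[OF xe])
  also have "cmean (\<lambda>q. z * (q / qh.T q z)) = z * qh.m z"
    by (simp only: cmean_mult_left qh.m_def)
  finally show ?thesis by simp
qed

definition G :: "complex \<times> complex \<times> complex \<Rightarrow> complex" where
  "G v = lagrange_inverse (\<lambda>E. F E (fst (snd v)) (snd (snd v))) (fst v)"

text \<open>The \<open>h\<close>-derivative of \<open>G\<close> as a residue integral, so that its
  joint analyticity is proved in the same way as that of \<open>G\<close>; the identification is
  \<open>deriv_G\<close>.\<close>

definition g :: "complex \<times> complex \<times> complex \<Rightarrow> complex" where
  "g v = lagrange_deriv (\<lambda>E. F E (fst (snd v)) (snd (snd v))) (fst v)"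

definition V :: "(complex \<times> complex \<times> complex) set" where
  "V = ball 0 (1/2) \<times> ball 0 s \<times> ball 0 s"

lemma F_cont:
  assumes "continuous_on Y x" "continuous_on Y e" "continuous_on Y E"
    and "\<And>y. y \<in> Y \<Longrightarrow> norm (x y) < s" "\<And>y. y \<in> Y \<Longrightarrow> norm (e y) < s" "\<And>y. y \<in> Y \<Longrightarrow> norm (E y) < 3"
  shows "continuous_on Y (\<lambda>y. F (E y) (x y) (e y))"
proof -
  have "continuous_on Y (\<lambda>y. case (E y, x y, e y) of (E, x, e) \<Rightarrow> F E x e)"
    by (rule continuous_on_compose2[of "ball 0 3 \<times> ball 0 r \<times> ball 0 r"])
      (use F_hol3 assms s in \<open>fastforce simp: hol3_def intro!: continuous_intros\<close>)+
  then show ?thesis by simp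
qed

lemma F_differentiable:
  assumes "norm x < s" "norm e < s" "norm E < 3"
  shows "(\<lambda>E. F E x e) field_differentiable at E" "(\<lambda>x. F E x e) field_differentiable at x"
    "(\<lambda>e. F E x e) field_differentiable at e"
  using F_hol3 assms s by (auto simp: hol3_def)

lemma Gg_hol3: "hol3 V G" "hol3 V g"
proof -
  have V: "open V" unfolding V_def by (intro open_Times open_ball)
  have Fc: "continuous_on (V \<times> sphere 0 1) (\<lambda>(v, E). F E (fst (snd v)) (snd (snd v)))"
    unfolding case_prod_unfold by (intro F_cont continuous_intros) (auto simp: V_def)
  have ni: "near_id (\<lambda>E. F E (fst (snd v)) (snd (snd v)))" if "v \<in> V" for v
    using that by (intro F_near_id) (auto simp: V_def)
  have cont: "continuous_on V G" "continuous_on V g"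
  proof -
    have h: "continuous_on V fst" by (intro continuous_intros)
    have h': "norm (fst v) < 1/2" if "v \<in> V" for v using that by (auto simp: V_def)
    show "continuous_on V G" unfolding G_def[abs_def]
      by (rule lagrange_continuous(2)[OF Fc ni h h'])
    show "continuous_on V g" unfolding g_def[abs_def]
      by (rule lagrange_continuous(1)[OF Fc ni h h'])
  qed
  have "(\<lambda>z. G (z, x, e)) field_differentiable at h \<and> (\<lambda>z. G (h, z, e)) field_differentiable at x \<and>
      (\<lambda>z. G (h, x, z)) field_differentiable at e \<and> (\<lambda>z. g (z, x, e)) field_differentiable at h \<and>
      (\<lambda>z. g (h, z, e)) field_differentiable at x \<and> (\<lambda>z. g (h, x, z)) field_differentiable at e"
    if "(h, x, e) \<in> V" for h x e
  proof -
    have hxe: "norm h < 1/2" "norm x < s" "norm e < s" using that by (auto simp: V_def)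
    have Fh: "(\<lambda>x. F z x e) holomorphic_on ball 0 s" "(\<lambda>e. F z x e) holomorphic_on ball 0 s"
      if "norm z = 1" for z
      unfolding holomorphic_on_def
      using F_differentiable(2)[of _ e z, THEN field_differentiable_at_within]
        F_differentiable(3)[of x _ z, THEN field_differentiable_at_within] hxe that by simp_all
    have ch: "(\<lambda>_. h) holomorphic_on ball 0 s" by (rule holomorphic_on_const)
    have c1: "continuous_on (ball 0 (1/2) \<times> sphere 0 1) (\<lambda>(h::complex, z). F z x e)"
      unfolding case_prod_unfold using hxe by (auto intro!: F_cont continuous_intros)
    have 1: "(\<lambda>h. g (h, x, e)) holomorphic_on ball 0 (1/2)" "(\<lambda>h. G (h, x, e)) holomorphic_on ball 0 (1/2)"
      unfolding g_def G_def fst_conv snd_conv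
      \<comment> \<open>As a function of \<open>h\<close> alone, \<open>F z x e\<close> is constant;
        only the target value \<open>h\<close> varies. For \<open>x\<close> and \<open>e\<close> the
        roles are reversed.\<close>
      by (rule lagrange_holomorphic[OF open_ball c1 holomorphic_on_const F_near_id[OF hxe(2,3)] holomorphic_on_ident]; simp)+
    have c2: "continuous_on (ball 0 s \<times> sphere 0 1) (\<lambda>(x, z). F z x e)"
      "continuous_on (ball 0 s \<times> sphere 0 1) (\<lambda>(e, z). F z x e)"
      unfolding case_prod_unfold using hxe by (auto intro!: F_cont continuous_intros)
    have n2: "near_id (\<lambda>E. F E x' e)" "near_id (\<lambda>E. F E x x')" if "x' \<in> ball 0 s" for x'
      using that hxe by (auto intro!: F_near_id)
    have 2: "(\<lambda>x. g (h, x, e)) holomorphic_on ball 0 s" "(\<lambda>x. G (h, x, e)) holomorphic_on ball 0 s"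
      unfolding g_def G_def fst_conv snd_conv
      using lagrange_holomorphic[OF open_ball c2(1) Fh(1) n2(1) ch] hxe(1) by simp_all
    have 3: "(\<lambda>e. g (h, x, e)) holomorphic_on ball 0 s" "(\<lambda>e. G (h, x, e)) holomorphic_on ball 0 s"
      unfolding g_def G_def fst_conv snd_conv
      using lagrange_holomorphic[OF open_ball c2(2) Fh(2) n2(2) ch] hxe(1) by simp_all
    show ?thesis
      using 1 2 3 hxe by (auto intro: holomorphic_on_imp_differentiable_at)
  qed
  then show "hol3 V G" "hol3 V g"
    using V cont by (auto simp: hol3_def)
qed

lemma G_F: "norm x < s \<Longrightarrow> norm e < s \<Longrightarrow> norm E < 1 \<Longrightarrow> G (F E x e, x, e) = E"
  unfolding G_def fst_conv snd_conv by (rule lagrange_inverse_eq[OF F_near_id])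

lemma F_G:
  assumes "(h, x, e) \<in> V"
  shows "F (G (h, x, e)) x e = h" "norm (G (h, x, e)) < 1" "g (h, x, e) = 1 / deriv (\<lambda>E. F E x e) (G (h, x, e))"
    "deriv (\<lambda>E. F E x e) (G (h, x, e)) \<noteq> 0"
  using lagrange_inverse[OF F_near_id, of x e h] assms unfolding G_def g_def V_def by auto

lemma deriv_G:
  assumes v: "(h, x, e) \<in> V"
  shows "deriv (\<lambda>t. G (t, x, e)) h = g (h, x, e)"
proof -
  have hxe: "norm h < 1/2" "norm x < s" "norm e < s" using v by (auto simp: V_def)
  have "(\<lambda>t. G (t, x, e)) field_differentiable at h"
    using Gg_hol3(1) v by (auto simp: hol3_def)
  then have dG: "((\<lambda>t. G (t, x, e)) has_field_derivative deriv (\<lambda>t. G (t, x, e)) h) (at h)"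
    by (rule field_differentiable_derivI)
  have "(\<lambda>E. F E x e) field_differentiable at (G (h, x, e))"
    using F_G(2)[OF v] hxe by (intro F_differentiable) auto
  then have dF: "((\<lambda>E. F E x e) has_field_derivative deriv (\<lambda>E. F E x e) (G (h, x, e))) (at (G (h, x, e)))"
    by (rule field_differentiable_derivI)
  have "((\<lambda>t. F (G (t, x, e)) x e) has_field_derivative
      deriv (\<lambda>E. F E x e) (G (h, x, e)) * deriv (\<lambda>t. G (t, x, e)) h) (at h)"
    by (rule DERIV_chain2[OF dF dG])
  moreover have "((\<lambda>t. F (G (t, x, e)) x e) has_field_derivative 1) (at h)"
    by (rule has_field_derivative_transform_within_open[OF DERIV_ident, of "ball 0 (1/2)"])
       (use hxe in \<open>auto simp: F_G V_def\<close>)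
  ultimately have "deriv (\<lambda>E. F E x e) (G (h, x, e)) * deriv (\<lambda>t. G (t, x, e)) h = 1"
    by (rule DERIV_unique)
  then show ?thesis unfolding F_G(3)[OF v] using F_G(4)[OF v] by (simp add: eq_divide_eq mult.commute)
qed

text \<open>\<open>H = Ecrit x e + z\<close> and the product of the coordinates is
  \<open>z * m z = F (Ecrit x e + z) x e\<close>, so \<open>G\<close> recovers \<open>H\<close>.
  Since 1/4 + 1/8 < 1/2 the product lies in the domain of \<open>G\<close>.\<close>

lemma normal_form_chart:
  assumes xe: "norm x < s" "norm e < s"
  obtains U \<Phi>1 \<Phi>2 where "(qcrit x e, pcrit x e) \<in> U" "symplectic_chart U \<Phi>1 \<Phi>2"
    "\<Phi>1 (qcrit x e, pcrit x e) = 0" "\<Phi>2 (qcrit x e, pcrit x e) = 0"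
    "\<And>q p. (q, p) \<in> U \<Longrightarrow> (\<Phi>1 (q, p) * \<Phi>2 (q, p), x, e) \<in> V \<and>
        H q p x e = G (\<Phi>1 (q, p) * \<Phi>2 (q, p), x, e)"
proof -
  interpret qh: quadratic_hamiltonian "\<lambda>q. D q x e" "\<lambda>q. a q x e" by (rule quadratic[OF xe])
  have "norm (qcrit x e) < 1" using qcrit_small[OF xe] by simp
  from qh.local_chart[OF D_f_facts(1)[OF xe] this D_f_facts(5)[OF xe], unfolded D_f_facts(6)[OF xe]]
  obtain U \<Phi>1 \<Phi>2 where U: "(qcrit x e, pcrit x e) \<in> U" "symplectic_chart U \<Phi>1 \<Phi>2"
    "\<Phi>1 (qcrit x e, pcrit x e) = 0" "\<Phi>2 (qcrit x e, pcrit x e) = 0"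
    and *: "\<And>q p z. (q, p) \<in> U \<Longrightarrow> z = D q x e * (p - f q x e) + a q x e * (p - f q x e)\<^sup>2 \<Longrightarrow>
        norm q < 1 \<and> norm z < 1/64 \<and> \<Phi>1 (q, p) * \<Phi>2 (q, p) = z * qh.m z"
    by metis
  show ?thesis
  proof (rule that[OF U])
    fix q p assume qp: "(q, p) \<in> U"
    define z where "z = D q x e * (p - f q x e) + a q x e * (p - f q x e)\<^sup>2"
    have z: "norm q < 1" "norm z < 1/64" "\<Phi>1 (q, p) * \<Phi>2 (q, p) = F (Ecrit x e + z) x e"
      using *[OF qp z_def] F_eq[OF xe, of z] by auto
    have E: "norm (Ecrit x e + z) < 1/4"
      using norm_triangle_ineq[of "Ecrit x e" z] Ecrit_small[OF xe] z(2) by simp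
    have "norm (F (Ecrit x e + z) x e - (Ecrit x e + z)) \<le> 1/8"
      using F_near_id[OF xe] E by (auto simp: near_id_def)
    then have "norm (F (Ecrit x e + z) x e) < 1/2"
      using norm_triangle_sub[of "F (Ecrit x e + z) x e" "Ecrit x e + z"] E by simp
    moreover have "H q p x e = Ecrit x e + z"
      using H_expand[OF xe, of q "p - f q x e"] z(1) by (simp add: z_def)
    ultimately show "(\<Phi>1 (q, p) * \<Phi>2 (q, p), x, e) \<in> V \<and> H q p x e = G (\<Phi>1 (q, p) * \<Phi>2 (q, p), x, e)"
      using G_F[OF xe, of "Ecrit x e + z"] E xe by (simp add: z(3) V_def)
  qed
qed

end

section \<open>Exact evaluation on the slices \<open>x = 0\<close> and \<open>x = e\<close>\<close>

context confluent_small
begin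

definition chi :: "complex \<Rightarrow> complex \<Rightarrow> complex \<Rightarrow> complex" where
  "chi h x e = b0 x e + 2 * (2 * x - e) * h"

text \<open>Such a relation says that \<open>E\<close> is the polynomial
  \<open>\<alpha> * h^2 + \<beta> * h + \<gamma>\<close> in the action \<open>h = F E x e\<close>;
  its derivative in \<open>h\<close> is that of \<open>G\<close>.\<close>

lemma deriv_of_quadratic_relation:
  assumes xe: "norm x < s" "norm e < s" and v: "(h, x, e) \<in> V"
    and rel: "\<And>E. norm E < 3 \<Longrightarrow> \<alpha> * (F E x e)\<^sup>2 + \<beta> * F E x e = E - \<gamma>"
  shows "g (h, x, e) = \<beta> + 2 * \<alpha> * h"
proof -
  let ?E = "G (h, x, e)"
  have E: "norm ?E < 1" using F_G(2)[OF v] .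
  have dF: "((\<lambda>E. F E x e) has_field_derivative deriv (\<lambda>E. F E x e) ?E) (at ?E)"
    using E xe by (intro field_differentiable_derivI F_differentiable) auto
  have "((\<lambda>E. \<alpha> * (F E x e)\<^sup>2 + \<beta> * F E x e) has_field_derivative
      (\<alpha> * (2 * F ?E x e * deriv (\<lambda>E. F E x e) ?E) + \<beta> * deriv (\<lambda>E. F E x e) ?E)) (at ?E)"
    by (auto intro!: derivative_eq_intros dF)
  moreover have "((\<lambda>E. \<alpha> * (F E x e)\<^sup>2 + \<beta> * F E x e) has_field_derivative 1) (at ?E)"
  proof (rule has_field_derivative_transform_within_open[of "\<lambda>E. E - \<gamma>" _ _ "ball 0 3"])
    show "((\<lambda>E. E - \<gamma>) has_field_derivative 1) (at ?E)" by (auto intro!: derivative_eq_intros)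
  qed (use E rel in auto)
  ultimately have "\<alpha> * (2 * F ?E x e * deriv (\<lambda>E. F E x e) ?E) + \<beta> * deriv (\<lambda>E. F E x e) ?E = 1"
    by (rule DERIV_unique)
  then have "(\<beta> + 2 * \<alpha> * h) * deriv (\<lambda>E. F E x e) ?E = 1"
    by (simp add: F_G(1)[OF v] algebra_simps)
  then show ?thesis
    unfolding F_G(3)[OF v] using F_G(4)[OF v] by (simp add: divide_eq_eq)
qed

end

locale confluent_slices = confluent_small +
  assumes e_small: "\<And>e q :: complex. norm e < r \<Longrightarrow> norm q \<le> 2 \<Longrightarrow> norm (e * (1 - q)) \<le> 1/64"
    and slope0: "\<And>e q. norm e < r \<Longrightarrow> norm q \<le> 2 \<Longrightarrow> norm (1 - e + e * \<theta> - e * \<sigma> * q - 1) \<le> 1/16"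
    and slope1: "\<And>e q. norm e < r \<Longrightarrow> norm q \<le> 2 \<Longrightarrow> norm (1 - e - e * \<sigma> + e * \<theta> * q - 1) \<le> 1/16"
    and Aeq: "\<And>e q. norm e < r \<Longrightarrow> norm q \<le> 2 \<Longrightarrow> norm (A * e * q) \<le> 1/16"
    and Ae: "\<And>e. norm e < r \<Longrightarrow> norm (A * e) \<le> 1/16"
begin

text \<open>For \<^term>\<open>x = 0\<close> the integrand of \<^const>\<open>F\<close> extends holomorphically to \<^term>\<open>q = 0\<close>, for \<^term>\<open>x = e\<close>
  to \<^term>\<open>q = \<infinity>\<close>; hence the mean is the value there.\<close>

lemma F_x_zero:
  assumes e: "norm e < r" and E: "norm E < 3"
  shows "- e * (F E 0 e)\<^sup>2 + b0 0 e * F E 0 e = E - 0"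
proof -
  let ?\<alpha> = "\<lambda>q. - (e * (1 - q))" and ?\<beta> = "\<lambda>q. 1 - e + e * \<theta> - e * \<sigma> * q" and ?N = "\<lambda>q. E - A * e * q"
  have "F E 0 e = cmean (\<lambda>q. small_root (?\<alpha> q) (?\<beta> q) (?N q))"
    unfolding F_def
  proof (rule cmean_cong)
    fix q :: complex assume "norm q = 1"
    then have q: "q \<noteq> 0" by auto
    have "a q 0 e = q\<^sup>2 * ?\<alpha> q" "b q 0 e = q * ?\<beta> q" "E - c q 0 e = ?N q"
      by (simp_all add: coeff_defs power2_eq_square power3_eq_cube algebra_simps)
    then show "q * small_root (a q 0 e) (b q 0 e) (E - c q 0 e) = small_root (?\<alpha> q) (?\<beta> q) (?N q)"
      by (simp only: small_root_scale[OF q])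
  qed
  moreover have "?\<alpha> 0 * (cmean (\<lambda>q. small_root (?\<alpha> q) (?\<beta> q) (?N q)))\<^sup>2
      + ?\<beta> 0 * cmean (\<lambda>q. small_root (?\<alpha> q) (?\<beta> q) (?N q)) = ?N 0"
  proof (rule cmean_small_root)
    fix q :: complex assume q: "norm q < 2"
    show "norm (?\<alpha> q) \<le> 1/64" using e_small[OF e, of q] q by simp
    show "norm (?\<beta> q - 1) \<le> 1/16" using slope0[OF e, of q] q by simp
    show "norm (?N q) \<le> 4"
      using norm_triangle_ineq4[of E "A * e * q"] Aeq[OF e, of q] q E by simp
  qed (intro holomorphic_intros)+
  ultimately show ?thesis by (simp add: b0_def)
qed

lemma F_x_e:
  assumes e: "norm e < r" and E: "norm E < 3"
  shows "e * (F E e e)\<^sup>2 + b0 e e * F E e e = E - A * e"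
proof -
  \<comment> \<open>The coefficients at \<open>q = 1 / w\<close>, multiplied by \<open>w^2\<close>,
    \<open>w\<close> and 1; they are polynomials in \<open>w\<close>, so the value at
    \<open>w = 0\<close> is available.\<close>
  let ?\<alpha> = "\<lambda>w. e * (1 - w)" and ?\<beta> = "\<lambda>w. 1 - e - e * \<sigma> + e * \<theta> * w" and ?N = "\<lambda>w. E - A * e"
  have "F E e e = cmean (\<lambda>w. inverse w * small_root (a (inverse w) e e) (b (inverse w) e e) (E - c (inverse w) e e))"
    unfolding F_def by (rule cmean_inverse[symmetric])
  also have "\<dots> = cmean (\<lambda>w. small_root (?\<alpha> w) (?\<beta> w) (?N w))"
  proof (rule cmean_cong)
    fix w :: complex assume "norm w = 1"
    then have w: "w \<noteq> 0" by auto
    then have iw: "inverse w \<noteq> 0" by simp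
    have "a (inverse w) e e = (inverse w)\<^sup>2 * ?\<alpha> w" "b (inverse w) e e = inverse w * ?\<beta> w" "E - c (inverse w) e e = ?N w"
      using w by (simp_all add: coeff_defs power2_eq_square field_simps)
    then show "inverse w * small_root (a (inverse w) e e) (b (inverse w) e e) (E - c (inverse w) e e)
        = small_root (?\<alpha> w) (?\<beta> w) (?N w)"
      by (simp only: small_root_scale[OF iw])
  qed
  finally have F: "F E e e = cmean (\<lambda>w. small_root (?\<alpha> w) (?\<beta> w) (?N w))" .
  have "?\<alpha> 0 * (cmean (\<lambda>w. small_root (?\<alpha> w) (?\<beta> w) (?N w)))\<^sup>2
      + ?\<beta> 0 * cmean (\<lambda>w. small_root (?\<alpha> w) (?\<beta> w) (?N w)) = ?N 0"
  proof (rule cmean_small_root)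
    fix w :: complex assume w: "norm w < 2"
    show "norm (?\<alpha> w) \<le> 1/64" using e_small[OF e, of w] w by simp
    show "norm (?\<beta> w - 1) \<le> 1/16" using slope1[OF e, of w] w by simp
    show "norm (?N w) \<le> 4"
      using norm_triangle_ineq4[of E "A * e"] Ae[OF e] E by simp
  qed (intro holomorphic_intros)+
  then show ?thesis by (simp add: F b0_def)
qed

lemma g_eq_chi_x_zero:
  assumes v: "(h, 0, e) \<in> V"
  shows "g (h, 0, e) = chi h 0 e"
proof -
  have e: "norm (0::complex) < s" "norm e < s" "norm e < r" using v s by (auto simp: V_def)
  have "g (h, 0, e) = b0 0 e + 2 * (- e) * h"
    by (rule deriv_of_quadratic_relation[OF e(1,2) v F_x_zero[OF e(3)]])
  then show ?thesis by (simp add: chi_def)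
qed

lemma g_eq_chi_x_e:
  assumes v: "(h, e, e) \<in> V"
  shows "g (h, e, e) = chi h e e"
proof -
  have e: "norm e < s" "norm e < r" using v s by (auto simp: V_def)
  have "g (h, e, e) = b0 e e + 2 * e * h"
    by (rule deriv_of_quadratic_relation[OF e(1,1) v F_x_e[OF e(2)]])
  then show ?thesis by (simp add: chi_def)
qed

section \<open>Division by \<open>x * (x - e)\<close>\<close>

definition K :: "complex \<times> complex \<times> complex \<Rightarrow> complex" where
  "K v = g v - chi (fst v) (fst (snd v)) (snd (snd v))"

text \<open>Since \<open>2 * \<rho> < s\<close>, the map \<open>t\<close> to
  \<open>\<rho> * t\<close> sends \<open>ball 0 2\<close> into the parameter disc, so Cauchy's
  formula applies on the unit circle.\<close>

definition \<rho> :: real where "\<rho> = s / 4"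

text \<open>The Cauchy integral of \<open>K / (\<xi> * (\<xi> - e))\<close> over \<open>\<bar>\<xi>\<bar> = \<rho>\<close>; the factor \<open>\<xi>\<close> cancels against the
  measure of the circle mean.\<close>

definition k :: "complex \<times> complex \<times> complex \<Rightarrow> complex" where
  "k v = cmean (\<lambda>t. K (fst v, of_real \<rho> * t, snd (snd v)) / ((of_real \<rho> * t - snd (snd v)) * (of_real \<rho> * t - fst (snd v))))"

definition V' :: "(complex \<times> complex \<times> complex) set" where
  "V' = ball 0 (1/2) \<times> ball 0 \<rho> \<times> ball 0 \<rho>"

lemma rho: "0 < \<rho>" "2 * \<rho> < s"
  using s by (auto simp: \<rho>_def)

lemma rho_ne: "norm (t :: complex) = 1 \<Longrightarrow> norm x < \<rho> \<Longrightarrow> of_real \<rho> * t \<noteq> x"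
  using rho by (auto simp: norm_mult)

lemma K_cont: "continuous_on V K"
  using Gg_hol3(2) unfolding K_def chi_def b0_def
  by (auto simp: hol3_def intro!: continuous_intros)

lemma K_differentiable:
  assumes "(h, x, e) \<in> V"
  shows "(\<lambda>z. K (z, x, e)) field_differentiable at h" "(\<lambda>z. K (h, z, e)) field_differentiable at x"
    "(\<lambda>z. K (h, x, z)) field_differentiable at e"
  using Gg_hol3(2) assms unfolding K_def chi_def b0_def fst_conv snd_conv
  by (auto simp: hol3_def intro!: derivative_intros)

lemma k_hol3: "hol3 V' k"
  unfolding k_def[abs_def]
proof (rule hol3_cmean)
  show V': "open V'" unfolding V'_def by (intro open_Times open_ball)
  let ?f = "\<lambda>v t. K (fst v, of_real \<rho> * t, snd (snd v)) / ((of_real \<rho> * t - snd (snd v)) * (of_real \<rho> * t - fst (snd v)))"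
  have in_V: "(h, of_real \<rho> * t, e) \<in> V" if "(h, x, e) \<in> V'" "norm t = 1" for h x e t
    using that rho by (auto simp: V_def V'_def norm_mult)
  show cont: "continuous_on (V' \<times> sphere 0 1) (\<lambda>(v, t). ?f v t)"
    unfolding case_prod_unfold
  proof (intro continuous_intros)
    show "continuous_on (V' \<times> sphere 0 1) (\<lambda>y. K (fst (fst y), of_real \<rho> * snd y, snd (snd (fst y))))"
      by (rule continuous_on_compose2[OF K_cont]) (use in_V in \<open>auto intro!: continuous_intros\<close>)
  qed (auto simp: V'_def dest: rho_ne)
  fix t :: complex assume t: "norm t = 1"
  have "continuous_on V' (\<lambda>v. case (v, t) of (v, t) \<Rightarrow> ?f v t)"
    by (rule continuous_on_compose2[OF cont]) (use t in \<open>auto intro!: continuous_intros\<close>)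
  then have c: "continuous_on V' (\<lambda>v. ?f v t)" by simp
  show "hol3 V' (\<lambda>v. ?f v t)"
    unfolding hol3_def
  proof (intro conjI allI impI V' c)
    fix h x e assume v: "(h, x, e) \<in> V'"
    have n: "of_real \<rho> * t - e \<noteq> 0" "of_real \<rho> * t - x \<noteq> 0"
      using rho_ne[OF t] v by (auto simp: V'_def)
    note d = K_differentiable[OF in_V[OF v t]]
    show "(\<lambda>z. ?f (z, x, e) t) field_differentiable at h"
      unfolding fst_conv snd_conv using n by (intro derivative_intros d) auto
    show "(\<lambda>z. ?f (h, z, e) t) field_differentiable at x"
      unfolding fst_conv snd_conv using n by (intro derivative_intros d) auto
    show "(\<lambda>z. ?f (h, x, z) t) field_differentiable at e"
      unfolding fst_conv snd_conv using n by (intro derivative_intros d) auto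
  qed
qed

text \<open>Partial fractions with \<xi> for the integration point: \<open>x * (x - e) / ((\<xi> -
  e) * (\<xi> - x)) = x / (\<xi> - x) - (x / e) * (e / (\<xi> - e))\<close>. Weighted with
  \<open>K\<close>, each \<open>y / (\<xi> - y)\<close> has mean \<open>K\<close> at
  \<open>y\<close> minus \<open>K\<close> at 0, and \<open>K\<close> vanishes at 0 and at
  \<open>e\<close>.\<close>

lemma k_eq_nonzero:
  assumes v: "(h, x, e) \<in> V'" and e: "e \<noteq> 0"
  shows "K (h, x, e) = x * (x - e) * k (h, x, e)"
proof (cases "x = e")
  case True
  have "(h, e, e) \<in> V" using v rho by (auto simp: V_def V'_def)
  then show ?thesis using g_eq_chi_x_e[of h e] True by (simp add: K_def)
next
  case False
  have hxe: "norm h < 1/2" "norm x < \<rho>" "norm e < \<rho>" using v by (auto simp: V'_def)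
  let ?R = "of_real \<rho> :: complex"
  define L where "L = (\<lambda>t. K (h, ?R * t, e))"
  have R: "?R \<noteq> 0" using rho by simp
  have L: "L holomorphic_on ball 0 2"
    unfolding holomorphic_on_def
  proof
    fix t :: complex assume "t \<in> ball 0 2"
    then have "\<rho> * norm t < s"
      using rho mult_strict_left_mono[of "norm t" 2 \<rho>] unfolding mem_ball_0 by linarith
    then have "norm (?R * t) < s" using rho(1) by (simp add: norm_mult)
    then have "(h, ?R * t, e) \<in> V" using hxe rho by (auto simp: V_def)
    then have "(\<lambda>t. K (h, ?R * t, e)) field_differentiable at t"
      using field_differentiable_compose[of "\<lambda>t. ?R * t" t "\<lambda>z. K (h, z, e)"] K_differentiable(2)
      by (auto simp: o_def intro!: derivative_intros)
    then show "L field_differentiable at t within ball 0 2"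
      unfolding L_def by (rule field_differentiable_at_within)
  qed
  have L0: "L 0 = 0"
    using g_eq_chi_x_zero[of h e] hxe rho s by (simp add: L_def K_def V_def)
  have Le: "L (e / ?R) = 0"
    using g_eq_chi_x_e[of h e] hxe rho R by (simp add: L_def K_def V_def)
  have Lx: "L (x / ?R) = K (h, x, e)" using R by (simp add: L_def)
  have cauchy: "cmean (\<lambda>t. t * L t / (t - y / ?R)) = L (y / ?R)" if "norm y < \<rho>" for y
    using that rho by (intro cmean_Cauchy[OF L]) (auto simp: norm_divide)
  have Lc: "continuous_on (sphere 0 1) L"
    using holomorphic_on_imp_continuous_on[OF L] by (rule continuous_on_subset) auto
  have Cc: "continuous_on (sphere 0 1) (\<lambda>t. t * L t / (t - y / ?R))" if "norm y < \<rho>" for y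
    using rho_ne[OF _ that] R by (intro continuous_intros Lc) (auto simp: field_simps)
  have "x * (x - e) * k (h, x, e) = cmean (\<lambda>t. x * (x - e) * (L t / ((?R * t - e) * (?R * t - x))))"
    unfolding k_def L_def by (simp only: cmean_mult_left fst_conv snd_conv)
  also have "\<dots> = cmean (\<lambda>t. (t * L t / (t - x / ?R) - L t) - (x / e) * (t * L t / (t - e / ?R) - L t))"
  proof (rule cmean_cong)
    fix t :: complex assume t: "norm t = 1"
    have n: "?R * t - e \<noteq> 0" "?R * t - x \<noteq> 0" using rho_ne[OF t] hxe by auto
    have sx: "t * L t / (t - y / ?R) - L t = y * L t / (?R * t - y)" if "?R * t - y \<noteq> 0" for y
    proof -
      have "t - y / ?R = (?R * t - y) / ?R" using R by (simp add: field_simps)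
      then have "t * L t / (t - y / ?R) = ?R * t * L t / (?R * t - y)" by simp
      also have "\<dots> - L t = (?R * t * L t - L t * (?R * t - y)) / (?R * t - y)"
        using that by (simp add: diff_divide_distrib)
      also have "\<dots> = y * L t / (?R * t - y)" by (simp add: algebra_simps)
      finally show ?thesis .
    qed
    have "x * L t / (?R * t - x) - (x / e) * (e * L t / (?R * t - e))
        = x * L t * (1 / (?R * t - x) - 1 / (?R * t - e))"
      using e by (simp add: algebra_simps)
    also have "1 / (?R * t - x) - 1 / (?R * t - e) = (x - e) / ((?R * t - e) * (?R * t - x))"
      using n by (simp add: diff_frac_eq mult.commute)
    finally show "x * (x - e) * (L t / ((?R * t - e) * (?R * t - x))) =
        (t * L t / (t - x / ?R) - L t) - (x / e) * (t * L t / (t - e / ?R) - L t)"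
      by (simp add: sx[OF n(1)] sx[OF n(2)] mult_ac)
  qed
  also have "\<dots> = cmean (\<lambda>t. t * L t / (t - x / ?R) - L t) - cmean (\<lambda>t. (x / e) * (t * L t / (t - e / ?R) - L t))"
    by (rule cmean_diff; intro continuous_on_diff continuous_on_mult continuous_on_const Cc Lc hxe)
  also have "\<dots> = (cmean (\<lambda>t. t * L t / (t - x / ?R)) - cmean L) - (x / e) * (cmean (\<lambda>t. t * L t / (t - e / ?R)) - cmean L)"
    unfolding cmean_mult_left cmean_diff[OF Cc[OF hxe(2)] Lc] cmean_diff[OF Cc[OF hxe(3)] Lc] ..
  also have "\<dots> = K (h, x, e)"
    unfolding cauchy[OF hxe(2)] cauchy[OF hxe(3)] Lx Le using cmean_mean_value[OF L] L0 by simp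
  finally show ?thesis ..
qed

text \<open>At \<^term>\<open>e = 0\<close> the zeros of \<^const>\<open>K\<close> at \<^term>\<open>x = 0\<close> and \<^term>\<open>x = e\<close> collide, so this case is
  obtained by continuity.\<close>

lemma k_eq:
  assumes v: "(h, x, e) \<in> V'"
  shows "K (h, x, e) = x * (x - e) * k (h, x, e)"
proof (cases "e = 0")
  case True
  have hx: "norm h < 1/2" "norm x < \<rho>" using v by (auto simp: V'_def)
  let ?d = "\<lambda>e. K (h, x, e) - x * (x - e) * k (h, x, e)"
  have "continuous_on (ball 0 \<rho>) ?d"
  proof (intro continuous_intros)
    show "continuous_on (ball 0 \<rho>) (\<lambda>e. K (h, x, e))"
      by (rule continuous_on_compose2[OF K_cont]) (use hx rho in \<open>auto simp: V_def intro!: continuous_intros\<close>)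
    have "continuous_on V' k" using k_hol3 by (simp add: hol3_def)
    then show "continuous_on (ball 0 \<rho>) (\<lambda>e. k (h, x, e))"
      by (rule continuous_on_compose2) (use hx in \<open>auto simp: V'_def intro!: continuous_intros\<close>)
  qed
  then have "isCont ?d 0" using rho by (simp add: continuous_on_eq_continuous_at)
  then have "(?d \<longlongrightarrow> ?d 0) (at 0)" by (simp add: isCont_def)
  moreover have "(?d \<longlongrightarrow> 0) (at 0)"
  proof (rule tendsto_eventually)
    have "\<forall>\<^sub>F e in at 0. e \<in> ball 0 \<rho> \<and> e \<noteq> (0 :: complex)"
      using rho by (intro eventually_conj eventually_at_in_open' eventually_neq_at_within) auto
    then show "\<forall>\<^sub>F e in at 0. ?d e = 0"
      by eventually_elim (use k_eq_nonzero hx in \<open>auto simp: V'_def\<close>)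
  qed
  ultimately have "?d 0 = 0" using LIM_unique by blast
  then show ?thesis using True by simp
qed (rule k_eq_nonzero[OF v])

end

theorem mainTheorem5:
  fixes \<theta>0 \<theta>1 \<theta>inf :: complex
  shows "formal_invariant (H_conf \<theta>0 \<theta>1 \<theta>inf)
           (\<lambda>h x e. 1 - e - (x - e) * \<theta>0 - x * (\<theta>0 + \<theta>1) + 2 * (2 * x - e) * h)"
proof -
  define A where "A = ((\<theta>0 + \<theta>1)^2 - \<theta>inf^2) / 4"
  interpret fam: confluent_family \<theta>0 "\<theta>0 + \<theta>1" A .
  obtain r where r: "confluent_disc \<theta>0 (\<theta>0 + \<theta>1) A r"
    and r': "\<And>e q :: complex. norm e < r \<Longrightarrow> norm q \<le> 2 \<Longrightarrow> norm (e * (1 - q)) \<le> 1/64"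
    "\<And>e q. norm e < r \<Longrightarrow> norm q \<le> 2 \<Longrightarrow> norm (1 - e + e * \<theta>0 - e * (\<theta>0 + \<theta>1) * q - 1) \<le> 1/16"
    "\<And>e q. norm e < r \<Longrightarrow> norm q \<le> 2 \<Longrightarrow> norm (1 - e - e * (\<theta>0 + \<theta>1) + e * \<theta>0 * q - 1) \<le> 1/16"
    "\<And>e q. norm e < r \<Longrightarrow> norm q \<le> 2 \<Longrightarrow> norm (A * e * q) \<le> 1/16"
    "\<And>e. norm e < r \<Longrightarrow> norm (A * e) \<le> 1/16"
  proof (rule fam.small_coefficients, goal_cases)
    case (1 r)
    show thesis
    proof (rule that[of r])
      show "confluent_disc \<theta>0 (\<theta>0 + \<theta>1) A r" by unfold_locales (fact 1)+
    qed (fact 1)+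
  qed
  interpret disc: confluent_disc \<theta>0 "\<theta>0 + \<theta>1" A r by (rule r)
  obtain s where "confluent_small \<theta>0 (\<theta>0 + \<theta>1) A r s"
  proof (rule disc.small_radius, goal_cases)
    case (1 s)
    show thesis
      by (rule that[of s], unfold_locales) (fact 1)+
  qed
  then interpret fin: confluent_slices \<theta>0 "\<theta>0 + \<theta>1" A r s
    by (intro confluent_slices.intro confluent_slices_axioms.intro r')
  have H: "H_conf \<theta>0 \<theta>1 \<theta>inf (q, p) x e = fam.H q p x e" for q p x e
    unfolding H_conf_def A_def[symmetric] fam.H_def fam.coeff_defs by (simp add: power_mult_distrib algebra_simps)
  \<comment> \<open>The charts are picked separately for each \<open>(x, e)\<close>; only
    \<open>G\<close> and the centre are given by formulas uniform in the parameters.\<close>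
  have "birkhoff_normal_form (H_conf \<theta>0 \<theta>1 \<theta>inf) fin.G"
    unfolding birkhoff_normal_form_def
  proof (intro exI conjI)
    show "hol3 fin.V fin.G" by (rule fin.Gg_hol3)
    show "(0, 0, 0) \<in> fin.V" "s > 0" using fin.s by (auto simp: fin.V_def)
    let ?c = "\<lambda>y. (fam.qcrit (fst y) (snd y), fam.pcrit (fst y) (snd y))"
    have "{(x, e). norm x < s \<and> norm e < s} \<subseteq> ball (0::complex) r \<times> ball (0::complex) r"
      using fin.s by auto
    then show "continuous_on {(x, e). norm x < s \<and> norm e < s} ?c"
      by (intro continuous_on_Pair continuous_on_subset[OF disc.qcrit_continuous]
          continuous_on_subset[OF disc.pcrit_continuous])
    show "?c (0, 0) = (0, 0)" by (simp add: disc.critical_point_zero)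
    show "\<forall>x e. norm x < s \<and> norm e < s \<longrightarrow>
        (\<exists>U \<Phi>1 \<Phi>2. ?c (x, e) \<in> U \<and> symplectic_chart U \<Phi>1 \<Phi>2 \<and>
          \<Phi>1 (?c (x, e)) = 0 \<and> \<Phi>2 (?c (x, e)) = 0 \<and>
          (\<forall>y\<in>U. (\<Phi>1 y * \<Phi>2 y, x, e) \<in> fin.V \<and>
             H_conf \<theta>0 \<theta>1 \<theta>inf y x e = fin.G (\<Phi>1 y * \<Phi>2 y, x, e)))"
    proof (intro allI impI, elim conjE)
      fix x e :: complex assume xe: "norm x < s" "norm e < s"
      from fin.normal_form_chart[OF this] obtain U \<Phi>1 \<Phi>2 where
        U: "(fam.qcrit x e, fam.pcrit x e) \<in> U" "symplectic_chart U \<Phi>1 \<Phi>2"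
        "\<Phi>1 (fam.qcrit x e, fam.pcrit x e) = 0" "\<Phi>2 (fam.qcrit x e, fam.pcrit x e) = 0"
        "\<And>q p. (q, p) \<in> U \<Longrightarrow> (\<Phi>1 (q, p) * \<Phi>2 (q, p), x, e) \<in> fin.V \<and>
          fam.H q p x e = fin.G (\<Phi>1 (q, p) * \<Phi>2 (q, p), x, e)"
        by metis
      show "\<exists>U \<Phi>1 \<Phi>2. ?c (x, e) \<in> U \<and> symplectic_chart U \<Phi>1 \<Phi>2 \<and>
          \<Phi>1 (?c (x, e)) = 0 \<and> \<Phi>2 (?c (x, e)) = 0 \<and>
          (\<forall>y\<in>U. (\<Phi>1 y * \<Phi>2 y, x, e) \<in> fin.V \<and>
             H_conf \<theta>0 \<theta>1 \<theta>inf y x e = fin.G (\<Phi>1 y * \<Phi>2 y, x, e))"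
        using U by (intro exI[of _ U] exI[of _ \<Phi>1] exI[of _ \<Phi>2]) (auto simp: H)
    qed
  qed
  moreover have "hol3 fin.V' fin.k" "(0, 0, 0) \<in> fin.V'"
    using fin.k_hol3 fin.rho by (auto simp: fin.V'_def)
  moreover have "deriv (\<lambda>t. fin.G (t, x, e)) h -
      (1 - e - (x - e) * \<theta>0 - x * (\<theta>0 + \<theta>1) + 2 * (2 * x - e) * h) = x * (x - e) * fin.k (h, x, e)"
    if "(h, x, e) \<in> fin.V'" for h x e
  proof -
    have "(h, x, e) \<in> fin.V" using that fin.rho by (auto simp: fin.V_def fin.V'_def)
    then show ?thesis
      using fin.k_eq[OF that] by (simp add: fin.deriv_G fin.K_def fin.chi_def fam.b0_def)
  qed
  moreover have "\<exists>chi0 chi1. \<forall>h x e. 1 - e - (x - e) * \<theta>0 - x * (\<theta>0 + \<theta>1) + 2 * (2 * x - e) * h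
      = chi0 h e + x * chi1 h e"
    \<comment> \<open>Obtained by collecting powers of \<open>x\<close> in the stated
      formula.\<close>
    by (intro exI[of _ "\<lambda>h e. 1 - e + e * \<theta>0 - 2 * e * h"] exI[of _ "\<lambda>h e. - \<theta>0 - (\<theta>0 + \<theta>1) + 4 * h"])
       (simp add: algebra_simps)
  ultimately show ?thesis
    unfolding formal_invariant_def by blast
qed

end
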